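(* Let $\Gamma$ be a group of type $\mathrm{FP}_\infty(\mathbb Q)$ and let $\sigma$ be a unitary representation of $\Gamma$. Fix a degree $q$, and assume that $H^q(\Gamma;\sigma)\neq0$. Let $\pi$ be a unitary representation of $\Gamma$ that weakly contains $\sigma$. Then at least one of the following occurs: (1) $\bar H^q(\Gamma;\pi)\neq0$; (2) $\mathring H^q(\Gamma;\pi)\neq0$; (3) $\mathring H^{q+1}(\Gamma;\pi)\neq0$. In other words, $H^q(\Gamma;\pi)\ne 0$ or $H^{q+1}(\Gamma;\pi)\neq 0$, and if $H^q(\Gamma;\pi)=0$ then $H^{q+1}(\Gamma;\pi)$ has non-zero torsion cohomology.
   Context: $\Gamma$ is a countable discrete group. It is of type $\mathrm{FP}_\infty(\mathbb Q)$ if the trivial $\mathbb Q[\Gamma]$-module $\mathbb Q$ has a projective resolution that is finitely generated in every degree. Unitary representations are on separable Hilbert spaces. $H^q(\Gamma;\pi)$ is group cohomology with coefficients in the Hilbert space $V$ of $\pi$, computed by the inhomogeneous cochains $C(\Gamma^q,V)$ with the topology of pointwise convergence, and carries the (possibly non-Hausdorff) subquotient topology (the topology does not depend on the chosen strong relatively injective resolution). The torsion cohomology $\mathring H^q(\Gamma;\pi)$ is the closure of $\{0\}$ in $H^q(\Gamma;\pi)$, and the Hausdorff cohomology is $\bar H^q(\Gamma;\pi)=H^q(\Gamma;\pi)/\overline{\{0\}}$. $\pi$ weakly contains $\sigma$ if $\|\sigma(f)\|\le\|\pi(f)\|$ for all $f\in\ell^1(\Gamma)$. *)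

theory Defs
  imports "HOL-Analysis.Analysis" "HOL-Algebra.Module" "HOL-Algebra.Coset"
begin

section \<open>Complex Hilbert spaces and unitary representations\<close>

text \<open>The inner product is linear in its first argument. Positive definiteness
  is a consequence of \<open>cinner_norm\<close>, since the norm is one.\<close>

class complex_hilbert_space = banach +
  fixes scaleC :: "complex \<Rightarrow> 'a \<Rightarrow> 'a" (infixr \<open>*\<^sub>C\<close> 75)
    and cinner :: "'a \<Rightarrow> 'a \<Rightarrow> complex"
  assumes scaleC_add_right: "c *\<^sub>C (x + y) = c *\<^sub>C x + c *\<^sub>C y"
    and scaleC_add_left: "(c + d) *\<^sub>C x = c *\<^sub>C x + d *\<^sub>C x"
    and scaleC_scaleC: "c *\<^sub>C (d *\<^sub>C x) = (c * d) *\<^sub>C x"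
    and scaleC_of_real: "of_real r *\<^sub>C x = r *\<^sub>R x"
    and cinner_add_left: "cinner (x + y) z = cinner x z + cinner y z"
    and cinner_scaleC_left: "cinner (c *\<^sub>C x) y = c * cinner x y"
    and cinner_commute: "cinner x y = cnj (cinner y x)"
    and cinner_norm: "cinner x x = of_real ((norm x)\<^sup>2)"

class separable_complex_hilbert_space = complex_hilbert_space +
  assumes separable: "\<exists>D. countable D \<and> (\<forall>U. open U \<longrightarrow> U \<noteq> {} \<longrightarrow> (\<exists>d\<in>D. d \<in> U))"

definition unitary_operator :: "('v::complex_hilbert_space \<Rightarrow> 'v) \<Rightarrow> bool" where
  "unitary_operator U \<longleftrightarrow>
     (\<forall>x y. U (x + y) = U x + U y) \<and> (\<forall>c x. U (c *\<^sub>C x) = c *\<^sub>C U x) \<and>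
     (\<forall>x y. cinner (U x) (U y) = cinner x y) \<and> surj U"

definition unitary_group :: "('v::complex_hilbert_space \<Rightarrow> 'v) monoid" where
  "unitary_group = \<lparr>carrier = {U. unitary_operator U}, mult = (\<circ>), one = id\<rparr>"

definition unitary_rep ::
    "('g, 'x) monoid_scheme \<Rightarrow> ('g \<Rightarrow> 'v::complex_hilbert_space \<Rightarrow> 'v) \<Rightarrow> bool" where
  "unitary_rep G \<pi> \<longleftrightarrow> \<pi> \<in> hom G unitary_group"

definition l1_functions :: "('g, 'x) monoid_scheme \<Rightarrow> ('g \<Rightarrow> complex) set" where
  "l1_functions G = {f. (\<lambda>g. norm (f g)) summable_on carrier G}"

text \<open>The operator \<open>\<pi>(f)\<close>, i.e. the sum of all \<open>f(g) \<pi>(g)\<close>.\<close>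

definition l1_operator ::
    "('g, 'x) monoid_scheme \<Rightarrow> ('g \<Rightarrow> 'v::complex_hilbert_space \<Rightarrow> 'v)
      \<Rightarrow> ('g \<Rightarrow> complex) \<Rightarrow> 'v \<Rightarrow> 'v" where
  "l1_operator G \<pi> f v = (\<Sum>\<^sub>\<infinity>g\<in>carrier G. f g *\<^sub>C \<pi> g v)"

definition weakly_contains ::
    "('g, 'x) monoid_scheme \<Rightarrow> ('g \<Rightarrow> 'v::complex_hilbert_space \<Rightarrow> 'v)
      \<Rightarrow> ('g \<Rightarrow> 'w::complex_hilbert_space \<Rightarrow> 'w) \<Rightarrow> bool" where
  "weakly_contains G \<pi> \<sigma> \<longleftrightarrow>
     (\<forall>f \<in> l1_functions G. onorm (l1_operator G \<sigma> f) \<le> onorm (l1_operator G \<pi> f))"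


section \<open>Projective resolutions over the rational group ring\<close>

definition rat_group_ring :: "('g, 'x) monoid_scheme \<Rightarrow> ('g \<Rightarrow> rat) ring" where
  "rat_group_ring G =
    \<lparr>carrier = {a. finite {g. a g \<noteq> 0} \<and> {g. a g \<noteq> 0} \<subseteq> carrier G},
     mult = (\<lambda>a b g. if g \<in> carrier G
               then \<Sum>h | h \<in> carrier G \<and> a h \<noteq> 0. a h * b (inv\<^bsub>G\<^esub> h \<otimes>\<^bsub>G\<^esub> g) else 0),
     one = (\<lambda>g. if g = \<one>\<^bsub>G\<^esub> then 1 else 0),
     zero = (\<lambda>_. 0),
     add = (\<lambda>a b g. a g + b g)\<rparr>"

text \<open>The locale \<open>module\<close> of HOL-Algebra demands a commutative ring of scalars;
  here is the same notion over an arbitrary ring.\<close>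

locale left_module = R?: ring R + M?: abelian_group M
  for R (structure) and M :: "('r, 'm, 'y) module_scheme" (structure) +
  assumes smult_closed:
      "\<lbrakk>a \<in> carrier R; x \<in> carrier M\<rbrakk> \<Longrightarrow> a \<odot>\<^bsub>M\<^esub> x \<in> carrier M"
    and smult_l_distr:
      "\<lbrakk>a \<in> carrier R; b \<in> carrier R; x \<in> carrier M\<rbrakk> \<Longrightarrow>
       (a \<oplus>\<^bsub>R\<^esub> b) \<odot>\<^bsub>M\<^esub> x = a \<odot>\<^bsub>M\<^esub> x \<oplus>\<^bsub>M\<^esub> b \<odot>\<^bsub>M\<^esub> x"
    and smult_r_distr:
      "\<lbrakk>a \<in> carrier R; x \<in> carrier M; y \<in> carrier M\<rbrakk> \<Longrightarrow>
       a \<odot>\<^bsub>M\<^esub> (x \<oplus>\<^bsub>M\<^esub> y) = a \<odot>\<^bsub>M\<^esub> x \<oplus>\<^bsub>M\<^esub> a \<odot>\<^bsub>M\<^esub> y"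
    and smult_assoc:
      "\<lbrakk>a \<in> carrier R; b \<in> carrier R; x \<in> carrier M\<rbrakk> \<Longrightarrow>
       (a \<otimes>\<^bsub>R\<^esub> b) \<odot>\<^bsub>M\<^esub> x = a \<odot>\<^bsub>M\<^esub> (b \<odot>\<^bsub>M\<^esub> x)"
    and smult_one: "x \<in> carrier M \<Longrightarrow> \<one>\<^bsub>R\<^esub> \<odot>\<^bsub>M\<^esub> x = x"

definition module_hom ::
    "('r, 'x) ring_scheme \<Rightarrow> ('r, 'm, 'y) module_scheme \<Rightarrow> ('r, 'n, 'z) module_scheme
      \<Rightarrow> ('m \<Rightarrow> 'n) set" where
  "module_hom R M N = {f \<in> carrier M \<rightarrow> carrier N.
     (\<forall>x\<in>carrier M. \<forall>y\<in>carrier M. f (x \<oplus>\<^bsub>M\<^esub> y) = f x \<oplus>\<^bsub>N\<^esub> f y) \<and>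
     (\<forall>a\<in>carrier R. \<forall>x\<in>carrier M. f (a \<odot>\<^bsub>M\<^esub> x) = a \<odot>\<^bsub>N\<^esub> f x)}"

definition finitely_generated_module ::
    "('r, 'x) ring_scheme \<Rightarrow> ('r, 'm, 'y) module_scheme \<Rightarrow> bool" where
  "finitely_generated_module R M \<longleftrightarrow>
     (\<exists>S \<subseteq> carrier M. finite S \<and>
        (\<forall>x\<in>carrier M. \<exists>c \<in> S \<rightarrow> carrier R. x = finsum M (\<lambda>s. c s \<odot>\<^bsub>M\<^esub> s) S))"

text \<open>The lifting property. Bounding the types of the test modules \<open>M\<close> and \<open>N\<close>
  loses nothing: they admit \<open>N = P\<close> and as \<open>M\<close> the free module on the carrier of
  \<open>P\<close> (finitely supported functions into \<open>R\<close>), so that \<open>P\<close> is a direct summand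
  of a free module, whence the lifting property holds in every universe.\<close>

definition projective_module ::
    "('r, 'x) ring_scheme \<Rightarrow> ('r, 'm) module \<Rightarrow> bool" where
  "projective_module R P \<longleftrightarrow> left_module R P \<and>
     (\<forall>(M :: ('r, 'm \<Rightarrow> 'r) module) (N :: ('r, 'm) module) p f.
        left_module R M \<and> left_module R N \<and>
        p \<in> module_hom R M N \<and> p ` carrier M = carrier N \<and> f \<in> module_hom R P N \<longrightarrow>
        (\<exists>h \<in> module_hom R P M. \<forall>x\<in>carrier P. p (h x) = f x))"

definition projective_resolution ::
    "('r, 'x) ring_scheme \<Rightarrow> ('r, 'n) module \<Rightarrow> (nat \<Rightarrow> ('r, 'm) module)
      \<Rightarrow> (nat \<Rightarrow> 'm \<Rightarrow> 'm) \<Rightarrow> ('m \<Rightarrow> 'n) \<Rightarrow> bool" where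
  "projective_resolution R N P d \<epsilon> \<longleftrightarrow>
     (\<forall>n. projective_module R (P n)) \<and>
     \<epsilon> \<in> module_hom R (P 0) N \<and>
     (\<forall>n. d n \<in> module_hom R (P (Suc n)) (P n)) \<and>
     \<epsilon> ` carrier (P 0) = carrier N \<and>
     d 0 ` carrier (P 1) = {x \<in> carrier (P 0). \<epsilon> x = \<zero>\<^bsub>N\<^esub>} \<and>
     (\<forall>n. d (Suc n) ` carrier (P (Suc (Suc n)))
          = {x \<in> carrier (P (Suc n)). d n x = \<zero>\<^bsub>P n\<^esub>})"

text \<open>In the record \<open>module\<close> the fields \<open>mult\<close> and \<open>one\<close> play no role.\<close>

definition trivial_rat_module :: "('g \<Rightarrow> rat, rat) module" where
  "trivial_rat_module =
    \<lparr>carrier = UNIV, mult = (*), one = 1, zero = 0, add = (+),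
     smult = (\<lambda>a x. (\<Sum>g | a g \<noteq> 0. a g) * x)\<rparr>"

text \<open>Type \<open>FP\<^sub>\<infinity>\<close> over the rationals. HOL cannot quantify over types inside
  a formula, so the type \<open>'m\<close> in which the modules of the resolution live is a
  parameter; a theorem assuming this for a free type variable \<open>'m\<close> covers
  resolutions in any universe.\<close>

definition type_FP_infinity_rat :: "'m itself \<Rightarrow> ('g, 'x) monoid_scheme \<Rightarrow> bool" where
  "type_FP_infinity_rat _ G \<longleftrightarrow>
     (\<exists>(P :: nat \<Rightarrow> ('g \<Rightarrow> rat, 'm) module) d \<epsilon>.
        projective_resolution (rat_group_ring G) trivial_rat_module P d \<epsilon> \<and>
        (\<forall>n. finitely_generated_module (rat_group_ring G) (P n)))"


section \<open>Group cohomology by inhomogeneous cochains\<close>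

definition group_power :: "('g, 'x) monoid_scheme \<Rightarrow> nat \<Rightarrow> 'g list set" where
  "group_power G q = {gs. length gs = q \<and> set gs \<subseteq> carrier G}"

text \<open>A cochain is an arbitrary function on \<open>G\<^sup>q\<close>, represented by its extension with
  value \<open>undefined\<close>; the product topology is that of pointwise convergence.\<close>

definition cochain_topology ::
    "('g, 'x) monoid_scheme \<Rightarrow> nat \<Rightarrow> ('g list \<Rightarrow> 'v::complex_hilbert_space) topology" where
  "cochain_topology G q = product_topology (\<lambda>_. euclidean) (group_power G q)"

definition cochain_group ::
    "('g, 'x) monoid_scheme \<Rightarrow> nat \<Rightarrow> ('g list \<Rightarrow> 'v::complex_hilbert_space) monoid" where
  "cochain_group G q =
    \<lparr>carrier = (\<Pi>\<^sub>E gs\<in>group_power G q. UNIV),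
     mult = (\<lambda>c d. \<lambda>gs\<in>group_power G q. c gs + d gs),
     one = (\<lambda>gs\<in>group_power G q. 0)\<rparr>"

definition merge_at :: "('g, 'x) monoid_scheme \<Rightarrow> nat \<Rightarrow> 'g list \<Rightarrow> 'g list" where
  "merge_at G i gs = take (i - 1) gs @ (gs ! (i - 1) \<otimes>\<^bsub>G\<^esub> gs ! i) # drop (i + 1) gs"

text \<open>
  \<open>(\<delta> c)(g\<^sub>1,\<dots>,g\<^sub>q\<^sub>+\<^sub>1) = \<pi>(g\<^sub>1) c(g\<^sub>2,\<dots>,g\<^sub>q\<^sub>+\<^sub>1)
     + \<Sum>\<^sub>i (-1)\<^sup>i c(g\<^sub>1,\<dots>,g\<^sub>i g\<^sub>i\<^sub>+\<^sub>1,\<dots>,g\<^sub>q\<^sub>+\<^sub>1) + (-1)\<^sup>q\<^sup>+\<^sup>1 c(g\<^sub>1,\<dots>,g\<^sub>q)\<close>,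
  with \<open>1 \<le> i \<le> q\<close>.\<close>

definition coboundary ::
    "('g, 'x) monoid_scheme \<Rightarrow> ('g \<Rightarrow> 'v::complex_hilbert_space \<Rightarrow> 'v) \<Rightarrow> nat
      \<Rightarrow> ('g list \<Rightarrow> 'v) \<Rightarrow> 'g list \<Rightarrow> 'v" where
  "coboundary G \<pi> q c = (\<lambda>gs\<in>group_power G (Suc q).
     \<pi> (hd gs) (c (tl gs)) + (\<Sum>i=1..q. (-1) ^ i *\<^sub>R c (merge_at G i gs))
       + (-1) ^ Suc q *\<^sub>R c (butlast gs))"

definition cocycles ::
    "('g, 'x) monoid_scheme \<Rightarrow> ('g \<Rightarrow> 'v::complex_hilbert_space \<Rightarrow> 'v) \<Rightarrow> nat
      \<Rightarrow> ('g list \<Rightarrow> 'v) set" where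
  "cocycles G \<pi> q =
     {c \<in> carrier (cochain_group G q). coboundary G \<pi> q c = \<one>\<^bsub>cochain_group G (Suc q)\<^esub>}"

fun coboundaries ::
    "('g, 'x) monoid_scheme \<Rightarrow> ('g \<Rightarrow> 'v::complex_hilbert_space \<Rightarrow> 'v) \<Rightarrow> nat
      \<Rightarrow> ('g list \<Rightarrow> 'v) set" where
  "coboundaries G \<pi> 0 = {\<one>\<^bsub>cochain_group G 0\<^esub>}"
| "coboundaries G \<pi> (Suc q) = coboundary G \<pi> q ` carrier (cochain_group G q)"

definition cocycle_group ::
    "('g, 'x) monoid_scheme \<Rightarrow> ('g \<Rightarrow> 'v::complex_hilbert_space \<Rightarrow> 'v) \<Rightarrow> nat
      \<Rightarrow> ('g list \<Rightarrow> 'v) monoid" where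
  "cocycle_group G \<pi> q = (cochain_group G q)\<lparr>carrier := cocycles G \<pi> q\<rparr>"

text \<open>Cohomology is formed as a quotient of (multiplicatively written) abelian
  groups; its elements are cosets of coboundaries and its zero element is \<open>\<one>\<close>.\<close>

definition cohomology ::
    "('g, 'x) monoid_scheme \<Rightarrow> ('g \<Rightarrow> 'v::complex_hilbert_space \<Rightarrow> 'v) \<Rightarrow> nat
      \<Rightarrow> ('g list \<Rightarrow> 'v) set monoid" where
  "cohomology G \<pi> q = cocycle_group G \<pi> q Mod coboundaries G \<pi> q"

definition quotient_topology :: "'a topology \<Rightarrow> ('a \<Rightarrow> 'b) \<Rightarrow> 'b topology" where
  "quotient_topology X f =
     topology (\<lambda>U. U \<subseteq> f ` topspace X \<and> openin X {x \<in> topspace X. f x \<in> U})"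

lemma openin_quotient_topology:
  "openin (quotient_topology X f) U \<longleftrightarrow>
     U \<subseteq> f ` topspace X \<and> openin X {x \<in> topspace X. f x \<in> U}"
proof -
  have "istopology (\<lambda>U. U \<subseteq> f ` topspace X \<and> openin X {x \<in> topspace X. f x \<in> U})"
    unfolding istopology_def
  proof (intro conjI allI impI)
    fix S T
    assume S: "S \<subseteq> f ` topspace X \<and> openin X {x \<in> topspace X. f x \<in> S}"
      and T: "T \<subseteq> f ` topspace X \<and> openin X {x \<in> topspace X. f x \<in> T}"
    show "S \<inter> T \<subseteq> f ` topspace X" using S by blast
    have "{x \<in> topspace X. f x \<in> S \<inter> T}
        = {x \<in> topspace X. f x \<in> S} \<inter> {x \<in> topspace X. f x \<in> T}" by blast
    then show "openin X {x \<in> topspace X. f x \<in> S \<inter> T}" using S T by (simp add: openin_Int)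
  next
    fix K
    assume K: "\<forall>S\<in>K. S \<subseteq> f ` topspace X \<and> openin X {x \<in> topspace X. f x \<in> S}"
    show "\<Union>K \<subseteq> f ` topspace X" using K by blast
    have "{x \<in> topspace X. f x \<in> \<Union>K} = (\<Union>S\<in>K. {x \<in> topspace X. f x \<in> S})" by blast
    then show "openin X {x \<in> topspace X. f x \<in> \<Union>K}" using K by auto
  qed
  then show ?thesis by (simp add: quotient_topology_def)
qed

lemma quotient_map_quotient_topology: "quotient_map X (quotient_topology X f) f"
proof -
  have "openin (quotient_topology X f) (f ` topspace X)"
    by (simp add: openin_quotient_topology) (metis (mono_tags, lifting) Collect_cong
        Collect_mem_eq image_eqI openin_topspace)
  then have "topspace (quotient_topology X f) = f ` topspace X"
    by (meson openin_quotient_topology openin_subset openin_topspace subset_antisym)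
  then show ?thesis
    by (auto simp: quotient_map_def openin_quotient_topology)
qed

definition cohomology_topology ::
    "('g, 'x) monoid_scheme \<Rightarrow> ('g \<Rightarrow> 'v::complex_hilbert_space \<Rightarrow> 'v) \<Rightarrow> nat
      \<Rightarrow> ('g list \<Rightarrow> 'v) set topology" where
  "cohomology_topology G \<pi> q =
     quotient_topology (subtopology (cochain_topology G q) (cocycles G \<pi> q))
       (\<lambda>c. coboundaries G \<pi> q #>\<^bsub>cocycle_group G \<pi> q\<^esub> c)"

definition torsion_cohomology ::
    "('g, 'x) monoid_scheme \<Rightarrow> ('g \<Rightarrow> 'v::complex_hilbert_space \<Rightarrow> 'v) \<Rightarrow> nat
      \<Rightarrow> ('g list \<Rightarrow> 'v) set set" where
  "torsion_cohomology G \<pi> q =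
     cohomology_topology G \<pi> q closure_of {\<one>\<^bsub>cohomology G \<pi> q\<^esub>}"

definition hausdorff_cohomology ::
    "('g, 'x) monoid_scheme \<Rightarrow> ('g \<Rightarrow> 'v::complex_hilbert_space \<Rightarrow> 'v) \<Rightarrow> nat
      \<Rightarrow> ('g list \<Rightarrow> 'v) set set monoid" where
  "hausdorff_cohomology G \<pi> q = cohomology G \<pi> q Mod torsion_cohomology G \<pi> q"

definition cohomology_nonzero ::
    "('g, 'x) monoid_scheme \<Rightarrow> ('g \<Rightarrow> 'v::complex_hilbert_space \<Rightarrow> 'v) \<Rightarrow> nat \<Rightarrow> bool" where
  "cohomology_nonzero G \<pi> q \<longleftrightarrow>
     carrier (cohomology G \<pi> q) \<noteq> {\<one>\<^bsub>cohomology G \<pi> q\<^esub>}"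

definition torsion_cohomology_nonzero ::
    "('g, 'x) monoid_scheme \<Rightarrow> ('g \<Rightarrow> 'v::complex_hilbert_space \<Rightarrow> 'v) \<Rightarrow> nat \<Rightarrow> bool" where
  "torsion_cohomology_nonzero G \<pi> q \<longleftrightarrow>
     torsion_cohomology G \<pi> q \<noteq> {\<one>\<^bsub>cohomology G \<pi> q\<^esub>}"

definition hausdorff_cohomology_nonzero ::
    "('g, 'x) monoid_scheme \<Rightarrow> ('g \<Rightarrow> 'v::complex_hilbert_space \<Rightarrow> 'v) \<Rightarrow> nat \<Rightarrow> bool" where
  "hausdorff_cohomology_nonzero G \<pi> q \<longleftrightarrow>
     carrier (hausdorff_cohomology G \<pi> q) \<noteq> {\<one>\<^bsub>hausdorff_cohomology G \<pi> q\<^esub>}"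

end

theory Submission
  imports Defs "HOL-Library.Poly_Mapping" "HOL-Library.Function_Algebras"
begin

text \<open>
  The proof is Hodge theory on a resolution of finite type. Let \<open>P\<close> be a resolution of the trivial
  module by finitely generated projectives. An equivariant map from \<open>P\<^sub>n\<close> to the Hilbert space \<open>V\<close> of a
  representation is determined by finitely many values, and so the cohomology \<open>H\<^sup>q(\<Gamma>;V)\<close> becomes
  \<open>ker B / im A\<close> for two bounded operators between finite powers of \<open>V\<close>; both are given by matrices
  over the rational group ring, and these matrices do not depend on the representation. They are found
  in \<open>finite_resolution_exists\<close>, which rewrites \<open>P\<close> in coordinates. That this complex
  computes the cohomology of inhomogeneous cochains, and that it detects whether coboundaries are
  closed for pointwise convergence, follows from the comparison with the bar resolution
  (\<open>chain_map_exists\<close>, \<open>chain_homotopy_exists\<close>): the two resolutions are homotopy equivalent and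
  all the induced maps on cochains are continuous (\<open>exact_at_transfer\<close>, \<open>closed_at_transfer\<close>).

  Suppose now that \<open>H\<^sup>q(\<Gamma>;\<pi>) = 0\<close> and that \<open>H\<^sup>q\<^sup>+\<^sup>1(\<Gamma>;\<pi>)\<close> has no torsion. Then \<open>ker B = im A\<close> and \<open>B\<close>
  has closed range, and the open mapping theorem makes the Laplacian \<open>\<Delta> = B\<^sup>*B + AA\<^sup>*\<close> bounded below
  (\<open>exact_closed_imp_coercive\<close>). Hence \<open>T = 1 - \<Delta>/N\<close> acts on the power of \<open>V\<close> with norm at
  most some \<open>r < 1\<close> when \<open>N\<close> is large (\<open>coercive_imp_contraction\<close>). The entries of the matrix \<open>T\<^sup>n\<close>
  lie in the group ring, so they have norm at most \<open>r\<^sup>n\<close> under \<open>\<pi>\<close>, and weak containment bounds them by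
  \<open>r\<^sup>n\<close> under \<open>\<sigma>\<close> as well. So the Neumann series of \<open>T\<close> converges under \<open>\<sigma>\<close>, the Laplacian is
  invertible there, and \<open>ker B = im A\<close> holds for \<open>\<sigma>\<close> too (\<open>weak_containment_exactness\<close>), that is,
  \<open>H\<^sup>q(\<Gamma>;\<sigma>) = 0\<close>. Passing to powers and looking at single entries avoids any statement about
  weak containment for matrices.

  By contraposition, \<open>H\<^sup>q(\<Gamma>;\<sigma>) \<noteq> 0\<close> and \<open>H\<^sup>q(\<Gamma>;\<pi>) = 0\<close> force torsion in \<open>H\<^sup>q\<^sup>+\<^sup>1(\<Gamma>;\<pi>)\<close>. The other
  claims follow, since \<open>H\<^sup>q(\<Gamma>;\<pi>)\<close> vanishes as soon as its torsion part and its Hausdorff quotient do.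
\<close>

section \<open>Rational chains\<close>

text \<open>The free module over the rational group ring with basis indexed by a set: the pair \<open>(i, g)\<close> stands
  for the translate by \<open>g\<close> of the \<open>i\<close>-th basis element.\<close>

type_synonym ('i, 'g) chain = "'i \<times> 'g \<Rightarrow>\<^sub>0 rat"

abbreviation single :: "'k \<Rightarrow> rat \<Rightarrow> ('k \<Rightarrow>\<^sub>0 rat)" where
  "single \<equiv> Poly_Mapping.single"

abbreviation coef :: "('k \<Rightarrow>\<^sub>0 rat) \<Rightarrow> 'k \<Rightarrow> rat" where
  "coef \<equiv> Poly_Mapping.lookup"

abbreviation supp :: "('k \<Rightarrow>\<^sub>0 rat) \<Rightarrow> 'k set" where
  "supp \<equiv> Poly_Mapping.keys"

definition scale_chain :: "rat \<Rightarrow> ('k \<Rightarrow>\<^sub>0 rat) \<Rightarrow> ('k \<Rightarrow>\<^sub>0 rat)" where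
  "scale_chain r x = Poly_Mapping.map ((*) r) x"

lemma lookup_scale_chain [simp]: "coef (scale_chain r x) k = r * coef x k"
  by (simp add: scale_chain_def map.rep_eq when_def)

lemma keys_scale_chain: "supp (scale_chain r x) \<subseteq> supp x"
  by (auto simp: in_keys_iff)

definition lin :: "(rat \<Rightarrow> 'b \<Rightarrow> 'b::ab_group_add) \<Rightarrow> ('k \<Rightarrow> 'b) \<Rightarrow> ('k \<Rightarrow>\<^sub>0 rat) \<Rightarrow> 'b" where
  "lin sc b x = (\<Sum>k\<in>supp x. sc (coef x k) (b k))"

locale rat_space = vector_space sc for sc :: "rat \<Rightarrow> 'b \<Rightarrow> 'b::ab_group_add"
begin

lemma lin_superset:
  assumes "finite K" "supp x \<subseteq> K"
  shows "lin sc b x = (\<Sum>k\<in>K. sc (coef x k) (b k))"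
  unfolding lin_def using assms
  by (intro sum.mono_neutral_left) (auto simp: in_keys_iff)

lemma lin_add: "lin sc b (x + y) = lin sc b x + lin sc b y"
proof -
  let ?K = "supp x \<union> supp y"
  have "lin sc b (x + y) = (\<Sum>k\<in>?K. sc (coef (x + y) k) (b k))"
    using keys_add[of x y] by (intro lin_superset) auto
  moreover have "lin sc b x = (\<Sum>k\<in>?K. sc (coef x k) (b k))"
    by (intro lin_superset) auto
  moreover have "lin sc b y = (\<Sum>k\<in>?K. sc (coef y k) (b k))"
    by (intro lin_superset) auto
  ultimately show ?thesis by (simp add: lookup_add scale_left_distrib sum.distrib)
qed

lemma lin_scale: "lin sc b (scale_chain r x) = sc r (lin sc b x)"
proof -
  have "lin sc b (scale_chain r x) = (\<Sum>k\<in>supp x. sc (coef (scale_chain r x) k) (b k))"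
    by (intro lin_superset keys_scale_chain) auto
  then show ?thesis by (simp add: lin_def scale_sum_right)
qed

lemma lin_zero [simp]: "lin sc b 0 = 0"
  by (simp add: lin_def)

lemma lin_single [simp]: "lin sc b (single k r) = sc r (b k)"
  by (simp add: lin_def)

end

lemma rat_space_chain: "rat_space (scale_chain :: rat \<Rightarrow> ('k \<Rightarrow>\<^sub>0 rat) \<Rightarrow> _)"
  by unfold_locales (auto intro!: poly_mapping_eqI simp: lookup_add algebra_simps)

interpretation chain_space: rat_space "scale_chain :: rat \<Rightarrow> ('k \<Rightarrow>\<^sub>0 rat) \<Rightarrow> _"
  by (rule rat_space_chain)

lemma scale_chain_single [simp]: "scale_chain r (single k a) = single k (r * a)"
  by (rule poly_mapping_eqI) (simp add: lookup_single when_def)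

lemma chain_expansion: "x = (\<Sum>k\<in>supp x. scale_chain (coef x k) (single k 1))"
proof (rule poly_mapping_eqI)
  fix k
  show "coef x k = coef (\<Sum>k\<in>supp x. scale_chain (coef x k) (single k 1)) k"
    by (cases "k \<in> supp x")
       (auto simp: lookup_sum lookup_single when_def in_keys_iff if_distrib cong: if_cong)
qed

lemma chain_induct [consumes 1, case_names zero add sc single]:
  assumes x: "supp x \<subseteq> K"
    and zero: "P 0"
    and add: "\<And>x y. P x \<Longrightarrow> P y \<Longrightarrow> P (x + y)"
    and sc: "\<And>r x. P x \<Longrightarrow> P (scale_chain r x)"
    and single: "\<And>k. k \<in> K \<Longrightarrow> P (single k 1)"
  shows "P x"
proof -
  have "P (\<Sum>k\<in>L. scale_chain (coef x k) (single k 1))"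
    if "finite L" "L \<subseteq> K" for L
    using that
  proof (induction L rule: finite_induct)
    case (insert k L)
    then have "P (scale_chain (coef x k) (single k 1))"
      "P (\<Sum>k\<in>L. scale_chain (coef x k) (single k 1))"
      by (blast intro: sc single)+
    from add[OF this] show ?case using insert.hyps by simp
  qed (simp add: zero)
  from this[OF finite_keys x] show ?thesis using chain_expansion[of x] by simp
qed

lemma lin_lin:
  assumes "rat_space sc"
  shows "lin sc b (lin scale_chain c x) = lin sc (\<lambda>k. lin sc b (c k)) x"
proof -
  interpret rat_space sc by fact
  have "lin sc b (\<Sum>k\<in>K. scale_chain (a k) (c k)) = (\<Sum>k\<in>K. sc (a k) (lin sc b (c k)))"
    if "finite K" for K a
    using that by (induction K) (auto simp: lin_add lin_scale)
  then show ?thesis by (simp add: lin_def[of scale_chain] lin_def[of _ "\<lambda>k. lin sc b (c k)"])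
qed

section \<open>Free modules over the group ring\<close>

locale rational_rep = group G + rat_space sc
  for G :: "('g, 'x) monoid_scheme" (structure) and sc :: "rat \<Rightarrow> 'b \<Rightarrow> 'b::ab_group_add" +
  fixes act :: "'g \<Rightarrow> 'b \<Rightarrow> 'b"
  assumes act_add: "g \<in> carrier G \<Longrightarrow> act g (x + y) = act g x + act g y"
    and act_scale: "g \<in> carrier G \<Longrightarrow> act g (sc r x) = sc r (act g x)"
    and act_mult: "g \<in> carrier G \<Longrightarrow> h \<in> carrier G \<Longrightarrow> act (g \<otimes> h) x = act g (act h x)"
    and act_one: "act \<one> x = x"

text \<open>Pairs with a second component outside of the group are left alone, so that translation is an action
  on all chains, not only on those supported on the group.\<close>

definition translate :: "('g, 'x) monoid_scheme \<Rightarrow> 'g \<Rightarrow> ('i, 'g) chain \<Rightarrow> ('i, 'g) chain" where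
  "translate G g = lin scale_chain
     (\<lambda>(i, h). single (i, if h \<in> carrier G then g \<otimes>\<^bsub>G\<^esub> h else h) 1)"

lemma translate_single:
  "h \<in> carrier G \<Longrightarrow> translate G g (single (i, h) r) = single (i, g \<otimes>\<^bsub>G\<^esub> h) r"
  by (simp add: translate_def)

lemma chain_eq_lin_single: "lin scale_chain (\<lambda>k. single k 1) x = x"
  unfolding lin_def by (rule chain_expansion[symmetric])

lemma rational_rep_translate:
  assumes "group G"
  shows "rational_rep G (scale_chain :: rat \<Rightarrow> ('i, 'g) chain \<Rightarrow> _) (translate G)"
proof -
  interpret group G by fact
  show ?thesis
  proof
    fix g h x assume gh: "g \<in> carrier G" "h \<in> carrier G"
    show "translate G (g \<otimes>\<^bsub>G\<^esub> h) x = translate G g (translate G h x)"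
      unfolding translate_def lin_lin[OF rat_space_chain]
      using gh by (intro arg_cong2[where f = "lin scale_chain"] ext) (auto simp: m_assoc)
  next
    fix x show "translate G \<one>\<^bsub>G\<^esub> x = x"
    proof -
      have "translate G \<one>\<^bsub>G\<^esub> x = lin scale_chain (\<lambda>k. single k 1) x"
        unfolding translate_def by (intro arg_cong2[where f = "lin scale_chain"] ext) auto
      then show ?thesis by (simp add: chain_eq_lin_single)
    qed
  qed (auto simp: translate_def chain_space.lin_add chain_space.lin_scale)
qed

definition free_chains :: "('g, 'x) monoid_scheme \<Rightarrow> 'i set \<Rightarrow> ('i, 'g) chain set" where
  "free_chains G I = {x. supp x \<subseteq> I \<times> carrier G}"

abbreviation gen :: "('g, 'x) monoid_scheme \<Rightarrow> 'i \<Rightarrow> ('i, 'g) chain" where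
  "gen G i \<equiv> single (i, \<one>\<^bsub>G\<^esub>) 1"

definition submod :: "('g, 'x) monoid_scheme \<Rightarrow> ('i, 'g) chain set \<Rightarrow> bool" where
  "submod G X \<longleftrightarrow> 0 \<in> X \<and> (\<forall>x\<in>X. \<forall>y\<in>X. x + y \<in> X) \<and> (\<forall>r. \<forall>x\<in>X. scale_chain r x \<in> X)
     \<and> (\<forall>g\<in>carrier G. \<forall>x\<in>X. translate G g x \<in> X)"

definition equivariant_on ::
    "('g, 'x) monoid_scheme \<Rightarrow> ('i, 'g) chain set \<Rightarrow> (rat \<Rightarrow> 'b \<Rightarrow> 'b::ab_group_add)
      \<Rightarrow> ('g \<Rightarrow> 'b \<Rightarrow> 'b) \<Rightarrow> (('i, 'g) chain \<Rightarrow> 'b) \<Rightarrow> bool" where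
  "equivariant_on G X sc act f \<longleftrightarrow>
     (\<forall>x\<in>X. \<forall>y\<in>X. f (x + y) = f x + f y) \<and>
     (\<forall>r. \<forall>x\<in>X. f (scale_chain r x) = sc r (f x)) \<and>
     (\<forall>g\<in>carrier G. \<forall>x\<in>X. f (translate G g x) = act g (f x))"

definition chain_hom ::
    "('g, 'x) monoid_scheme \<Rightarrow> ('i, 'g) chain set \<Rightarrow> ('j, 'g) chain set
      \<Rightarrow> (('i, 'g) chain \<Rightarrow> ('j, 'g) chain) \<Rightarrow> bool" where
  "chain_hom G X Y f \<longleftrightarrow> equivariant_on G X scale_chain (translate G) f \<and> (\<forall>x\<in>X. f x \<in> Y)"

text \<open>The equivariant extension of a family \<open>u\<close> of values on the basis. It is the only equivariant map on a
  free module with these values (\<open>equivariant_eq_ext_act\<close>), and so families indexed by a basis stand for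
  homomorphisms, with \<open>extend\<close> playing the role of matrix multiplication.\<close>

definition ext_act ::
    "(rat \<Rightarrow> 'b \<Rightarrow> 'b::ab_group_add) \<Rightarrow> ('g \<Rightarrow> 'b \<Rightarrow> 'b) \<Rightarrow> ('i \<Rightarrow> 'b) \<Rightarrow> ('i, 'g) chain \<Rightarrow> 'b" where
  "ext_act sc act u = lin sc (\<lambda>(i, g). act g (u i))"

abbreviation extend :: "('g, 'x) monoid_scheme \<Rightarrow> ('i \<Rightarrow> ('j, 'g) chain) \<Rightarrow> ('i, 'g) chain \<Rightarrow> ('j, 'g) chain" where
  "extend G \<equiv> ext_act scale_chain (translate G)"

lemma equivariant_onD:
  assumes "equivariant_on G X sc act f"
  shows "x \<in> X \<Longrightarrow> y \<in> X \<Longrightarrow> f (x + y) = f x + f y"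
    and "x \<in> X \<Longrightarrow> f (scale_chain r x) = sc r (f x)"
    and "g \<in> carrier G \<Longrightarrow> x \<in> X \<Longrightarrow> f (translate G g x) = act g (f x)"
  using assms by (auto simp: equivariant_on_def)

lemma submodD:
  assumes "submod G X"
  shows "0 \<in> X" "x \<in> X \<Longrightarrow> y \<in> X \<Longrightarrow> x + y \<in> X" "x \<in> X \<Longrightarrow> scale_chain r x \<in> X"
    "g \<in> carrier G \<Longrightarrow> x \<in> X \<Longrightarrow> translate G g x \<in> X"
  using assms by (auto simp: submod_def)

lemma submod_diff:
  assumes "submod G X" "x \<in> X" "y \<in> X" shows "x - y \<in> X"
proof -
  have "x - y = x + scale_chain (-1) y" by (rule poly_mapping_eqI) (simp add: lookup_minus lookup_add)
  then show ?thesis using submodD(2,3)[OF assms(1)] assms(2,3) by metis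
qed

lemma equivariant_on_subset: "equivariant_on G X sc act f \<Longrightarrow> Y \<subseteq> X \<Longrightarrow> equivariant_on G Y sc act f"
  unfolding equivariant_on_def by blast

lemma chain_homD:
  assumes "chain_hom G X Y f"
  shows "x \<in> X \<Longrightarrow> y \<in> X \<Longrightarrow> f (x + y) = f x + f y"
    and "x \<in> X \<Longrightarrow> f (scale_chain r x) = scale_chain r (f x)"
    and "g \<in> carrier G \<Longrightarrow> x \<in> X \<Longrightarrow> f (translate G g x) = translate G g (f x)"
    and "x \<in> X \<Longrightarrow> f x \<in> Y"
  using assms by (auto simp: equivariant_on_def chain_hom_def)

lemma (in rational_rep) equivariant_zero:
  assumes "equivariant_on G X sc act f" "0 \<in> X" shows "f 0 = 0"
  using equivariant_onD(1)[OF assms(1) assms(2) assms(2)] by simp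

lemma (in rational_rep) equivariant_diff:
  assumes f: "equivariant_on G X sc act f" and X: "submod G X" and x: "x \<in> X" and y: "y \<in> X"
  shows "f (x - y) = f x - f y"
  using equivariant_onD(1)[OF f submod_diff[OF X x y] y] by (simp add: algebra_simps)

lemma submod_free_chains:
  fixes G :: "('g, 'x) monoid_scheme" and I :: "'i set"
  assumes "group G" shows "submod G (free_chains G I)"
proof -
  interpret group G by fact
  have "supp (translate G g x) \<subseteq> I \<times> carrier G"
    if g: "g \<in> carrier G" and x: "supp x \<subseteq> I \<times> carrier G" for g and x :: "('i, 'g) chain"
  proof -
    have "supp (translate G g x) \<subseteq> (\<Union>k\<in>supp x. supp (scale_chain (coef x k)
       (case k of (i, h) \<Rightarrow> single (i, if h \<in> carrier G then g \<otimes>\<^bsub>G\<^esub> h else h) 1)))"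
      unfolding translate_def lin_def by (rule order_trans[OF keys_sum]) auto
    also have "\<dots> \<subseteq> I \<times> carrier G"
    proof (rule UN_least)
      fix k assume k: "k \<in> supp x"
      then obtain i h where "k = (i, h)" "i \<in> I" "h \<in> carrier G" using x by blast
      then show "supp (scale_chain (coef x k)
         (case k of (i, h) \<Rightarrow> single (i, if h \<in> carrier G then g \<otimes>\<^bsub>G\<^esub> h else h) 1))
         \<subseteq> I \<times> carrier G" using g by simp
    qed
    finally show ?thesis .
  qed
  moreover have "supp (x + y) \<subseteq> I \<times> carrier G"
    if "supp x \<subseteq> I \<times> carrier G" "supp y \<subseteq> I \<times> carrier G"
    for x y :: "('i, 'g) chain"
    using keys_add[of x y] that by blast
  moreover have "supp (scale_chain r x) \<subseteq> I \<times> carrier G"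
    if "supp x \<subseteq> I \<times> carrier G" for r and x :: "('i, 'g) chain"
    using keys_scale_chain[of r x] that by blast
  ultimately show ?thesis
    unfolding submod_def free_chains_def by simp
qed

lemma gen_in_free_chains: "group G \<Longrightarrow> i \<in> I \<Longrightarrow> gen G i \<in> free_chains G I"
  by (simp add: free_chains_def group.is_monoid)

context rational_rep
begin

lemma ext_act_equivariant: "equivariant_on G (free_chains G I) sc act (ext_act sc act u)"
proof -
  have act_lin: "act g (lin sc b x) = lin sc (\<lambda>k. act g (b k)) x" if g: "g \<in> carrier G" for g b and x :: "'k \<Rightarrow>\<^sub>0 rat"
  proof -
    have z: "act g 0 = 0" using act_add[OF g, of 0 0] by simp
    have "act g (\<Sum>k\<in>K. sc (a k) (b k)) = (\<Sum>k\<in>K. sc (a k) (act g (b k)))" if "finite K" for K a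
      using that by (induction K) (auto simp: z act_add[OF g] act_scale[OF g])
    then show ?thesis by (simp add: lin_def)
  qed
  have "ext_act sc act u (translate G g x) = act g (ext_act sc act u x)"
    if g: "g \<in> carrier G" and x: "supp x \<subseteq> I \<times> carrier G" for g x
  proof -
    have "ext_act sc act u (translate G g x) = lin sc (\<lambda>(i, h). act (if h \<in> carrier G then g \<otimes> h else h) (u i)) x"
      unfolding ext_act_def translate_def lin_lin[OF rat_space_axioms]
      by (intro arg_cong2[where f = "lin sc"] ext) auto
    also have "\<dots> = lin sc (\<lambda>(i, h). act g (act h (u i))) x"
      unfolding lin_def using x g by (intro sum.cong) (auto simp: act_mult)
    also have "\<dots> = act g (ext_act sc act u x)"
      unfolding ext_act_def act_lin[OF g] by (intro arg_cong2[where f = "lin sc"] ext) auto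
    finally show ?thesis .
  qed
  then show ?thesis
    by (auto simp: equivariant_on_def free_chains_def ext_act_def lin_add lin_scale)
qed

lemma ext_act_gen [simp]: "ext_act sc act u (gen G i) = u i"
  by (simp add: ext_act_def act_one)

end

lemma free_chains_induct [consumes 2, case_names zero add sc translate gen]:
  assumes G: "group G" and x: "x \<in> free_chains G I"
    and zero: "P 0"
    and add: "\<And>x y. x \<in> free_chains G I \<Longrightarrow> y \<in> free_chains G I \<Longrightarrow> P x \<Longrightarrow> P y \<Longrightarrow> P (x + y)"
    and sc: "\<And>r x. x \<in> free_chains G I \<Longrightarrow> P x \<Longrightarrow> P (scale_chain r x)"
    and translate: "\<And>g x. g \<in> carrier G \<Longrightarrow> x \<in> free_chains G I \<Longrightarrow> P x \<Longrightarrow> P (translate G g x)"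
    and gen: "\<And>i. i \<in> I \<Longrightarrow> P (gen G i)"
  shows "P x"
proof -
  interpret group G by fact
  note F = submodD[OF submod_free_chains[OF G, of I]]
  have "supp x \<subseteq> I \<times> carrier G" using x by (simp add: free_chains_def)
  then have "P x \<and> x \<in> free_chains G I"
  proof (induction x rule: chain_induct)
    case (single k)
    then obtain i g where k: "k = (i, g)" "i \<in> I" "g \<in> carrier G" by blast
    have "gen G i \<in> free_chains G I" by (rule gen_in_free_chains[OF G k(2)])
    moreover have "single k 1 = translate G g (gen G i)" using k by (simp add: translate_single)
    ultimately show ?case using k by (simp add: translate gen F(4))
  qed (auto simp: zero add sc F(1-3))
  then show "P x" ..
qed

lemma (in rational_rep) equivariant_eq_on_free:
  assumes f: "equivariant_on G (free_chains G I) sc act f"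
    and f': "equivariant_on G (free_chains G I) sc act f'"
    and eq: "\<And>i. i \<in> I \<Longrightarrow> f (gen G i) = f' (gen G i)"
    and x: "x \<in> free_chains G I"
  shows "f x = f' x"
  using is_group x
proof (induction rule: free_chains_induct)
  case zero
  have "0 \<in> free_chains G I" by (simp add: free_chains_def)
  then show ?case using f f' by (simp add: equivariant_zero)
next
  case (add x y) then show ?case by (simp only: equivariant_onD(1)[OF f] equivariant_onD(1)[OF f'])
next
  case (sc r x) then show ?case by (simp only: equivariant_onD(2)[OF f] equivariant_onD(2)[OF f'])
next
  case (translate g x) then show ?case by (simp only: equivariant_onD(3)[OF f] equivariant_onD(3)[OF f'])
next
  case (gen i) then show ?case by (rule eq)
qed

lemma (in rational_rep) equivariant_eq_ext_act:
  assumes "equivariant_on G (free_chains G I) sc act f" "x \<in> free_chains G I"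
  shows "f x = ext_act sc act (\<lambda>i. f (gen G i)) x"
  by (rule equivariant_eq_on_free[OF assms(1) ext_act_equivariant _ assms(2)]) simp

lemma equivariant_on_comp:
  assumes "chain_hom G X Y f" "equivariant_on G Y sc act h"
  shows "equivariant_on G X sc act (\<lambda>x. h (f x))"
  using assms by (auto simp: chain_hom_def equivariant_on_def)

lemma chain_hom_comp:
  assumes "chain_hom G X Y f" "chain_hom G Y Z h"
  shows "chain_hom G X Z (\<lambda>x. h (f x))"
  using assms by (auto simp: chain_hom_def equivariant_on_def)

lemma ext_act_closed:
  fixes G :: "('g, 'x) monoid_scheme" and Y :: "('j, 'g) chain set" and I :: "'i set"
  assumes G: "group G" and Y: "submod G Y" and u: "\<And>i. i \<in> I \<Longrightarrow> u i \<in> Y"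
    and x: "x \<in> free_chains G I"
  shows "extend G u x \<in> Y"
proof -
  interpret rational_rep G scale_chain "translate G :: 'g \<Rightarrow> ('j, 'g) chain \<Rightarrow> _" by (rule rational_rep_translate[OF G])
  note e = equivariant_onD[OF ext_act_equivariant[of I u]]
  show ?thesis using G x
  proof (induction rule: free_chains_induct)
    case zero then show ?case using submodD(1)[OF Y] by (simp add: ext_act_def)
  next
    case (gen i)
    then show ?case using u by (simp only: ext_act_gen)
  next
    case (add x y) then show ?case by (simp add: e submodD(2)[OF Y])
  next
    case (sc r x) then show ?case by (simp add: e submodD(3)[OF Y])
  next
    case (translate g x) then show ?case by (simp add: e submodD(4)[OF Y])
  qed
qed

text \<open>The lifting property of the projective module \<open>X\<close>, which is a retract of a free module by \<open>E\<close>: choose a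
  partner in \<open>Y\<close> for the image under \<open>E\<close> of every generator, and extend equivariantly. What is lifted
  through is an additive relation rather than a map, because the comparison of resolutions asks for
  values with a prescribed boundary and, in the lowest degree, a prescribed augmentation as well.\<close>

lemma projective_lift:
  fixes G :: "('g, 'x) monoid_scheme" and Y :: "('j, 'g) chain set"
    and X :: "('i, 'g) chain set" and I :: "'i set"
  assumes G: "group G" and Y: "submod G Y" and XF: "X \<subseteq> free_chains G I"
    and E: "chain_hom G (free_chains G I) X E" and EX: "\<And>x. x \<in> X \<Longrightarrow> E x = x"
    and R0: "R 0 0"
    and Radd: "\<And>x x' y y'. x \<in> X \<Longrightarrow> x' \<in> X \<Longrightarrow> y \<in> Y \<Longrightarrow> y' \<in> Y \<Longrightarrow> R x y \<Longrightarrow> R x' y' \<Longrightarrow> R (x + x') (y + y')"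
    and Rscale: "\<And>r x y. x \<in> X \<Longrightarrow> y \<in> Y \<Longrightarrow> R x y \<Longrightarrow> R (scale_chain r x) (scale_chain r y)"
    and Rtr: "\<And>g x y. g \<in> carrier G \<Longrightarrow> x \<in> X \<Longrightarrow> y \<in> Y \<Longrightarrow> R x y \<Longrightarrow> R (translate G g x) (translate G g y)"
    and total: "\<And>x. x \<in> X \<Longrightarrow> \<exists>y\<in>Y. R x y"
  shows "\<exists>h. chain_hom G X Y h \<and> (\<forall>x\<in>X. R x (h x))"
proof -
  interpret Y: rational_rep G scale_chain "translate G :: 'g \<Rightarrow> ('j, 'g) chain \<Rightarrow> _" by (rule rational_rep_translate[OF G])
  have "\<exists>m. \<forall>i\<in>I. m i \<in> Y \<and> R (E (gen G i)) (m i)"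
  proof (rule bchoice, rule ballI)
    fix i assume "i \<in> I"
    then have "E (gen G i) \<in> X" by (intro chain_homD(4)[OF E] gen_in_free_chains[OF G])
    from total[OF this] show "\<exists>y. y \<in> Y \<and> R (E (gen G i)) y" by blast
  qed
  then obtain m where m: "\<And>i. i \<in> I \<Longrightarrow> m i \<in> Y" "\<And>i. i \<in> I \<Longrightarrow> R (E (gen G i)) (m i)" by blast
  let ?h = "extend G m"
  note e = equivariant_onD[OF Y.ext_act_equivariant[of I m]]
  have hY: "?h x \<in> Y" if "x \<in> free_chains G I" for x
    by (rule ext_act_closed[OF G Y m(1) that])
  have "R (E x) (?h x)" if "x \<in> free_chains G I" for x
    using G that
  proof (induction rule: free_chains_induct)
    case zero
    have "(0 :: ('i, 'g) chain) \<in> free_chains G I" by (simp add: free_chains_def)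
    then have "E 0 = 0" using chain_homD(1)[OF E, of 0 0] by simp
    then show ?case using R0 by (simp add: ext_act_def)
  next
    case (gen i)
    then show ?case using m by (simp only: Y.ext_act_gen)
  next
    case (add x y)
    then show ?case by (simp add: e chain_homD[OF E] hY Radd)
  next
    case (sc r x)
    then show ?case by (simp add: e chain_homD[OF E] hY Rscale)
  next
    case (translate g x)
    then show ?case by (simp add: e chain_homD[OF E] hY Rtr)
  qed
  then have "R x (?h x)" if "x \<in> X" for x using that EX XF by fastforce
  moreover have "chain_hom G X Y ?h"
    using hY XF equivariant_on_subset[OF Y.ext_act_equivariant XF] by (auto simp: chain_hom_def)
  ultimately show ?thesis by blast
qed

section \<open>Resolutions and their comparison\<close>

text \<open>A resolution of the trivial module by projective modules in coordinates: \<open>X n\<close> is a retract, by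
  \<open>E n\<close>, of the free module on \<open>I n\<close>. Degrees are shifted by one: \<open>X (Suc n)\<close> is the module in degree
  \<open>n\<close>, and \<open>X 0\<close> vanishes. Then the complex of cochains also begins with a zero term, and degree
  zero, where the only coboundary is zero, is like any other degree.\<close>

locale resolution = group G
  for G :: "('g, 'x) monoid_scheme" (structure) +
  fixes I :: "nat \<Rightarrow> 'i set"
    and X :: "nat \<Rightarrow> ('i, 'g) chain set"
    and E :: "nat \<Rightarrow> ('i, 'g) chain \<Rightarrow> ('i, 'g) chain"
    and D :: "nat \<Rightarrow> ('i, 'g) chain \<Rightarrow> ('i, 'g) chain"
    and \<epsilon> :: "('i, 'g) chain \<Rightarrow> rat"
  assumes X_submod: "submod G (X n)"
    and X_free: "X n \<subseteq> free_chains G (I n)"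
    and E_hom: "chain_hom G (free_chains G (I n)) (X n) (E n)"
    and E_id: "x \<in> X n \<Longrightarrow> E n x = x"
    and D_hom: "chain_hom G (X (Suc n)) (X n) (D n)"
    and aug_equivariant: "equivariant_on G (X 1) (*) (\<lambda>_ r. r) \<epsilon>"
    and X_0: "X 0 = {0}"
    and D_D: "x \<in> X (Suc (Suc n)) \<Longrightarrow> D n (D (Suc n) x) = 0"
    and aug_D: "x \<in> X 2 \<Longrightarrow> \<epsilon> (D 1 x) = 0"
    and aug_surj: "\<exists>x\<in>X 1. \<epsilon> x = 1"
    and exact: "x \<in> X (Suc n) \<Longrightarrow> D n x = 0 \<Longrightarrow> (n = 0 \<Longrightarrow> \<epsilon> x = 0)
                  \<Longrightarrow> \<exists>y\<in>X (Suc (Suc n)). D (Suc n) y = x"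

definition chain_map ::
    "('g, 'x) monoid_scheme \<Rightarrow> (nat \<Rightarrow> ('i, 'g) chain set) \<Rightarrow> (nat \<Rightarrow> ('i, 'g) chain \<Rightarrow> ('i, 'g) chain)
      \<Rightarrow> (('i, 'g) chain \<Rightarrow> rat)
      \<Rightarrow> (nat \<Rightarrow> ('j, 'g) chain set) \<Rightarrow> (nat \<Rightarrow> ('j, 'g) chain \<Rightarrow> ('j, 'g) chain)
      \<Rightarrow> (('j, 'g) chain \<Rightarrow> rat) \<Rightarrow> (nat \<Rightarrow> ('i, 'g) chain \<Rightarrow> ('j, 'g) chain) \<Rightarrow> bool" where
  "chain_map G X D \<epsilon> Y D' \<epsilon>' \<phi> \<longleftrightarrow>
     (\<forall>n. chain_hom G (X n) (Y n) (\<phi> n)) \<and>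
     (\<forall>n. \<forall>x\<in>X (Suc n). D' n (\<phi> (Suc n) x) = \<phi> n (D n x)) \<and>
     (\<forall>x\<in>X 1. \<epsilon>' (\<phi> 1 x) = \<epsilon> x)"

lemma chain_map_id: "chain_map G X D \<epsilon> X D \<epsilon> (\<lambda>n x. x)"
  by (simp add: chain_map_def chain_hom_def equivariant_on_def)

lemma chain_map_comp:
  assumes "chain_map G X D \<epsilon> Y D' \<epsilon>' \<phi>" "chain_map G Y D' \<epsilon>' Z D2 e2 \<psi>"
  shows "chain_map G X D \<epsilon> Z D2 e2 (\<lambda>n x. \<psi> n (\<phi> n x))"
proof -
  have h: "chain_hom G (X n) (Y n) (\<phi> n)" "chain_hom G (Y n) (Z n) (\<psi> n)" for n
    using assms(1,2) by (auto simp: chain_map_def)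
  show ?thesis
    using assms(1,2) chain_hom_comp[OF h] chain_homD(4)[OF h(1)]
    unfolding chain_map_def by (simp del: One_nat_def)
qed

lemma (in resolution) chain_hom_zero: "chain_hom G (X n) Y f \<Longrightarrow> f 0 = 0"
  using chain_homD(1)[of G "X n" Y f 0 0] submodD(1)[OF X_submod[of n]] by simp

lemma chain_hom_diff:
  assumes f: "chain_hom G X Y f" and X: "submod G X" and x: "x \<in> X" and y: "y \<in> X"
  shows "f (x - y) = f x - f y"
  using chain_homD(1)[OF f submod_diff[OF X x y] y] by (simp add: algebra_simps)

lemma aug_diff:
  assumes f: "equivariant_on G X (*) a (f :: _ \<Rightarrow> rat)" and X: "submod G X" and x: "x \<in> X" and y: "y \<in> X"
  shows "f (x - y) = f x - f y"
  using equivariant_onD(1)[OF f submod_diff[OF X x y] y] by (simp add: algebra_simps)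

lemma translate_simps:
  assumes "group G" "g \<in> carrier G"
  shows "translate G g (x + y) = translate G g x + translate G g y"
    "translate G g (x - y) = translate G g x - translate G g y"
proof -
  interpret rational_rep G scale_chain "translate G" by (rule rational_rep_translate[OF assms(1)])
  show 1: "translate G g (x + y) = translate G g x + translate G g y" for x y by (rule act_add[OF assms(2)])
  show "translate G g (x - y) = translate G g x - translate G g y" using 1[of "x - y" y] by (simp add: algebra_simps)
qed

text \<open>The maps are lifted degree by degree. The invariant \<open>P\<close> carried along says that the next lifting problem can be
  solved; it follows from exactness of the target, as the map constructed so far takes boundaries
  to cycles.\<close>

lemma chain_map_exists:
  fixes G :: "('g, 'x) monoid_scheme" and I :: "nat \<Rightarrow> 'i set" and J :: "nat \<Rightarrow> 'j set"
  assumes "resolution G I X E D \<epsilon>" "resolution G J Y E' D' \<epsilon>'"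
  shows "\<exists>\<phi>. chain_map G X D \<epsilon> Y D' \<epsilon>' \<phi>"
proof -
  interpret X: resolution G I X E D \<epsilon> by fact
  interpret Y: resolution G J Y E' D' \<epsilon>' by fact
  have G: "group G" by (rule X.is_group)
  define Q where "Q n (f :: ('i, 'g) chain \<Rightarrow> ('j, 'g) chain) f' \<longleftrightarrow>
    (\<forall>x\<in>X (Suc n). D' n (f' x) = f (D n x) \<and> (n = 0 \<longrightarrow> \<epsilon>' (f' x) = \<epsilon> x))" for n f f'
  define P where "P n f \<longleftrightarrow> chain_hom G (X n) (Y n) f \<and>
    (\<forall>x\<in>X (Suc n). \<exists>y\<in>Y (Suc n). D' n y = f (D n x) \<and> (n = 0 \<longrightarrow> \<epsilon>' y = \<epsilon> x))" for n f
  have "\<exists>\<phi>. \<forall>n. P n (\<phi> n) \<and> Q n (\<phi> n) (\<phi> (Suc n))"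
  proof (rule dependent_nat_choice)
    obtain u where u: "u \<in> Y 1" "\<epsilon>' u = 1" using Y.aug_surj by blast
    have "P 0 (\<lambda>_. 0)"
      unfolding P_def
    proof (intro conjI ballI)
      show "chain_hom G (X 0) (Y 0) (\<lambda>_. 0)"
        using translate_simps(1)[OF G, of _ 0 0]
        by (auto simp: chain_hom_def equivariant_on_def Y.X_0)
      fix x assume x: "x \<in> X (Suc 0)"
      let ?y = "scale_chain (\<epsilon> x) u"
      have y: "?y \<in> Y (Suc 0)" using submodD(3)[OF Y.X_submod[of 1] u(1)] by simp
      have "D' 0 ?y = 0" using chain_homD(4)[OF Y.D_hom y] by (simp add: Y.X_0)
      moreover have "\<epsilon>' ?y = \<epsilon> x" using equivariant_onD(2)[OF Y.aug_equivariant u(1)] u(2) by simp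
      ultimately show "\<exists>y\<in>Y (Suc 0). D' 0 y = 0 \<and> (0 = 0 \<longrightarrow> \<epsilon>' y = \<epsilon> x)" using y by auto
    qed
    then show "\<exists>f. P 0 f" by blast
  next
    fix f n assume "P n f"
    then have f: "chain_hom G (X n) (Y n) f"
      and tot: "\<And>x. x \<in> X (Suc n) \<Longrightarrow> \<exists>y\<in>Y (Suc n). D' n y = f (D n x) \<and> (n = 0 \<longrightarrow> \<epsilon>' y = \<epsilon> x)"
      by (auto simp: P_def)
    have eX: "equivariant_on G (X (Suc 0)) (*) (\<lambda>_ r. r) \<epsilon>" using X.aug_equivariant by simp
    have eY: "equivariant_on G (Y (Suc 0)) (*) (\<lambda>_ r. r) \<epsilon>'" using Y.aug_equivariant by simp
    have fDh: "equivariant_on G (X (Suc n)) scale_chain (translate G) (\<lambda>x. f (D n x))"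
      using chain_hom_comp[OF X.D_hom f] by (simp add: chain_hom_def)
    have DY: "equivariant_on G (Y (Suc n)) scale_chain (translate G) (D' n)"
      using Y.D_hom by (simp add: chain_hom_def)
    have e0: "\<epsilon> 0 = 0" "\<epsilon>' 0 = 0"
      using equivariant_onD(2)[OF eX submodD(1)[OF X.X_submod], of 0]
        equivariant_onD(2)[OF eY submodD(1)[OF Y.X_submod], of 0] by simp_all
    have "\<exists>f'. chain_hom G (X (Suc n)) (Y (Suc n)) f' \<and>
       (\<forall>x\<in>X (Suc n). D' n (f' x) = f (D n x) \<and> (n = 0 \<longrightarrow> \<epsilon>' (f' x) = \<epsilon> x))"
    proof (rule projective_lift[OF G Y.X_submod X.X_free X.E_hom X.E_id])
      show "D' n 0 = f (D n 0) \<and> (n = 0 \<longrightarrow> \<epsilon>' 0 = \<epsilon> 0)"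
        using e0 X.chain_hom_zero[OF X.D_hom] Y.chain_hom_zero[OF Y.D_hom] X.chain_hom_zero[OF f] by simp
    qed (use tot equivariant_onD[OF eX] equivariant_onD[OF eY] in \<open>auto simp: equivariant_onD[OF fDh] equivariant_onD[OF DY]\<close>)
    then obtain f' where f': "chain_hom G (X (Suc n)) (Y (Suc n)) f'"
      "\<And>x. x \<in> X (Suc n) \<Longrightarrow> D' n (f' x) = f (D n x)" "\<And>x. x \<in> X (Suc n) \<Longrightarrow> n = 0 \<Longrightarrow> \<epsilon>' (f' x) = \<epsilon> x" by blast
    have "P (Suc n) f'"
      unfolding P_def
    proof (intro conjI ballI f'(1))
      fix x assume x: "x \<in> X (Suc (Suc n))"
      have Dx: "D (Suc n) x \<in> X (Suc n)" by (rule chain_homD(4)[OF X.D_hom x])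
      have "D' n (f' (D (Suc n) x)) = 0"
        using f'(2)[OF Dx] X.D_D[OF x] X.chain_hom_zero[OF f] by simp
      moreover have "\<epsilon>' (f' (D (Suc n) x)) = 0" if "n = 0"
        using f'(3)[OF Dx that] X.aug_D[of x] x that by (simp add: numeral_2_eq_2)
      ultimately have "\<exists>y\<in>Y (Suc (Suc n)). D' (Suc n) y = f' (D (Suc n) x)"
        by (intro Y.exact chain_homD(4)[OF f'(1)] Dx)
      then show "\<exists>y\<in>Y (Suc (Suc n)). D' (Suc n) y = f' (D (Suc n) x) \<and> (Suc n = 0 \<longrightarrow> \<epsilon>' y = \<epsilon> x)" by simp
    qed
    moreover have "Q n f f'" using f'(2,3) by (simp add: Q_def)
    ultimately show "\<exists>f'. P (Suc n) f' \<and> Q n f f'" by blast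
  qed
  then obtain \<phi> where \<phi>: "\<And>n. P n (\<phi> n)" "\<And>n. Q n (\<phi> n) (\<phi> (Suc n))" by blast
  have "chain_map G X D \<epsilon> Y D' \<epsilon>' \<phi>"
    using \<phi>(1) \<phi>(2) \<phi>(2)[of 0] unfolding chain_map_def P_def Q_def by auto
  then show ?thesis by blast
qed

definition chain_homotopy where
  "chain_homotopy G X D Y D' \<phi> \<phi>' h \<longleftrightarrow>
     (\<forall>n. chain_hom G (X n) (Y (Suc n)) (h n)) \<and>
     (\<forall>n. \<forall>x\<in>X (Suc n). \<phi> (Suc n) x - \<phi>' (Suc n) x = D' (Suc n) (h (Suc n) x) + h n (D n x))"

text \<open>The same induction, now for the difference \<open>w\<close> of the two chain maps corrected by the part of the homotopy in
  the preceding degree: by construction \<open>w\<close> takes its values in cycles.\<close>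

lemma chain_homotopy_exists:
  fixes G :: "('g, 'x) monoid_scheme" and I :: "nat \<Rightarrow> 'i set" and J :: "nat \<Rightarrow> 'j set"
  assumes "resolution G I X E D \<epsilon>" "resolution G J Y E' D' \<epsilon>'"
    and \<phi>: "chain_map G X D \<epsilon> Y D' \<epsilon>' \<phi>" and \<phi>': "chain_map G X D \<epsilon> Y D' \<epsilon>' \<phi>'"
  shows "\<exists>h. chain_homotopy G X D Y D' \<phi> \<phi>' h"
proof -
  interpret X: resolution G I X E D \<epsilon> by fact
  interpret Y: resolution G J Y E' D' \<epsilon>' by fact
  have G: "group G" by (rule X.is_group)
  define w where "w n f x = \<phi> (Suc n) x - \<phi>' (Suc n) x - f (D n x)"
    for n and f :: "('i, 'g) chain \<Rightarrow> ('j, 'g) chain" and x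
  define Q where "Q n f f' \<longleftrightarrow> (\<forall>x\<in>X (Suc n). D' (Suc n) (f' x) = w n f x)" for n f f'
  define P where "P n f \<longleftrightarrow> chain_hom G (X n) (Y (Suc n)) f \<and>
    (\<forall>x\<in>X (Suc n). \<exists>y\<in>Y (Suc (Suc n)). D' (Suc n) y = w n f x)" for n f
  note pm = \<phi>[unfolded chain_map_def] \<phi>'[unfolded chain_map_def]
  have hom: "chain_hom G (X n) (Y n) (\<phi> n)" "chain_hom G (X n) (Y n) (\<phi>' n)" for n using pm by auto
  have com: "x \<in> X (Suc n) \<Longrightarrow> D' n (\<phi> (Suc n) x) = \<phi> n (D n x)"
    "x \<in> X (Suc n) \<Longrightarrow> D' n (\<phi>' (Suc n) x) = \<phi>' n (D n x)" for x n using pm by auto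
  have aug: "x \<in> X 1 \<Longrightarrow> \<epsilon>' (\<phi> 1 x) = \<epsilon> x" "x \<in> X 1 \<Longrightarrow> \<epsilon>' (\<phi>' 1 x) = \<epsilon> x" for x using pm by auto
  have w_hom: "chain_hom G (X (Suc n)) (Y (Suc n)) (w n f)" if f: "chain_hom G (X n) (Y (Suc n)) f" for n f
  proof -
    note c = chain_hom_comp[OF X.D_hom f]
    show ?thesis
      unfolding chain_hom_def equivariant_on_def
    proof (intro conjI ballI allI)
      fix x assume x: "x \<in> X (Suc n)"
      show "w n f x \<in> Y (Suc n)" unfolding w_def
        using x by (intro submod_diff[OF Y.X_submod] chain_homD(4)[OF hom(1)] chain_homD(4)[OF hom(2)] chain_homD(4)[OF c])
    qed (simp_all add: w_def chain_homD[OF hom(1)] chain_homD[OF hom(2)] chain_homD[OF c] translate_simps[OF G]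
         chain_space.scale_right_diff_distrib)
  qed
  have "\<exists>h. \<forall>n. P n (h n) \<and> Q n (h n) (h (Suc n))"
  proof (rule dependent_nat_choice)
    have z: "chain_hom G (X 0) (Y (Suc 0)) (\<lambda>_. 0)"
      using translate_simps(1)[OF G, of _ 0 0] submodD(1)[OF Y.X_submod]
      by (auto simp: chain_hom_def equivariant_on_def)
    have "P 0 (\<lambda>_. 0)"
      unfolding P_def
    proof (intro conjI ballI z)
      fix x assume x: "x \<in> X (Suc 0)"
      have wx: "w 0 (\<lambda>_. 0) x \<in> Y (Suc 0)" by (rule chain_homD(4)[OF w_hom[OF z] x])
      show "\<exists>y\<in>Y (Suc (Suc 0)). D' (Suc 0) y = w 0 (\<lambda>_. 0) x"
      proof (rule Y.exact[OF wx])
        show "D' 0 (w 0 (\<lambda>_. 0) x) = 0" using chain_homD(4)[OF Y.D_hom wx] by (simp add: Y.X_0)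
        have "\<epsilon>' (\<phi> 1 x - \<phi>' 1 x) = \<epsilon>' (\<phi> 1 x) - \<epsilon>' (\<phi>' 1 x)"
          using x by (intro aug_diff[OF Y.aug_equivariant Y.X_submod] chain_homD(4)[OF hom(1)] chain_homD(4)[OF hom(2)]) auto
        then show "\<epsilon>' (w 0 (\<lambda>_. 0) x) = 0" using aug x by (simp add: w_def)
      qed
    qed
    then show "\<exists>f. P 0 f" by blast
  next
    fix f n assume "P n f"
    then have f: "chain_hom G (X n) (Y (Suc n)) f"
      and tot: "\<And>x. x \<in> X (Suc n) \<Longrightarrow> \<exists>y\<in>Y (Suc (Suc n)). D' (Suc n) y = w n f x"
      by (auto simp: P_def)
    note w = w_hom[OF f]
    note DY = Y.D_hom[of "Suc n"]
    have "\<exists>f'. chain_hom G (X (Suc n)) (Y (Suc (Suc n))) f' \<and>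
       (\<forall>x\<in>X (Suc n). D' (Suc n) (f' x) = w n f x)"
    proof (rule projective_lift[OF G Y.X_submod X.X_free X.E_hom X.E_id])
      show "D' (Suc n) 0 = w n f 0"
        using X.chain_hom_zero[OF w] Y.chain_hom_zero[OF DY] by simp
    qed (use tot in \<open>simp_all add: chain_homD[OF w] chain_homD[OF DY]\<close>)
    then obtain f' where f': "chain_hom G (X (Suc n)) (Y (Suc (Suc n))) f'"
      "\<And>x. x \<in> X (Suc n) \<Longrightarrow> D' (Suc n) (f' x) = w n f x" by blast
    have "P (Suc n) f'"
      unfolding P_def
    proof (intro conjI ballI f'(1))
      fix x assume x: "x \<in> X (Suc (Suc n))"
      have Dx: "D (Suc n) x \<in> X (Suc n)" by (rule chain_homD(4)[OF X.D_hom x])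
      have wx: "w (Suc n) f' x \<in> Y (Suc (Suc n))" by (rule chain_homD(4)[OF w_hom[OF f'(1)] x])
      note h1 = chain_homD(4)[OF hom(1) x] and h2 = chain_homD(4)[OF hom(2) x]
      have "D' (Suc n) (w (Suc n) f' x) =
          D' (Suc n) (\<phi> (Suc (Suc n)) x) - D' (Suc n) (\<phi>' (Suc (Suc n)) x) - D' (Suc n) (f' (D (Suc n) x))"
        using chain_hom_diff[OF DY Y.X_submod submod_diff[OF Y.X_submod h1 h2] chain_homD(4)[OF f'(1) Dx]]
          chain_hom_diff[OF DY Y.X_submod h1 h2] by (simp add: w_def)
      also have "\<dots> = 0"
        using com[OF x] f'(2)[OF Dx] X.D_D[OF x] X.chain_hom_zero[OF f] by (simp add: w_def)
      finally show "\<exists>y\<in>Y (Suc (Suc (Suc n))). D' (Suc (Suc n)) y = w (Suc n) f' x"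
        by (intro Y.exact wx) auto
    qed
    moreover have "Q n f f'" using f'(2) by (simp add: Q_def)
    ultimately show "\<exists>f'. P (Suc n) f' \<and> Q n f f'" by blast
  qed
  then obtain h where h: "\<And>n. P n (h n)" "\<And>n. Q n (h n) (h (Suc n))" by blast
  have "chain_homotopy G X D Y D' \<phi> \<phi>' h"
    using h unfolding chain_homotopy_def P_def Q_def w_def by (auto simp: algebra_simps)
  then show ?thesis by blast
qed

section \<open>Equivariant cochains on a resolution\<close>

text \<open>Cohomology of the complex of equivariant maps \<open>Hom(X, V)\<close>: it vanishes in degree \<open>n\<close> (carried by
  \<open>X (Suc n)\<close>) if \<open>exact_at\<close> holds at \<open>n\<close>.\<close>

definition exact_at where
  "exact_at G sc act X D n \<longleftrightarrow>
     (\<forall>z. equivariant_on G (X (Suc n)) sc act z \<longrightarrow> (\<forall>x\<in>X (Suc (Suc n)). z (D (Suc n) x) = 0)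
        \<longrightarrow> (\<exists>b. equivariant_on G (X n) sc act b \<and> (\<forall>x\<in>X (Suc n). z x = b (D n x))))"

text \<open>The coboundaries in \<open>Hom(X (Suc n), V)\<close> are closed for pointwise convergence, so that the cohomology
  carried by \<open>X (Suc n)\<close> has no torsion.\<close>

definition closed_at where
  "closed_at G sc act X D n \<longleftrightarrow>
     (\<forall>z. equivariant_on G (X (Suc n)) sc act z \<longrightarrow>
        (\<forall>T e. finite T \<longrightarrow> T \<subseteq> X (Suc n) \<longrightarrow> e > 0 \<longrightarrow>
           (\<exists>b. equivariant_on G (X n) sc act b \<and> (\<forall>x\<in>T. norm (z x - b (D n x)) < (e::real))))
        \<longrightarrow> (\<exists>b. equivariant_on G (X n) sc act b \<and> (\<forall>x\<in>X (Suc n). z x = b (D n x))))"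

lemma homotopy_equivalence_exists:
  assumes X: "resolution G I X E D \<epsilon>" and Y: "resolution G J Y E' D' \<epsilon>'"
  obtains \<phi> \<psi> h where "chain_map G X D \<epsilon> Y D' \<epsilon>' \<phi>" "chain_map G Y D' \<epsilon>' X D \<epsilon> \<psi>"
    "chain_homotopy G Y D' Y D' (\<lambda>n y. \<phi> n (\<psi> n y)) (\<lambda>n y. y) h"
proof -
  obtain \<phi> \<psi> where c: "chain_map G X D \<epsilon> Y D' \<epsilon>' \<phi>" "chain_map G Y D' \<epsilon>' X D \<epsilon> \<psi>"
    using chain_map_exists[OF X Y] chain_map_exists[OF Y X] by blast
  have "chain_map G Y D' \<epsilon>' Y D' \<epsilon>' (\<lambda>n y. \<phi> n (\<psi> n y))"
    by (rule chain_map_comp[OF c(2,1)])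
  from chain_homotopy_exists[OF Y Y this chain_map_id] show thesis using that c by blast
qed

context rational_rep
begin

lemma equivariant_on_diff:
  assumes "equivariant_on G X sc act f" "equivariant_on G X sc act f'"
  shows "equivariant_on G X sc act (\<lambda>x. f x - f' x)"
proof -
  have "act g (x - y) = act g x - act g y" if "g \<in> carrier G" for g x y
    using act_add[OF that, of "x - y" y] by (simp add: algebra_simps)
  then show ?thesis using assms by (simp add: equivariant_on_def scale_right_diff_distrib)
qed

text \<open>Since the homotopy is \<open>\<phi>\<psi> - 1 = D'h + hD'\<close> and \<open>z\<close> vanishes on boundaries, \<open>z\<close> differs from its
  double pullback \<open>z\<phi>\<psi> = bD\<psi> = b\<psi>D'\<close> by the coboundary \<open>zhD'\<close>.\<close>

lemma cocycle_pulled_back_to_boundary: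
  assumes Y: "resolution G J Y E' D' \<epsilon>'"
    and \<psi>: "chain_map G Y D' \<epsilon>' X D \<epsilon> \<psi>"
    and h: "chain_homotopy G Y D' Y D' (\<lambda>n y. \<phi> n (\<psi> n y)) (\<lambda>n y. y) h"
    and \<phi>: "\<And>k. chain_hom G (X k) (Y k) (\<phi> k)"
    and z: "equivariant_on G (Y (Suc n)) sc act z" and zc: "\<And>y. y \<in> Y (Suc (Suc n)) \<Longrightarrow> z (D' (Suc n) y) = 0"
    and b: "equivariant_on G (X n) sc act b" "\<And>x. x \<in> X (Suc n) \<Longrightarrow> z (\<phi> (Suc n) x) = b (D n x)"
  shows "\<exists>b. equivariant_on G (Y n) sc act b \<and> (\<forall>y\<in>Y (Suc n). z y = b (D' n y))"
proof -
  interpret Y: resolution G J Y E' D' \<epsilon>' by fact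
  note \<psi> = \<psi>[unfolded chain_map_def] and h = h[unfolded chain_homotopy_def]
  have \<psi>h: "chain_hom G (Y k) (X k) (\<psi> k)" for k using \<psi> by blast
  have hh: "chain_hom G (Y k) (Y (Suc k)) (h k)" for k using h by blast
  have "z y = b (\<psi> n (D' n y)) - z (h n (D' n y))" if y: "y \<in> Y (Suc n)" for y
  proof -
    have hy: "h (Suc n) y \<in> Y (Suc (Suc n))" by (rule chain_homD(4)[OF hh y])
    have Dy: "D' n y \<in> Y n" by (rule chain_homD(4)[OF Y.D_hom y])
    have 1: "\<phi> (Suc n) (\<psi> (Suc n) y) - y = D' (Suc n) (h (Suc n) y) + h n (D' n y)" using h y by simp
    have "z (\<phi> (Suc n) (\<psi> (Suc n) y) - y) = z (\<phi> (Suc n) (\<psi> (Suc n) y)) - z y"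
      by (intro equivariant_diff[OF z Y.X_submod] chain_homD(4)[OF \<phi>] chain_homD(4)[OF \<psi>h] y)
    moreover have "z (D' (Suc n) (h (Suc n) y) + h n (D' n y)) = 0 + z (h n (D' n y))"
      using equivariant_onD(1)[OF z chain_homD(4)[OF Y.D_hom hy] chain_homD(4)[OF hh Dy]] zc[OF hy] by simp
    moreover have "z (\<phi> (Suc n) (\<psi> (Suc n) y)) = b (\<psi> n (D' n y))"
      using b(2)[OF chain_homD(4)[OF \<psi>h y]] \<psi> y by simp
    ultimately show ?thesis using 1 by (simp add: algebra_simps)
  qed
  moreover have "equivariant_on G (Y n) sc act (\<lambda>y. b (\<psi> n y) - z (h n y))"
    by (intro equivariant_on_diff equivariant_on_comp[OF \<psi>h b(1)] equivariant_on_comp[OF hh z])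
  ultimately show ?thesis by (intro exI[of _ "\<lambda>y. b (\<psi> n y) - z (h n y)"]) auto
qed

lemma exact_at_transfer:
  assumes X: "resolution G I X E D \<epsilon>" and Y: "resolution G J Y E' D' \<epsilon>'"
    and ex: "exact_at G sc act X D n"
  shows "exact_at G sc act Y D' n"
  unfolding exact_at_def
proof (intro allI impI)
  fix z assume z: "equivariant_on G (Y (Suc n)) sc act z" and zc: "\<forall>y\<in>Y (Suc (Suc n)). z (D' (Suc n) y) = 0"
  obtain \<phi> \<psi> h where \<phi>: "chain_map G X D \<epsilon> Y D' \<epsilon>' \<phi>" and \<psi>: "chain_map G Y D' \<epsilon>' X D \<epsilon> \<psi>"
    and h: "chain_homotopy G Y D' Y D' (\<lambda>n y. \<phi> n (\<psi> n y)) (\<lambda>n y. y) h"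
    by (rule homotopy_equivalence_exists[OF X Y])
  note \<phi> = \<phi>[unfolded chain_map_def]
  have \<phi>h: "chain_hom G (X k) (Y k) (\<phi> k)" for k using \<phi> by blast
  have "z (\<phi> (Suc n) (D (Suc n) x)) = 0" if x: "x \<in> X (Suc (Suc n))" for x
  proof -
    have "\<phi> (Suc n) (D (Suc n) x) = D' (Suc n) (\<phi> (Suc (Suc n)) x)" using \<phi> x by simp
    then show ?thesis using zc chain_homD(4)[OF \<phi>h x] by simp
  qed
  then obtain b where "equivariant_on G (X n) sc act b" "\<And>x. x \<in> X (Suc n) \<Longrightarrow> z (\<phi> (Suc n) x) = b (D n x)"
    using ex equivariant_on_comp[OF \<phi>h z] unfolding exact_at_def by blast
  then show "\<exists>b. equivariant_on G (Y n) sc act b \<and> (\<forall>y\<in>Y (Suc n). z y = b (D' n y))"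
    using zc by (intro cocycle_pulled_back_to_boundary[OF Y \<psi> h \<phi>h z]) auto
qed

end

text \<open>Coboundaries vanish on boundaries, and evaluation at a single boundary is continuous.\<close>

lemma (in resolution) approximable_imp_cocycle:
  fixes act :: "'g \<Rightarrow> 'v::real_normed_vector \<Rightarrow> 'v"
  assumes "rational_rep G sc act"
    and app: "\<And>T e. finite T \<Longrightarrow> T \<subseteq> X (Suc n) \<Longrightarrow> e > 0 \<Longrightarrow>
       \<exists>b. equivariant_on G (X n) sc act b \<and> (\<forall>x\<in>T. norm (z x - b (D n x)) < (e::real))"
    and y: "y \<in> X (Suc (Suc n))"
  shows "z (D (Suc n) y) = 0"
proof (rule ccontr)
  interpret rational_rep G sc act by fact
  assume "z (D (Suc n) y) \<noteq> 0"
  then have pos: "norm (z (D (Suc n) y)) > 0" by simp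
  have "D (Suc n) y \<in> X (Suc n)" by (rule chain_homD(4)[OF D_hom y])
  then obtain b where b: "equivariant_on G (X n) sc act b"
    "norm (z (D (Suc n) y) - b (D n (D (Suc n) y))) < norm (z (D (Suc n) y))"
    using app[of "{D (Suc n) y}", OF _ _ pos] by auto
  then show False using D_D[OF y] equivariant_zero[OF b(1) submodD(1)[OF X_submod]] by simp
qed

lemma closed_at_transfer:
  fixes act :: "'g \<Rightarrow> 'v::real_normed_vector \<Rightarrow> 'v"
  assumes rep: "rational_rep G sc act"
    and X: "resolution G I X E D \<epsilon>" and Y: "resolution G J Y E' D' \<epsilon>'"
    and cl: "closed_at G sc act X D n"
  shows "closed_at G sc act Y D' n"
  unfolding closed_at_def
proof (intro allI impI)
  interpret rational_rep G sc act by fact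
  fix z assume z: "equivariant_on G (Y (Suc n)) sc act z"
    and app: "\<forall>T e. finite T \<longrightarrow> T \<subseteq> Y (Suc n) \<longrightarrow> e > 0 \<longrightarrow>
           (\<exists>b. equivariant_on G (Y n) sc act b \<and> (\<forall>x\<in>T. norm (z x - b (D' n x)) < (e::real)))"
  obtain \<phi> \<psi> h where \<phi>: "chain_map G X D \<epsilon> Y D' \<epsilon>' \<phi>" and \<psi>: "chain_map G Y D' \<epsilon>' X D \<epsilon> \<psi>"
    and h: "chain_homotopy G Y D' Y D' (\<lambda>n y. \<phi> n (\<psi> n y)) (\<lambda>n y. y) h"
    by (rule homotopy_equivalence_exists[OF X Y])
  note \<phi> = \<phi>[unfolded chain_map_def]
  have \<phi>h: "chain_hom G (X k) (Y k) (\<phi> k)" for k using \<phi> by blast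
  have 1: "equivariant_on G (X (Suc n)) sc act (\<lambda>x. z (\<phi> (Suc n) x))"
    by (rule equivariant_on_comp[OF \<phi>h z])
  have 2: "\<exists>b. equivariant_on G (X n) sc act b \<and> (\<forall>x\<in>T. norm (z (\<phi> (Suc n) x) - b (D n x)) < e)"
    if T: "finite T" "T \<subseteq> X (Suc n)" "e > 0" for T e
  proof -
    have "\<phi> (Suc n) ` T \<subseteq> Y (Suc n)" using T(2) chain_homD(4)[OF \<phi>h] by blast
    then obtain b where b: "equivariant_on G (Y n) sc act b" "\<And>x. x \<in> T \<Longrightarrow> norm (z (\<phi> (Suc n) x) - b (D' n (\<phi> (Suc n) x))) < e"
      using app[rule_format, of "\<phi> (Suc n) ` T", OF finite_imageI[OF T(1)] _ T(3)] by auto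
    have "b (D' n (\<phi> (Suc n) x)) = b (\<phi> n (D n x))" if "x \<in> T" for x using \<phi> T(2) that by auto
    then show ?thesis using b equivariant_on_comp[OF \<phi>h b(1)] by (intro exI[of _ "\<lambda>x. b (\<phi> n x)"]) auto
  qed
  obtain b where b: "equivariant_on G (X n) sc act b" "\<And>x. x \<in> X (Suc n) \<Longrightarrow> z (\<phi> (Suc n) x) = b (D n x)"
    using cl[unfolded closed_at_def, rule_format, OF 1 2] by blast
  have zc: "z (D' (Suc n) y) = 0" if "y \<in> Y (Suc (Suc n))" for y
    by (rule resolution.approximable_imp_cocycle[OF Y rep _ that]) (use app in simp)
  show "\<exists>b. equivariant_on G (Y n) sc act b \<and> (\<forall>y\<in>Y (Suc n). z y = b (D' n y))"
    by (rule cocycle_pulled_back_to_boundary[OF Y \<psi> h \<phi>h z zc b])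
qed

section \<open>The bar resolution\<close>

fun bar_index :: "('g, 'x) monoid_scheme \<Rightarrow> nat \<Rightarrow> 'g list set" where
  "bar_index G 0 = {}"
| "bar_index G (Suc n) = group_power G n"

abbreviation bar_module :: "('g, 'x) monoid_scheme \<Rightarrow> nat \<Rightarrow> ('g list, 'g) chain set" where
  "bar_module G n \<equiv> free_chains G (bar_index G n)"

definition bar_face_sum :: "('g, 'x) monoid_scheme \<Rightarrow> nat \<Rightarrow> 'g list \<Rightarrow> ('g list, 'g) chain" where
  "bar_face_sum G n gs = single (tl gs, hd gs) 1
     + (\<Sum>i=1..n. scale_chain ((-1) ^ i) (gen G (merge_at G i gs)))
     + scale_chain ((-1) ^ Suc n) (gen G (butlast gs))"

fun bar_boundary :: "('g, 'x) monoid_scheme \<Rightarrow> nat \<Rightarrow> ('g list, 'g) chain \<Rightarrow> ('g list, 'g) chain" where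
  "bar_boundary G 0 = (\<lambda>_. 0)"
| "bar_boundary G (Suc n) = extend G (bar_face_sum G n)"

definition augmentation :: "('k \<Rightarrow>\<^sub>0 rat) \<Rightarrow> rat" where
  "augmentation = lin (*) (\<lambda>_. 1)"

text \<open>The contraction \<open>g[g\<^sub>1|\<dots>|g\<^sub>n] \<mapsto> [g|g\<^sub>1|\<dots>|g\<^sub>n]\<close>, which is linear but not equivariant.\<close>

definition bar_contraction :: "('g, 'x) monoid_scheme \<Rightarrow> ('g list, 'g) chain \<Rightarrow> ('g list, 'g) chain" where
  "bar_contraction G = lin scale_chain (\<lambda>(gs, g). gen G (g # gs))"

lemma rat_space_times: "rat_space ((*) :: rat \<Rightarrow> rat \<Rightarrow> rat)"
  by unfold_locales (simp_all add: algebra_simps)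

lemma augmentation_simps:
  "augmentation (x + y) = augmentation x + augmentation y"
  "augmentation (scale_chain r x) = r * augmentation x"
  "augmentation 0 = 0"
  "augmentation (single k r) = r"
proof -
  interpret rat_space "(*) :: rat \<Rightarrow> rat \<Rightarrow> rat" by (rule rat_space_times)
  show "augmentation (x + y) = augmentation x + augmentation y"
    "augmentation (scale_chain r x) = r * augmentation x"
    "augmentation 0 = 0"
    "augmentation (single k r) = r"
    by (simp_all add: augmentation_def lin_add lin_scale)
qed

lemma augmentation_translate: "augmentation (translate G g x) = augmentation x"
proof -
  have "supp x \<subseteq> UNIV" by simp
  then show ?thesis
  proof (induction x rule: chain_induct)
    case (single k)
    then show ?case by (simp add: translate_def augmentation_simps split: prod.split)
  qed (simp_all add: translate_def chain_space.lin_add chain_space.lin_scale augmentation_simps)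
qed

lemma bar_contraction_simps:
  "bar_contraction G (x + y) = bar_contraction G x + bar_contraction G y"
  "bar_contraction G (scale_chain r x) = scale_chain r (bar_contraction G x)"
  "bar_contraction G 0 = 0"
  "bar_contraction G (single (gs, g) r) = scale_chain r (gen G (g # gs))"
  by (simp_all add: bar_contraction_def chain_space.lin_add chain_space.lin_scale del: scale_chain_single)

lemma bar_contraction_sum: "bar_contraction G (sum f A) = (\<Sum>a\<in>A. bar_contraction G (f a))"
  by (induction A rule: infinite_finite_induct) (simp_all add: bar_contraction_simps)

lemma bar_boundary_simps:
  "bar_boundary G n (x + y) = bar_boundary G n x + bar_boundary G n y"
  "bar_boundary G n (scale_chain r x) = scale_chain r (bar_boundary G n x)"
  "bar_boundary G n 0 = 0"
  by (cases n; simp add: ext_act_def chain_space.lin_add chain_space.lin_scale)+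

lemma bar_boundary_diff: "bar_boundary G n (x - y) = bar_boundary G n x - bar_boundary G n y"
  using bar_boundary_simps(1)[of G n "x - y" y] by (simp add: algebra_simps)

lemma merge_at_Cons_1: "gs \<noteq> [] \<Longrightarrow> merge_at G 1 (g # gs) = (g \<otimes>\<^bsub>G\<^esub> hd gs) # tl gs"
  by (cases gs) (simp_all add: merge_at_def)

lemma merge_at_Cons_Suc: "i \<ge> 1 \<Longrightarrow> merge_at G (Suc i) (g # gs) = g # merge_at G i gs"
  by (cases i) (simp_all add: merge_at_def)

lemma merge_at_in_group_power:
  assumes "group G" "gs \<in> group_power G (Suc n)" "i \<in> {1..n}"
  shows "merge_at G i gs \<in> group_power G n"
proof -
  interpret group G by fact
  have "gs ! (i - 1) \<in> carrier G" "gs ! i \<in> carrier G"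
    using assms(2,3) by (auto simp: group_power_def)
  then show ?thesis
    using assms(2,3) by (auto simp: merge_at_def group_power_def dest!: in_set_takeD in_set_dropD)
qed

lemma bar_face_sum_in_free_chains:
  assumes G: "group G" and gs: "gs \<in> group_power G (Suc n)"
  shows "bar_face_sum G n gs \<in> free_chains G (group_power G n)"
proof -
  note F = submodD[OF submod_free_chains[OF G, of "group_power G n"]]
  have sum: "(\<Sum>i\<in>A. f i) \<in> free_chains G (group_power G n)"
    if "\<And>i. i \<in> A \<Longrightarrow> f i \<in> free_chains G (group_power G n)" for A :: "nat set" and f
    using that by (induction A rule: infinite_finite_induct) (auto simp: F(1,2))
  have 1: "single (tl gs, hd gs) 1 \<in> free_chains G (group_power G n)"
    using gs by (cases gs) (auto simp: free_chains_def group_power_def)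
  have 2: "butlast gs \<in> group_power G n"
    using gs by (auto simp: group_power_def dest: in_set_butlastD)
  show ?thesis
    unfolding bar_face_sum_def
    by (intro F(2) F(3) sum 1 gen_in_free_chains[OF G] 2 merge_at_in_group_power[OF G gs])
qed

lemma bar_boundary_hom:
  fixes G :: "('g, 'x) monoid_scheme"
  assumes G: "group G"
  shows "chain_hom G (bar_module G (Suc n)) (bar_module G n) (bar_boundary G n)"
proof (cases n)
  case 0
  then show ?thesis
    using translate_simps(1)[OF G, of _ 0 0]
    by (auto simp: chain_hom_def equivariant_on_def free_chains_def)
next
  case (Suc m)
  interpret rational_rep G "scale_chain" "translate G :: 'g \<Rightarrow> ('g list, 'g) chain \<Rightarrow> _"
    by (rule rational_rep_translate[OF G])
  show ?thesis
    using Suc ext_act_equivariant[of "group_power G (Suc m)" "bar_face_sum G m"]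
      ext_act_closed[OF G submod_free_chains[OF G], of "group_power G (Suc m)" "bar_face_sum G m"]
      bar_face_sum_in_free_chains[OF G, of _ m]
    by (simp add: chain_hom_def)
qed

lemma bar_contraction_in_free_chains:
  assumes G: "group G" and x: "x \<in> free_chains G (group_power G n)"
  shows "bar_contraction G x \<in> free_chains G (group_power G (Suc n))"
proof -
  note F = submodD[OF submod_free_chains[OF G, of "group_power G (Suc n)"]]
  have "supp x \<subseteq> group_power G n \<times> carrier G" using x by (simp add: free_chains_def)
  then show ?thesis
  proof (induction x rule: chain_induct)
    case (single k)
    then obtain gs g where "k = (gs, g)" "gs \<in> group_power G n" "g \<in> carrier G" by blast
    moreover from this have "g # gs \<in> group_power G (Suc n)" by (simp add: group_power_def)
    ultimately show ?case using gen_in_free_chains[OF G, of "g # gs"]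
      by (simp add: bar_contraction_simps)
  qed (simp_all add: bar_contraction_simps F)
qed

text \<open>The faces of \<open>[g|g\<^sub>1|\<dots>|g\<^sub>n]\<close> are \<open>g[g\<^sub>1|\<dots>|g\<^sub>n]\<close> itself, followed by the contractions of the faces of
  \<open>g[g\<^sub>1|\<dots>|g\<^sub>n]\<close> with the opposite signs.\<close>

lemma bar_contraction_homotopy:
  fixes G :: "('g, 'x) monoid_scheme"
  assumes G: "group G" and x: "x \<in> free_chains G (group_power G n)"
  shows "bar_boundary G (Suc n) (bar_contraction G x)
    = x - (if n = 0 then scale_chain (augmentation x) (gen G []) else bar_contraction G (bar_boundary G n x))"
proof -
  interpret rational_rep G "scale_chain" "translate G :: 'g \<Rightarrow> ('g list, 'g) chain \<Rightarrow> _"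
    by (rule rational_rep_translate[OF G])
  have "supp x \<subseteq> group_power G n \<times> carrier G" using x by (simp add: free_chains_def)
  then show ?thesis
  proof (induction x rule: chain_induct)
    case zero show ?case
      by (simp add: bar_contraction_simps bar_boundary_simps augmentation_simps del: bar_boundary.simps)
  next
    case (add x y) then show ?case
      by (simp add: bar_contraction_simps bar_boundary_simps augmentation_simps
          chain_space.scale_left_distrib single_add del: bar_boundary.simps)
  next
    case (sc r x) then show ?case
      by (simp add: bar_contraction_simps bar_boundary_simps augmentation_simps
          chain_space.scale_right_diff_distrib del: bar_boundary.simps)
  next
    case (single k)
    then obtain gs g where k: "k = (gs, g)" "gs \<in> group_power G n" "g \<in> carrier G" by blast
    have L: "bar_boundary G (Suc n) (bar_contraction G (single k 1)) = bar_face_sum G n (g # gs)"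
      using k by (simp add: bar_contraction_simps)
    show ?case
    proof (cases n)
      case 0
      then show ?thesis using k unfolding L
        by (simp add: bar_face_sum_def group_power_def augmentation_simps single_uminus)
    next
      case (Suc m)
      then have gs: "gs \<noteq> []" "length gs = Suc m" using k by (auto simp: group_power_def)
      have hd: "hd gs \<in> carrier G" using gs k by (cases gs) (auto simp: group_power_def)
      let ?f = "\<lambda>i. scale_chain ((-1) ^ i) (gen G (merge_at G i (g # gs)))"
      have "(\<Sum>i=1..n. ?f i) = ?f 1 + (\<Sum>i=Suc 1..Suc m. ?f i)"
        using Suc by (simp add: sum.atLeast_Suc_atMost)
      also have "(\<Sum>i=Suc 1..Suc m. ?f i) = (\<Sum>i=1..m. ?f (Suc i))"
        by (rule sum.shift_bounds_cl_Suc_ivl)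
      also have "\<dots> = - (\<Sum>i=1..m. scale_chain ((-1) ^ i) (gen G (g # merge_at G i gs)))"
        unfolding sum_negf[symmetric] by (rule sum.cong) (auto simp: merge_at_Cons_Suc single_uminus)
      finally have 1: "bar_face_sum G n (g # gs) = single k 1 - gen G ((g \<otimes>\<^bsub>G\<^esub> hd gs) # tl gs)
          - (\<Sum>i=1..m. scale_chain ((-1) ^ i) (gen G (g # merge_at G i gs)))
          - scale_chain ((-1) ^ n) (gen G (g # butlast gs))"
        using merge_at_Cons_1[OF gs(1), of G g] k(1) gs(1) by (simp add: bar_face_sum_def single_uminus)
      have "single k 1 = translate G g (gen G gs)"
        using k by (simp add: translate_single)
      then have "bar_boundary G n (single k 1) = translate G g (bar_face_sum G m gs)"
        using Suc k chain_homD(3)[OF bar_boundary_hom[OF G, of n] k(3), of "gen G gs"] gen_in_free_chains[OF G, of gs]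
        by simp
      also have "bar_contraction G \<dots> = gen G ((g \<otimes>\<^bsub>G\<^esub> hd gs) # tl gs)
          + (\<Sum>i=1..m. scale_chain ((-1) ^ i) (gen G (g # merge_at G i gs)))
          + scale_chain ((-1) ^ n) (gen G (g # butlast gs))"
      proof -
        have tr_sum: "translate G g (sum f A) = (\<Sum>a\<in>A. translate G g (f a))"
          for A :: "nat set" and f :: "nat \<Rightarrow> ('g list, 'g) chain"
          using act_add[OF k(3), of 0 0]
          by (induction A rule: infinite_finite_induct) (simp_all add: act_add[OF k(3)])
        show ?thesis using hd k(3) Suc
          by (simp add: bar_face_sum_def act_add tr_sum translate_single bar_contraction_simps bar_contraction_sum)
      qed
      finally show ?thesis using Suc 1 L by (simp add: algebra_simps)
    qed
  qed
qed

text \<open>No double sum over faces is needed. Every generator is a value of the contraction \<open>s\<close>, and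
  \<open>\<partial>\<partial>s = \<partial>(1 - s\<partial>) = \<partial> - (1 - s\<partial>)\<partial> = s\<partial>\<partial>\<close>, which vanishes by induction; in the lowest
  degree the augmentation takes the place of the missing boundary.\<close>

lemma bar_boundary_boundary:
  fixes G :: "('g, 'x) monoid_scheme"
  assumes G: "group G" and x: "x \<in> bar_module G (Suc (Suc n))"
  shows "bar_boundary G n (bar_boundary G (Suc n) x) = 0 \<and> (n = 0 \<longrightarrow> augmentation (bar_boundary G (Suc n) x) = 0)"
  using x
proof (induction n arbitrary: x)
  case 0
  interpret rational_rep G "scale_chain" "translate G :: 'g \<Rightarrow> ('g list, 'g) chain \<Rightarrow> _"
    by (rule rational_rep_translate[OF G])
  have "augmentation (bar_boundary G (Suc 0) x) = 0" using G 0
  proof (induction x rule: free_chains_induct)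
    case zero then show ?case by (simp only: bar_boundary_simps augmentation_simps)
  next
    case (add x y) then show ?case by (simp add: bar_boundary_simps augmentation_simps del: bar_boundary.simps)
  next
    case (sc r x) then show ?case by (simp add: bar_boundary_simps augmentation_simps del: bar_boundary.simps)
  next
    case (translate g x)
    then show ?case using chain_homD(3)[OF bar_boundary_hom[OF G, of "Suc 0"] translate(1,2)] by (simp add: augmentation_translate)
  next
    case (gen gs)
    then show ?case by (simp add: bar_face_sum_def augmentation_simps)
  qed
  then show ?case by simp
next
  case (Suc n)
  interpret rational_rep G "scale_chain" "translate G :: 'g \<Rightarrow> ('g list, 'g) chain \<Rightarrow> _"
    by (rule rational_rep_translate[OF G])
  have hom: "chain_hom G (bar_module G (Suc (Suc (Suc n)))) (bar_module G (Suc n))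
     (\<lambda>x. bar_boundary G (Suc n) (bar_boundary G (Suc (Suc n)) x))"
    by (rule chain_hom_comp[OF bar_boundary_hom[OF G] bar_boundary_hom[OF G]])
  have "bar_boundary G (Suc n) (bar_boundary G (Suc (Suc n)) x) = 0" using G Suc.prems
  proof (induction x rule: free_chains_induct)
    case zero then show ?case by (simp only: bar_boundary_simps)
  next
    case (add x y) then show ?case by (simp only: bar_boundary_simps add_0)
  next
    case (sc r x) then show ?case by (simp only: bar_boundary_simps chain_space.scale_zero_right)
  next
    case (translate g x)
    have "translate G g (0 :: ('g list, 'g) chain) = 0" using act_add[OF translate(1), of 0 0] by simp
    then show ?case using chain_homD(3)[OF hom translate(1,2)] translate(3) by (simp del: bar_boundary.simps)
  next
    case (gen gs)
    obtain g hs where gs: "gs = g # hs" "g \<in> carrier G" "hs \<in> group_power G (Suc n)"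
      using gen by (cases gs) (auto simp: group_power_def)
    let ?y = "single (hs, g) 1 :: ('g list, 'g) chain"
    have y: "?y \<in> free_chains G (group_power G (Suc n))" using gs by (simp add: free_chains_def)
    let ?w = "bar_boundary G (Suc n) ?y"
    have w: "?w \<in> free_chains G (group_power G n)"
      using chain_homD(4)[OF bar_boundary_hom[OF G, of "Suc n"], of ?y] y by (simp del: bar_boundary.simps)
    have IH: "bar_boundary G n ?w = 0" "n = 0 \<Longrightarrow> augmentation ?w = 0" using Suc.IH[of ?y] y by simp_all
    have "bar_boundary G (Suc (Suc n)) (gen G gs) = bar_boundary G (Suc (Suc n)) (bar_contraction G ?y)"
      by (simp add: gs(1) bar_contraction_simps del: bar_boundary.simps)
    also have "\<dots> = ?y - bar_contraction G ?w"
      by (subst bar_contraction_homotopy[OF G y]) simp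
    also have "bar_boundary G (Suc n) \<dots> = ?w - bar_boundary G (Suc n) (bar_contraction G ?w)"
      by (rule bar_boundary_diff)
    also have "\<dots> = 0"
      using IH by (subst bar_contraction_homotopy[OF G w]) (simp add: bar_contraction_simps del: bar_boundary.simps)
    finally show ?case .
  qed
  then show ?case by simp
qed

lemma resolution_bar:
  fixes G :: "('g, 'x) monoid_scheme"
  assumes G: "group G"
  shows "resolution G (bar_index G) (bar_module G) (\<lambda>n x. x) (bar_boundary G) augmentation"
proof -
  interpret group G by fact
  show ?thesis
  proof
    show "chain_hom G (bar_module G n) (bar_module G n) (\<lambda>x. x)" for n
      by (simp add: chain_hom_def equivariant_on_def)
    show "equivariant_on G (bar_module G 1) (*) (\<lambda>_ r. r) augmentation"
      by (simp add: equivariant_on_def augmentation_simps augmentation_translate)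
    show "bar_module G 0 = {0}"
      by (auto simp: free_chains_def)
    have "gen G [] \<in> bar_module G 1"
      by (simp add: gen_in_free_chains[OF G] group_power_def)
    then show "\<exists>x\<in>bar_module G 1. augmentation x = 1"
      by (rule bexI[rotated]) (simp add: augmentation_simps)
  next
    fix n x assume x: "x \<in> bar_module G (Suc n)" "bar_boundary G n x = 0" "n = 0 \<Longrightarrow> augmentation x = 0"
    have "bar_boundary G (Suc n) (bar_contraction G x) = x"
      using x bar_contraction_homotopy[OF G, of x n] by (simp add: bar_contraction_simps split: if_splits)
    then show "\<exists>y\<in>bar_module G (Suc (Suc n)). bar_boundary G (Suc n) y = x"
      using bar_contraction_in_free_chains[OF G, of x n] x(1) by auto
  next
    fix x assume "x \<in> bar_module G 2"
    then show "augmentation (bar_boundary G 1 x) = 0"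
      using bar_boundary_boundary[OF G, of x 0] by (simp add: numeral_2_eq_2)
  qed (use submod_free_chains[OF G] bar_boundary_hom[OF G] bar_boundary_boundary[OF G] in auto)
qed

section \<open>Finite-type resolutions in coordinates\<close>

definition free_module :: "('r, 'x) ring_scheme \<Rightarrow> 's set \<Rightarrow> ('r, 's \<Rightarrow> 'r) module" where
  "free_module R S =
    \<lparr>carrier = {m. (\<forall>s\<in>S. m s \<in> carrier R) \<and> (\<forall>s. s \<notin> S \<longrightarrow> m s = \<zero>\<^bsub>R\<^esub>)},
     mult = (\<lambda>m _. m), one = (\<lambda>_. \<zero>\<^bsub>R\<^esub>), zero = (\<lambda>_. \<zero>\<^bsub>R\<^esub>),
     add = (\<lambda>m m' s. m s \<oplus>\<^bsub>R\<^esub> m' s), smult = (\<lambda>a m s. a \<otimes>\<^bsub>R\<^esub> m s)\<rparr>"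

lemma left_module_free_module:
  assumes "ring R"
  shows "left_module R (free_module R S)"
proof -
  interpret ring R by fact
  let ?M = "free_module R S"
  have el: "m s \<in> carrier R" if "m \<in> carrier ?M" for m s
    using that by (cases "s \<in> S") (simp_all add: free_module_def)
  have add: "m \<oplus>\<^bsub>?M\<^esub> m' = (\<lambda>s. m s \<oplus>\<^bsub>R\<^esub> m' s)" for m m'
    by (simp add: free_module_def)
  have smult: "a \<odot>\<^bsub>?M\<^esub> m = (\<lambda>s. a \<otimes>\<^bsub>R\<^esub> m s)" for a m
    by (simp add: free_module_def)
  have zero: "\<zero>\<^bsub>?M\<^esub> = (\<lambda>s. \<zero>\<^bsub>R\<^esub>)"
    by (simp add: free_module_def)
  have grp: "abelian_group ?M"
  proof (rule abelian_groupI)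
    fix m assume m: "m \<in> carrier ?M"
    show "\<exists>m'\<in>carrier ?M. m' \<oplus>\<^bsub>?M\<^esub> m = \<zero>\<^bsub>?M\<^esub>"
    proof (rule bexI)
      show "(\<lambda>s. \<ominus>\<^bsub>R\<^esub> m s) \<oplus>\<^bsub>?M\<^esub> m = \<zero>\<^bsub>?M\<^esub>"
        by (simp add: add zero l_neg el[OF m])
      show "(\<lambda>s. \<ominus>\<^bsub>R\<^esub> m s) \<in> carrier ?M"
        using m by (simp add: free_module_def)
    qed
    show "\<zero>\<^bsub>?M\<^esub> \<oplus>\<^bsub>?M\<^esub> m = m"
      by (simp add: add zero el[OF m])
    fix m' assume m': "m' \<in> carrier ?M"
    show "m \<oplus>\<^bsub>?M\<^esub> m' \<in> carrier ?M"
      using m m' by (simp add: free_module_def)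
    show "m \<oplus>\<^bsub>?M\<^esub> m' = m' \<oplus>\<^bsub>?M\<^esub> m"
      by (simp add: add a_comm[OF el[OF m] el[OF m']])
    fix n assume n: "n \<in> carrier ?M"
    show "m \<oplus>\<^bsub>?M\<^esub> m' \<oplus>\<^bsub>?M\<^esub> n
        = m \<oplus>\<^bsub>?M\<^esub> (m' \<oplus>\<^bsub>?M\<^esub> n)"
      by (simp add: add a_assoc[OF el[OF m] el[OF m'] el[OF n]])
  qed (simp add: free_module_def)
  show ?thesis
    unfolding left_module_def left_module_axioms_def
  proof (intro conjI allI impI grp assms)
    fix a m assume a: "a \<in> carrier R" and m: "m \<in> carrier ?M"
    show "a \<odot>\<^bsub>?M\<^esub> m \<in> carrier ?M"
      using a m by (simp add: free_module_def)
    fix b assume b: "b \<in> carrier R"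
    show "(a \<oplus>\<^bsub>R\<^esub> b) \<odot>\<^bsub>?M\<^esub> m
        = a \<odot>\<^bsub>?M\<^esub> m \<oplus>\<^bsub>?M\<^esub> b \<odot>\<^bsub>?M\<^esub> m"
      by (simp add: add smult l_distr[OF a b el[OF m]])
    show "(a \<otimes>\<^bsub>R\<^esub> b) \<odot>\<^bsub>?M\<^esub> m = a \<odot>\<^bsub>?M\<^esub> (b \<odot>\<^bsub>?M\<^esub> m)"
      by (simp add: smult m_assoc[OF a b el[OF m]])
  next
    fix a m m' assume a: "a \<in> carrier R" and m: "m \<in> carrier ?M" "m' \<in> carrier ?M"
    show "a \<odot>\<^bsub>?M\<^esub> (m \<oplus>\<^bsub>?M\<^esub> m')
        = a \<odot>\<^bsub>?M\<^esub> m \<oplus>\<^bsub>?M\<^esub> a \<odot>\<^bsub>?M\<^esub> m'"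
      by (simp add: add smult r_distr[OF el[OF m(1)] el[OF m(2)] a])
  next
    fix m assume m: "m \<in> carrier ?M"
    show "\<one>\<^bsub>R\<^esub> \<odot>\<^bsub>?M\<^esub> m = m" by (simp add: smult el[OF m])
  qed
qed

lemma (in left_module) smult_zero:
  assumes "a \<in> carrier R" shows "a \<odot>\<^bsub>M\<^esub> \<zero>\<^bsub>M\<^esub> = \<zero>\<^bsub>M\<^esub>"
proof -
  note z = smult_closed[OF assms M.zero_closed]
  have "a \<odot>\<^bsub>M\<^esub> \<zero>\<^bsub>M\<^esub> \<oplus>\<^bsub>M\<^esub> a \<odot>\<^bsub>M\<^esub> \<zero>\<^bsub>M\<^esub> = a \<odot>\<^bsub>M\<^esub> (\<zero>\<^bsub>M\<^esub> \<oplus>\<^bsub>M\<^esub> \<zero>\<^bsub>M\<^esub>)"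
    by (rule smult_r_distr[symmetric]) (use assms in auto)
  also have "\<dots> = a \<odot>\<^bsub>M\<^esub> \<zero>\<^bsub>M\<^esub>" by simp
  finally show ?thesis using M.add.l_cancel_one[OF z z] by simp
qed

lemma (in left_module) smult_finsum:
  assumes "finite S" "a \<in> carrier R" "f \<in> S \<rightarrow> carrier M"
  shows "a \<odot>\<^bsub>M\<^esub> finsum M f S = finsum M (\<lambda>s. a \<odot>\<^bsub>M\<^esub> f s) S"
  using assms(1,3)
proof (induction S rule: finite_induct)
  case empty then show ?case by (simp add: smult_zero assms(2))
next
  case (insert s S)
  then have "f s \<in> carrier M" "f \<in> S \<rightarrow> carrier M" by auto
  moreover from this have "(\<lambda>s. a \<odot>\<^bsub>M\<^esub> f s) \<in> S \<rightarrow> carrier M" using smult_closed assms(2) by auto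
  ultimately show ?case using insert assms(2)
    by (simp add: M.finsum_insert smult_r_distr smult_closed M.finsum_closed)
qed

text \<open>The dual basis lemma: \<open>h\<close> is a splitting of the surjection from the free module on a finite
  generating set.\<close>

lemma projective_coordinates:
  fixes R :: "('r, 'x) ring_scheme" and P :: "('r, 'm) module"
  assumes proj: "projective_module R P" and fg: "finitely_generated_module R P"
  obtains S h where "finite S" "S \<subseteq> carrier P" "h \<in> module_hom R P (free_module R S)"
    "\<forall>x\<in>carrier P. finsum P (\<lambda>s. h x s \<odot>\<^bsub>P\<^esub> s) S = x"
proof -
  interpret P: left_module R P using proj by (simp add: projective_module_def)
  obtain S where S: "S \<subseteq> carrier P" "finite S"
    and gen: "\<And>x. x \<in> carrier P \<Longrightarrow> \<exists>c\<in>S \<rightarrow> carrier R. x = finsum P (\<lambda>s. c s \<odot>\<^bsub>P\<^esub> s) S"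
    using fg unfolding finitely_generated_module_def by blast
  let ?M = "free_module R S"
  define p where "p m = finsum P (\<lambda>s. m s \<odot>\<^bsub>P\<^esub> s) S" for m
  have el: "m s \<in> carrier R" if "m \<in> carrier ?M" "s \<in> S" for m s
    using that by (auto simp: free_module_def)
  have sm: "m s \<odot>\<^bsub>P\<^esub> s \<in> carrier P" if "m \<in> carrier ?M" "s \<in> S" for m s
    using el[OF that] that S by (auto intro: P.smult_closed)
  have p_hom: "p \<in> module_hom R ?M P"
    unfolding module_hom_def
  proof (intro CollectI conjI ballI)
    show "p \<in> carrier ?M \<rightarrow> carrier P"
      unfolding p_def by (intro funcsetI P.M.finsum_closed sm)
  next
    fix m m' assume m: "m \<in> carrier ?M" "m' \<in> carrier ?M"
    have add: "(m \<oplus>\<^bsub>?M\<^esub> m') s = m s \<oplus>\<^bsub>R\<^esub> m' s" for s by (simp add: free_module_def)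
    have "p (m \<oplus>\<^bsub>?M\<^esub> m') = finsum P (\<lambda>s. m s \<odot>\<^bsub>P\<^esub> s \<oplus>\<^bsub>P\<^esub> m' s \<odot>\<^bsub>P\<^esub> s) S"
      unfolding p_def add
      by (intro P.M.finsum_cong' refl funcsetI P.M.a_closed sm m P.smult_l_distr el subsetD[OF S(1)])
    also have "\<dots> = p m \<oplus>\<^bsub>P\<^esub> p m'"
      unfolding p_def by (intro P.M.finsum_addf funcsetI sm m)
    finally show "p (m \<oplus>\<^bsub>?M\<^esub> m') = p m \<oplus>\<^bsub>P\<^esub> p m'" .
  next
    fix a m assume a: "a \<in> carrier R" and m: "m \<in> carrier ?M"
    have smult: "(a \<odot>\<^bsub>?M\<^esub> m) s = a \<otimes>\<^bsub>R\<^esub> m s" for s by (simp add: free_module_def)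
    have "p (a \<odot>\<^bsub>?M\<^esub> m) = finsum P (\<lambda>s. a \<odot>\<^bsub>P\<^esub> (m s \<odot>\<^bsub>P\<^esub> s)) S"
      unfolding p_def smult
      by (intro P.M.finsum_cong' refl funcsetI P.smult_assoc P.smult_closed sm m a el subsetD[OF S(1)])
    also have "\<dots> = a \<odot>\<^bsub>P\<^esub> p m"
      unfolding p_def by (intro P.smult_finsum[symmetric] S(2) a funcsetI sm m)
    finally show "p (a \<odot>\<^bsub>?M\<^esub> m) = a \<odot>\<^bsub>P\<^esub> p m" .
  qed
  have p_surj: "p ` carrier ?M = carrier P"
  proof
    have "p \<in> carrier ?M \<rightarrow> carrier P" using p_hom by (simp add: module_hom_def)
    then show "p ` carrier ?M \<subseteq> carrier P" by blast
    show "carrier P \<subseteq> p ` carrier ?M"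
    proof
      fix x assume "x \<in> carrier P"
      then obtain c where c: "c \<in> S \<rightarrow> carrier R" "x = finsum P (\<lambda>s. c s \<odot>\<^bsub>P\<^esub> s) S" using gen by blast
      let ?m = "\<lambda>s. if s \<in> S then c s else \<zero>\<^bsub>R\<^esub>"
      have m: "?m \<in> carrier ?M" using c(1) by (simp add: free_module_def Pi_iff)
      have "p ?m = x"
        unfolding p_def c(2)
      proof (rule P.M.finsum_cong'[OF refl])
        show "(\<lambda>s. c s \<odot>\<^bsub>P\<^esub> s) \<in> S \<rightarrow> carrier P"
          by (intro funcsetI P.smult_closed funcset_mem[OF c(1)] subsetD[OF S(1)])
      qed simp
      then show "x \<in> p ` carrier ?M" using m by blast
    qed
  qed
  have "(\<lambda>x. x) \<in> module_hom R P P" by (simp add: module_hom_def)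
  then obtain h where h: "h \<in> module_hom R P ?M" "\<And>x. x \<in> carrier P \<Longrightarrow> p (h x) = x"
    using proj p_hom p_surj left_module_free_module[OF P.R.ring_axioms, of S] P.left_module_axioms
    unfolding projective_module_def by blast
  show thesis by (rule that[OF S(2,1) h(1)]) (use h(2) in \<open>simp add: p_def\<close>)
qed

definition rat_monomial :: "'g \<Rightarrow> rat \<Rightarrow> 'g \<Rightarrow> rat" where
  "rat_monomial g r = (\<lambda>k. if k = g then r else 0)"

lemma rat_monomial_in_carrier: "g \<in> carrier G \<Longrightarrow> rat_monomial g r \<in> carrier (rat_group_ring G)"
  by (auto simp: rat_monomial_def rat_group_ring_def)

lemma rat_monomial_mult:
  assumes "g \<in> carrier G"
  shows "rat_monomial g r \<otimes>\<^bsub>rat_group_ring G\<^esub> b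
    = (\<lambda>k. if k \<in> carrier G then r * b (inv\<^bsub>G\<^esub> g \<otimes>\<^bsub>G\<^esub> k) else 0)"
proof -
  have "{h. h \<in> carrier G \<and> rat_monomial g r h \<noteq> 0} = (if r = 0 then {} else {g})"
    using assms by (auto simp: rat_monomial_def)
  then show ?thesis by (auto simp: rat_group_ring_def rat_monomial_def fun_eq_iff)
qed

lemma lookup_translate:
  fixes G :: "('g, 'x) monoid_scheme" and x :: "('i, 'g) chain"
  assumes G: "group G" and g: "g \<in> carrier G" and x: "x \<in> free_chains G I"
  shows "coef (translate G g x) (i, k)
    = (if k \<in> carrier G then coef x (i, inv\<^bsub>G\<^esub> g \<otimes>\<^bsub>G\<^esub> k) else 0)"
proof -
  interpret group G by fact
  have *: "coef (translate G g x) (i, k) =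
    (\<Sum>\<kappa>\<in>supp x. coef x \<kappa> * (if k \<in> carrier G \<and> \<kappa> = (i, inv\<^bsub>G\<^esub> g \<otimes>\<^bsub>G\<^esub> k) then 1 else 0))"
    unfolding translate_def lin_def lookup_sum
  proof (rule sum.cong[OF refl])
    fix \<kappa> assume "\<kappa> \<in> supp x"
    then obtain j h where \<kappa>: "\<kappa> = (j, h)" "h \<in> carrier G" using x by (auto simp: free_chains_def)
    have "g \<otimes>\<^bsub>G\<^esub> h = k \<longleftrightarrow> k \<in> carrier G \<and> h = inv\<^bsub>G\<^esub> g \<otimes>\<^bsub>G\<^esub> k"
      using g \<kappa>(2) inv_solve_left[of h g k] m_closed[of g h] by metis
    then show "coef (scale_chain (coef x \<kappa>)
        (case \<kappa> of (i, h) \<Rightarrow> single (i, if h \<in> carrier G then g \<otimes>\<^bsub>G\<^esub> h else h) 1)) (i, k)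
      = coef x \<kappa> * (if k \<in> carrier G \<and> \<kappa> = (i, inv\<^bsub>G\<^esub> g \<otimes>\<^bsub>G\<^esub> k) then 1 else 0)"
      using \<kappa> by (auto simp: lookup_single when_def)
  qed
  show ?thesis
    unfolding * by (cases "k \<in> carrier G") (auto simp: if_distrib in_keys_iff cong: if_cong)
qed

text \<open>Here \<open>\<theta>\<close> assigns to an element its coordinates and \<open>\<tau>\<close> is a retraction from the free module. Linearity
  over the group ring is recorded for rational scalars and group elements only, as these generate
  it.\<close>

definition coordinates_of ::
    "('g, 'x) monoid_scheme \<Rightarrow> ('g \<Rightarrow> rat, 'm) module \<Rightarrow> 'm set \<Rightarrow> ('m \<Rightarrow> ('m, 'g) chain)
      \<Rightarrow> (('m, 'g) chain \<Rightarrow> 'm) \<Rightarrow> bool" where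
  "coordinates_of G P S \<theta> \<tau> \<longleftrightarrow> finite S \<and>
    (\<forall>x\<in>carrier P. \<theta> x \<in> free_chains G S \<and> \<tau> (\<theta> x) = x \<and>
       (\<forall>y\<in>carrier P. \<theta> (x \<oplus>\<^bsub>P\<^esub> y) = \<theta> x + \<theta> y) \<and>
       (\<forall>r. \<theta> (rat_monomial \<one>\<^bsub>G\<^esub> r \<odot>\<^bsub>P\<^esub> x) = scale_chain r (\<theta> x)) \<and>
       (\<forall>g\<in>carrier G. \<theta> (rat_monomial g 1 \<odot>\<^bsub>P\<^esub> x) = translate G g (\<theta> x))) \<and>
    (\<forall>c\<in>free_chains G S. \<tau> c \<in> carrier P \<and>
       (\<forall>c'\<in>free_chains G S. \<tau> (c + c') = \<tau> c \<oplus>\<^bsub>P\<^esub> \<tau> c') \<and>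
       (\<forall>r. \<tau> (scale_chain r c) = rat_monomial \<one>\<^bsub>G\<^esub> r \<odot>\<^bsub>P\<^esub> \<tau> c) \<and>
       (\<forall>g\<in>carrier G. \<tau> (translate G g c) = rat_monomial g 1 \<odot>\<^bsub>P\<^esub> \<tau> c))"

lemma fg_projective_in_chains:
  fixes G :: "('g, 'x) monoid_scheme" and P :: "('g \<Rightarrow> rat, 'm) module"
  assumes G: "group G"
    and proj: "projective_module (rat_group_ring G) P" and fg: "finitely_generated_module (rat_group_ring G) P"
  shows "\<exists>S \<theta> \<tau>. coordinates_of G P S \<theta> \<tau>"
proof -
  let ?R = "rat_group_ring G"
  interpret G: group G by fact
  interpret P: left_module ?R P using proj by (simp add: projective_module_def)
  obtain S h where S: "finite S" "S \<subseteq> carrier P" and h: "h \<in> module_hom ?R P (free_module ?R S)"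
    and hx: "\<forall>x\<in>carrier P. finsum P (\<lambda>s. h x s \<odot>\<^bsub>P\<^esub> s) S = x"
    by (rule projective_coordinates[OF proj fg])
  have hM: "h x \<in> carrier (free_module ?R S)" if "x \<in> carrier P" for x using h that by (auto simp: module_hom_def)
  have hR: "h x s \<in> carrier ?R" "s \<notin> S \<Longrightarrow> h x s g = 0" if "x \<in> carrier P" for x s g
  proof -
    note m = hM[OF that]
    show "h x s \<in> carrier ?R"
      using m P.R.zero_closed by (cases "s \<in> S") (simp_all add: free_module_def)
    show "s \<notin> S \<Longrightarrow> h x s g = 0"
      using m by (simp add: free_module_def rat_group_ring_def)
  qed
  have h_add: "h (x \<oplus>\<^bsub>P\<^esub> y) s = h x s \<oplus>\<^bsub>?R\<^esub> h y s" if "x \<in> carrier P" "y \<in> carrier P" for x y s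
    using h that by (simp add: module_hom_def free_module_def)
  have h_smult: "h (a \<odot>\<^bsub>P\<^esub> x) s = a \<otimes>\<^bsub>?R\<^esub> h x s" if "x \<in> carrier P" "a \<in> carrier ?R" for x a s
    using h that by (simp add: module_hom_def free_module_def)
  define \<theta> where "\<theta> x = Abs_poly_mapping (\<lambda>(s, g). h x s g)" for x
  have lookup_\<theta>: "coef (\<theta> x) (s, g) = h x s g" if x: "x \<in> carrier P" for x s g
  proof -
    have "{k. (\<lambda>(s, g). h x s g) k \<noteq> 0} \<subseteq> (\<Union>s\<in>S. Pair s ` {g. h x s g \<noteq> 0})"
    proof clarify
      fix s g assume n: "h x s g \<noteq> 0"
      then have "s \<in> S" using hR(2)[OF x, of s g] by blast
      then show "(s, g) \<in> (\<Union>s\<in>S. Pair s ` {g. h x s g \<noteq> 0})" using n by blast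
    qed
    moreover have "finite (\<Union>s\<in>S. Pair s ` {g. h x s g \<noteq> 0})"
      using S(1) hR(1)[OF x] by (auto simp: rat_group_ring_def)
    ultimately have "finite {k. (\<lambda>(s, g). h x s g) k \<noteq> 0}" by (rule finite_subset)
    then show ?thesis by (simp add: \<theta>_def)
  qed
  have supp: "h x s g = 0" if "x \<in> carrier P" "g \<notin> carrier G" for x s g
    using hR(1)[OF that(1), of s] that(2) by (auto simp: rat_group_ring_def)
  have \<theta>_in: "\<theta> x \<in> free_chains G S" if x: "x \<in> carrier P" for x
  proof -
    have "s \<in> S \<and> g \<in> carrier G" if "(s, g) \<in> supp (\<theta> x)" for s g
      using that hR(2)[OF x, of s g] supp[OF x, of g s] by (auto simp: in_keys_iff lookup_\<theta>[OF x])
    then show ?thesis by (auto simp: free_chains_def)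
  qed
  have \<theta>_add: "\<theta> (x \<oplus>\<^bsub>P\<^esub> y) = \<theta> x + \<theta> y" if "x \<in> carrier P" "y \<in> carrier P" for x y
  proof (rule poly_mapping_eqI)
    fix k :: "'m \<times> 'g"
    obtain s g where k: "k = (s, g)" by fastforce
    have "h (x \<oplus>\<^bsub>P\<^esub> y) s g = h x s g + h y s g"
      using h_add[OF that, of s] by (simp add: rat_group_ring_def)
    then show "coef (\<theta> (x \<oplus>\<^bsub>P\<^esub> y)) k = coef (\<theta> x + \<theta> y) k"
      unfolding k by (simp only: lookup_add lookup_\<theta>[OF that(1)] lookup_\<theta>[OF that(2)] lookup_\<theta>[OF P.M.a_closed[OF that]])
  qed
  have mono: "rat_monomial g r \<odot>\<^bsub>P\<^esub> x \<in> carrier P" if "g \<in> carrier G" "x \<in> carrier P" for g r x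
    by (rule P.smult_closed[OF rat_monomial_in_carrier[OF that(1)] that(2)])
  have \<theta>_mono: "coef (\<theta> (rat_monomial g r \<odot>\<^bsub>P\<^esub> x)) (s, k)
      = (if k \<in> carrier G then r * h x s (inv\<^bsub>G\<^esub> g \<otimes>\<^bsub>G\<^esub> k) else 0)" if "x \<in> carrier P" "g \<in> carrier G" for x g r s k
    using that by (simp add: lookup_\<theta> mono h_smult rat_monomial_in_carrier rat_monomial_mult)
  have \<theta>_scale: "\<theta> (rat_monomial \<one>\<^bsub>G\<^esub> r \<odot>\<^bsub>P\<^esub> x) = scale_chain r (\<theta> x)" if "x \<in> carrier P" for x r
  proof (rule poly_mapping_eqI)
    fix k :: "'m \<times> 'g"
    obtain s g where k: "k = (s, g)" by fastforce
    show "coef (\<theta> (rat_monomial \<one>\<^bsub>G\<^esub> r \<odot>\<^bsub>P\<^esub> x)) k = coef (scale_chain r (\<theta> x)) k"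
      unfolding k using that supp by (simp add: \<theta>_mono lookup_\<theta>)
  qed
  have \<theta>_tr: "\<theta> (rat_monomial g 1 \<odot>\<^bsub>P\<^esub> x) = translate G g (\<theta> x)" if "x \<in> carrier P" "g \<in> carrier G" for x g
  proof (rule poly_mapping_eqI)
    fix k :: "'m \<times> 'g"
    obtain s l where k: "k = (s, l)" by fastforce
    show "coef (\<theta> (rat_monomial g 1 \<odot>\<^bsub>P\<^esub> x)) k = coef (translate G g (\<theta> x)) k"
      unfolding k using that lookup_translate[OF G that(2) \<theta>_in[OF that(1)]] by (simp add: \<theta>_mono lookup_\<theta>)
  qed
  define row where "row c s = (\<lambda>k. coef c (s, k))" for c :: "('m, 'g) chain" and s
  define \<tau> where "\<tau> c = finsum P (\<lambda>s. row c s \<odot>\<^bsub>P\<^esub> s) S" for c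
  have row_in: "row c s \<in> carrier ?R" if c: "c \<in> free_chains G S" for c s
  proof -
    have sub: "{k. row c s k \<noteq> 0} \<subseteq> snd ` supp c"
      by (force simp: row_def in_keys_iff)
    have "finite {k. row c s k \<noteq> 0}"
      by (rule finite_subset[OF sub finite_imageI[OF finite_keys]])
    moreover have "snd ` supp c \<subseteq> carrier G"
      using c by (auto simp: free_chains_def)
    ultimately show ?thesis using sub by (simp add: rat_group_ring_def)
  qed
  have rs: "row c s \<odot>\<^bsub>P\<^esub> s \<in> carrier P" if "c \<in> free_chains G S" "s \<in> S" for c s
    by (intro P.smult_closed row_in that subsetD[OF S(2)])
  have \<tau>_in: "\<tau> c \<in> carrier P" if "c \<in> free_chains G S" for c
    unfolding \<tau>_def by (intro P.M.finsum_closed funcsetI rs that)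
  note F = submodD[OF submod_free_chains[OF G, of S]]
  have \<tau>_add: "\<tau> (c + c') = \<tau> c \<oplus>\<^bsub>P\<^esub> \<tau> c'" if c: "c \<in> free_chains G S" "c' \<in> free_chains G S" for c c'
  proof -
    have row: "row (c + c') s = row c s \<oplus>\<^bsub>?R\<^esub> row c' s" for s
      by (simp add: row_def lookup_add rat_group_ring_def)
    have "\<tau> (c + c') = finsum P (\<lambda>s. row c s \<odot>\<^bsub>P\<^esub> s \<oplus>\<^bsub>P\<^esub> row c' s \<odot>\<^bsub>P\<^esub> s) S"
      unfolding \<tau>_def row
      by (intro P.M.finsum_cong' refl funcsetI P.M.a_closed rs c P.smult_l_distr row_in subsetD[OF S(2)])
    also have "\<dots> = \<tau> c \<oplus>\<^bsub>P\<^esub> \<tau> c'"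
      unfolding \<tau>_def by (intro P.M.finsum_addf funcsetI rs c)
    finally show ?thesis .
  qed
  have \<tau>_mono: "\<tau> c' = rat_monomial g r \<odot>\<^bsub>P\<^esub> \<tau> c"
    if c: "c \<in> free_chains G S" and g: "g \<in> carrier G"
      and row: "\<And>s. row c' s = rat_monomial g r \<otimes>\<^bsub>?R\<^esub> row c s" for c c' g r
  proof -
    note m = rat_monomial_in_carrier[OF g, of r]
    have "\<tau> c' = finsum P (\<lambda>s. rat_monomial g r \<odot>\<^bsub>P\<^esub> (row c s \<odot>\<^bsub>P\<^esub> s)) S"
      unfolding \<tau>_def row
      by (intro P.M.finsum_cong' refl funcsetI P.smult_assoc P.smult_closed rs c m row_in subsetD[OF S(2)])
    also have "\<dots> = rat_monomial g r \<odot>\<^bsub>P\<^esub> \<tau> c"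
      unfolding \<tau>_def by (intro P.smult_finsum[symmetric] S(1) m funcsetI rs c)
    finally show ?thesis .
  qed
  have \<tau>_scale: "\<tau> (scale_chain r c) = rat_monomial \<one>\<^bsub>G\<^esub> r \<odot>\<^bsub>P\<^esub> \<tau> c" if c: "c \<in> free_chains G S" for c r
  proof (rule \<tau>_mono[OF c G.one_closed])
    fix s
    have "coef c (s, k) = 0" if "k \<notin> carrier G" for k
      using c that by (force simp: free_chains_def in_keys_iff)
    then show "row (scale_chain r c) s = rat_monomial \<one>\<^bsub>G\<^esub> r \<otimes>\<^bsub>?R\<^esub> row c s"
      by (auto simp: rat_monomial_mult row_def)
  qed
  have \<tau>_tr: "\<tau> (translate G g c) = rat_monomial g 1 \<odot>\<^bsub>P\<^esub> \<tau> c" if c: "c \<in> free_chains G S" and g: "g \<in> carrier G" for c g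
    by (rule \<tau>_mono[OF c g]) (auto simp: rat_monomial_mult[OF g] row_def lookup_translate[OF G g c] fun_eq_iff)
  have "\<tau> (\<theta> x) = x" if x: "x \<in> carrier P" for x
  proof -
    have "row (\<theta> x) s = h x s" for s by (simp add: row_def lookup_\<theta>[OF x])
    then show ?thesis using hx x by (simp add: \<tau>_def)
  qed
  then have "coordinates_of G P S \<theta> \<tau>"
    by (simp add: coordinates_of_def S(1) \<theta>_in \<theta>_add \<theta>_scale \<theta>_tr \<tau>_in \<tau>_add \<tau>_scale \<tau>_tr)
  then show ?thesis by blast
qed

lemma sum_rat_monomial: "(\<Sum>k | rat_monomial g r k \<noteq> 0. rat_monomial g r k) = r"
proof -
  have "{k. rat_monomial g r k \<noteq> 0} = (if r = 0 then {} else {g})" by (auto simp: rat_monomial_def)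
  then show ?thesis by (auto simp: rat_monomial_def)
qed

text \<open>A projective resolution of finite type is transported along coordinates; the retract \<open>E\<close> is \<open>\<theta>\<tau>\<close>.\<close>

lemma finite_resolution_exists:
  fixes G :: "('g, 'x) monoid_scheme"
  assumes G: "group G" and FP: "type_FP_infinity_rat TYPE('m) G"
  obtains I X E D \<epsilon> where "resolution G (I :: nat \<Rightarrow> 'm set) X E D \<epsilon>" "\<And>n. finite (I n)"
proof -
  let ?R = "rat_group_ring G"
  interpret G: group G by fact
  obtain P :: "nat \<Rightarrow> ('g \<Rightarrow> rat, 'm) module" and d e where
    res: "projective_resolution ?R trivial_rat_module P d e" and fg: "\<And>n. finitely_generated_module ?R (P n)"
    using FP unfolding type_FP_infinity_rat_def by blast
  have proj: "projective_module ?R (P n)" for n using res by (simp add: projective_resolution_def)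
  have d: "d n \<in> module_hom ?R (P (Suc n)) (P n)" for n using res by (simp add: projective_resolution_def)
  have e: "e \<in> module_hom ?R (P 0) trivial_rat_module" using res by (simp add: projective_resolution_def)
  have e_surj: "e ` carrier (P 0) = UNIV" using res by (simp add: projective_resolution_def trivial_rat_module_def)
  have ex0: "d 0 ` carrier (P 1) = {x \<in> carrier (P 0). e x = 0}"
    using res by (simp add: projective_resolution_def trivial_rat_module_def)
  have exS: "d (Suc n) ` carrier (P (Suc (Suc n))) = {x \<in> carrier (P (Suc n)). d n x = \<zero>\<^bsub>P n\<^esub>}" for n
    using res by (simp add: projective_resolution_def)
  interpret P: left_module ?R "P n" for n using proj by (simp add: projective_module_def)
  have "\<exists>t. \<forall>n. coordinates_of G (P n) (fst (t n)) (fst (snd (t n))) (snd (snd (t n)))"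
  proof (rule choice, rule allI)
    fix n
    show "\<exists>t. coordinates_of G (P n) (fst t) (fst (snd t)) (snd (snd t))"
      using fg_projective_in_chains[OF G proj fg, of n] by force
  qed
  then obtain t where t: "\<And>n. coordinates_of G (P n) (fst (t n)) (fst (snd (t n))) (snd (snd (t n)))" by blast
  define S where "S n = fst (t n)" for n
  define \<theta> where "\<theta> n = fst (snd (t n))" for n
  define \<tau> where "\<tau> n = snd (snd (t n))" for n
  have co: "coordinates_of G (P n) (S n) (\<theta> n) (\<tau> n)" for n
    using t by (simp add: S_def \<theta>_def \<tau>_def)
  have S: "finite (S n)" for n using co by (simp add: coordinates_of_def)
  have \<theta>: "\<And>n x. x \<in> carrier (P n) \<Longrightarrow> \<theta> n x \<in> free_chains G (S n)" "\<And>n x. x \<in> carrier (P n) \<Longrightarrow> \<tau> n (\<theta> n x) = x"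
      "\<And>n x y. x \<in> carrier (P n) \<Longrightarrow> y \<in> carrier (P n) \<Longrightarrow> \<theta> n (x \<oplus>\<^bsub>P n\<^esub> y) = \<theta> n x + \<theta> n y"
      "\<And>n x r. x \<in> carrier (P n) \<Longrightarrow> \<theta> n (rat_monomial \<one>\<^bsub>G\<^esub> r \<odot>\<^bsub>P n\<^esub> x) = scale_chain r (\<theta> n x)"
      "\<And>n x g. x \<in> carrier (P n) \<Longrightarrow> g \<in> carrier G \<Longrightarrow> \<theta> n (rat_monomial g 1 \<odot>\<^bsub>P n\<^esub> x) = translate G g (\<theta> n x)"
    using co[unfolded coordinates_of_def] by auto
  have \<tau>: "\<And>n c. c \<in> free_chains G (S n) \<Longrightarrow> \<tau> n c \<in> carrier (P n)"
      "\<And>n c c'. c \<in> free_chains G (S n) \<Longrightarrow> c' \<in> free_chains G (S n) \<Longrightarrow> \<tau> n (c + c') = \<tau> n c \<oplus>\<^bsub>P n\<^esub> \<tau> n c'"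
      "\<And>n c r. c \<in> free_chains G (S n) \<Longrightarrow> \<tau> n (scale_chain r c) = rat_monomial \<one>\<^bsub>G\<^esub> r \<odot>\<^bsub>P n\<^esub> \<tau> n c"
      "\<And>n c g. c \<in> free_chains G (S n) \<Longrightarrow> g \<in> carrier G \<Longrightarrow> \<tau> n (translate G g c) = rat_monomial g 1 \<odot>\<^bsub>P n\<^esub> \<tau> n c"
    using co[unfolded coordinates_of_def] by auto
  have dD: "d n x \<in> carrier (P n)" "y \<in> carrier (P (Suc n)) \<Longrightarrow> d n (x \<oplus>\<^bsub>P (Suc n)\<^esub> y) = d n x \<oplus>\<^bsub>P n\<^esub> d n y"
      "a \<in> carrier ?R \<Longrightarrow> d n (a \<odot>\<^bsub>P (Suc n)\<^esub> x) = a \<odot>\<^bsub>P n\<^esub> d n x"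
    if "x \<in> carrier (P (Suc n))" for n x y a
    using d[of n] that by (auto simp: module_hom_def)
  have eD: "y \<in> carrier (P 0) \<Longrightarrow> e (x \<oplus>\<^bsub>P 0\<^esub> y) = e x + e y"
      "g \<in> carrier G \<Longrightarrow> e (rat_monomial g r \<odot>\<^bsub>P 0\<^esub> x) = r * e x"
    if "x \<in> carrier (P 0)" for x y r g
    using e that rat_monomial_in_carrier[of g G r]
    by (auto simp: module_hom_def trivial_rat_module_def sum_rat_monomial)
  have \<theta>0: "\<theta> n \<zero>\<^bsub>P n\<^esub> = 0" for n
    using \<theta>(3)[of "\<zero>\<^bsub>P n\<^esub>" n "\<zero>\<^bsub>P n\<^esub>"] by simp
  have mono: "rat_monomial g r \<in> carrier ?R" if "g \<in> carrier G" for g r by (rule rat_monomial_in_carrier[OF that])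
  have mP: "rat_monomial g r \<odot>\<^bsub>P n\<^esub> x \<in> carrier (P n)" if "g \<in> carrier G" "x \<in> carrier (P n)" for g r n x
    by (rule P.smult_closed[OF mono[OF that(1)] that(2)])
  define I where "I n = (case n of 0 \<Rightarrow> {} | Suc m \<Rightarrow> S m)" for n
  define X where "X n = (case n of 0 \<Rightarrow> {0} | Suc m \<Rightarrow> \<theta> m ` carrier (P m))" for n
  define E where "E n = (case n of 0 \<Rightarrow> (\<lambda>_. 0) | Suc m \<Rightarrow> (\<lambda>c. \<theta> m (\<tau> m c)))" for n
  define D where "D n = (case n of 0 \<Rightarrow> (\<lambda>_. 0) | Suc m \<Rightarrow> (\<lambda>c. \<theta> m (d m (\<tau> (Suc m) c))))" for n
  have tr0: "translate G g 0 = (0 :: ('m, 'g) chain)" if "g \<in> carrier G" for g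
    using translate_simps(1)[OF G that, of "0 :: ('m, 'g) chain" 0] by simp
  have XF: "X n \<subseteq> free_chains G (I n)" for n
    using \<theta>(1) by (cases n) (auto simp: X_def I_def free_chains_def)
  have Xsub: "submod G (X n)" for n
  proof (cases n)
    case 0 then show ?thesis by (auto simp: submod_def X_def tr0)
  next
    case (Suc m)
    show ?thesis
      unfolding submod_def Suc X_def
    proof (simp, intro conjI ballI allI)
      show "0 \<in> \<theta> m ` carrier (P m)" using \<theta>0[of m] by (metis P.zero_closed imageI)
    next
      fix x y assume "x \<in> carrier (P m)" "y \<in> carrier (P m)"
      then show "\<theta> m x + \<theta> m y \<in> \<theta> m ` carrier (P m)" by (metis \<theta>(3) P.a_closed imageI)
    next
      fix r x assume "x \<in> carrier (P m)"
      then show "scale_chain r (\<theta> m x) \<in> \<theta> m ` carrier (P m)" by (metis \<theta>(4) mP G.one_closed imageI)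
    next
      fix g x assume "g \<in> carrier G" "x \<in> carrier (P m)"
      then show "translate G g (\<theta> m x) \<in> \<theta> m ` carrier (P m)" by (metis \<theta>(5) mP imageI)
    qed
  qed
  have "resolution G I X E D (\<lambda>c. e (\<tau> 0 c))"
  proof
    fix n
    show "chain_hom G (free_chains G (I n)) (X n) (E n)"
    proof (cases n)
      case 0 then show ?thesis by (auto simp: chain_hom_def equivariant_on_def E_def X_def tr0)
    next
      case (Suc m) then show ?thesis
        by (auto simp: chain_hom_def equivariant_on_def E_def X_def I_def \<tau> \<theta>)
    qed
    show "chain_hom G (X (Suc n)) (X n) (D n)"
    proof (cases n)
      case 0 then show ?thesis by (auto simp: chain_hom_def equivariant_on_def D_def X_def tr0)
    next
      case (Suc m)
      then show ?thesis
        using \<theta>(1)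
        by (auto simp: chain_hom_def equivariant_on_def D_def X_def I_def \<tau> \<theta> dD mono)
    qed
    show "x \<in> X n \<Longrightarrow> E n x = x" for x
      by (cases n) (auto simp: X_def E_def \<theta>(2))
    show "D n (D (Suc n) x) = 0" if x: "x \<in> X (Suc (Suc n))" for x
    proof (cases n)
      case 0 then show ?thesis by (simp add: D_def)
    next
      case (Suc m)
      then obtain p where p: "x = \<theta> (Suc n) p" "p \<in> carrier (P (Suc n))" using x by (auto simp: X_def)
      have "d n p \<in> d (Suc m) ` carrier (P (Suc (Suc m)))" using p Suc by simp
      then have "d m (d n p) = \<zero>\<^bsub>P m\<^esub>" using exS[of m] by simp
      then show ?thesis using p Suc by (simp add: D_def \<theta>(2) dD(1) \<theta>0)
    qed
    show "\<exists>y\<in>X (Suc (Suc n)). D (Suc n) y = x"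
      if x: "x \<in> X (Suc n)" "D n x = 0" "n = 0 \<Longrightarrow> e (\<tau> 0 x) = 0" for x
    proof -
      obtain p where p: "x = \<theta> n p" "p \<in> carrier (P n)" using x(1) by (auto simp: X_def)
      have "p \<in> d n ` carrier (P (Suc n))"
      proof (cases n)
        case 0
        then show ?thesis using x(3) p \<theta>(2)[OF p(2)] ex0 by simp
      next
        case (Suc m)
        have p': "p \<in> carrier (P (Suc m))" using p Suc by simp
        have "\<theta> m (d m p) = \<theta> m \<zero>\<^bsub>P m\<^esub>" using x(2) p Suc by (simp add: D_def \<theta>(2) \<theta>0)
        then have "d m p = \<zero>\<^bsub>P m\<^esub>" using \<theta>(2)[OF dD(1)[OF p']] \<theta>(2)[OF P.zero_closed] by metis
        then show ?thesis using p' exS[of m] Suc by simp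
      qed
      then obtain y where y: "y \<in> carrier (P (Suc n))" "p = d n y" by blast
      have "D (Suc n) (\<theta> (Suc n) y) = x" using y p by (simp add: D_def \<theta>(2))
      then show ?thesis using y by (intro bexI[of _ "\<theta> (Suc n) y"]) (auto simp: X_def)
    qed
  next
    show "equivariant_on G (X 1) (*) (\<lambda>_ r. r) (\<lambda>c. e (\<tau> 0 c))"
      using \<theta>(1) by (auto simp: equivariant_on_def X_def \<tau> \<theta>(2) eD)
    show "X 0 = {0}" by (simp add: X_def)
    show "e (\<tau> 0 (D 1 x)) = 0" if "x \<in> X 2" for x
    proof -
      have "x \<in> \<theta> 1 ` carrier (P 1)" using that by (simp add: X_def numeral_2_eq_2)
      then obtain p where p: "x = \<theta> 1 p" "p \<in> carrier (P 1)" by blast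
      then have "e (d 0 p) = 0" using ex0 by auto
      then show ?thesis using p by (simp add: D_def \<theta>(2) dD(1))
    qed
    obtain p where "p \<in> carrier (P 0)" "e p = 1" using e_surj by (metis UNIV_I imageE)
    then show "\<exists>x\<in>X 1. e (\<tau> 0 x) = 1" by (intro bexI[of _ "\<theta> 0 p"]) (auto simp: X_def \<theta>(2))
  qed (use XF Xsub in auto)
  moreover have "finite (I n)" for n using S by (cases n) (auto simp: I_def)
  ultimately show thesis using that by blast
qed

section \<open>An open mapping theorem for seminorms\<close>

text \<open>
  The power of a space \<open>V\<close> with a finite index set \<open>J\<close> is represented by all functions into \<open>V\<close> with a
  seminorm that sees only the values on \<open>J\<close>. So the index set remains a term, and all the powers of
  \<open>V\<close> over subsets of one type share a vector space.\<close>

instantiation "fun" :: (type, real_vector) real_vector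
begin

definition scaleR_fun :: "real \<Rightarrow> ('a \<Rightarrow> 'b) \<Rightarrow> 'a \<Rightarrow> 'b" where
  "scaleR_fun r f = (\<lambda>x. r *\<^sub>R f x)"

instance
  by standard (simp_all add: scaleR_fun_def fun_eq_iff scaleR_add_right scaleR_add_left)

end

lemma scaleR_fun_apply [simp]: "(r *\<^sub>R f) x = r *\<^sub>R f x"
  by (simp add: scaleR_fun_def)

definition seminorm :: "('a::real_vector \<Rightarrow> real) \<Rightarrow> bool" where
  "seminorm p \<longleftrightarrow> (\<forall>x y. p (x + y) \<le> p x + p y) \<and> (\<forall>r x. p (r *\<^sub>R x) = \<bar>r\<bar> * p x)"

definition series_complete :: "('a::real_vector \<Rightarrow> real) \<Rightarrow> bool" where
  "series_complete p \<longleftrightarrow>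
     (\<forall>x. summable (\<lambda>n. p (x n)) \<longrightarrow> (\<exists>s. (\<lambda>n. p (s - (\<Sum>k<n. x k))) \<longlonglongrightarrow> 0))"

lemma
  assumes "seminorm p"
  shows seminorm_triangle: "p (x + y) \<le> p x + p y"
    and seminorm_scale: "p (r *\<^sub>R x) = \<bar>r\<bar> * p x"
    and seminorm_zero: "p 0 = 0"
    and seminorm_minus: "p (x - y) = p (y - x)"
    and seminorm_triangle_diff: "p (x - z) \<le> p (x - y) + p (y - z)"
    and seminorm_nonneg: "p x \<ge> 0"
    and seminorm_diff: "p (x - y) \<le> p x + p y"
proof -
  have t: "p (x + y) \<le> p x + p y" for x y using assms by (simp add: seminorm_def)
  have s: "p (r *\<^sub>R x) = \<bar>r\<bar> * p x" for r x using assms by (simp add: seminorm_def)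
  show "p (x + y) \<le> p x + p y" "p (r *\<^sub>R x) = \<bar>r\<bar> * p x" by (fact t s)+
  show z: "p 0 = 0" using s[of 0 0] by simp
  have m: "p (- x) = p x" for x using s[of "-1" x] by simp
  show "p (x - y) = p (y - x)" using m[of "x - y"] by simp
  show "p (x - z) \<le> p (x - y) + p (y - z)" using t[of "x - y" "y - z"] by simp
  show "p x \<ge> 0" using t[of x "- x"] z m[of x] by simp
  show "p (x - y) \<le> p x + p y" using t[of x "- y"] m[of y] by simp
qed

lemma seminorm_sum: "seminorm p \<Longrightarrow> p (sum f A) \<le> (\<Sum>a\<in>A. p (f a))"
proof (induction A rule: infinite_finite_induct)
  case (insert a A)
  then show ?case using seminorm_triangle[of p "f a" "sum f A"] by simp
qed (simp_all add: seminorm_zero)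

text \<open>Baire's argument: if the conclusion fails for every \<open>n\<close>, there are nested balls centred in the range, the
  \<open>n\<close>-th keeping a positive distance from the image of the ball of radius \<open>n\<close>. As the range is
  closed, their common limit is, up to distance zero, the image of some \<open>z\<close>, which is absurd as soon as \<open>n\<close> exceeds \<open>p z\<close>.\<close>

lemma range_ball_almost_covered:
  fixes f :: "'a::real_vector \<Rightarrow> 'b::real_vector"
  assumes p: "seminorm p" and q: "seminorm q" "series_complete q" and f: "linear f"
    and closed: "\<And>y. (\<And>e. e > 0 \<Longrightarrow> \<exists>x. q (y - f x) < e) \<Longrightarrow> \<exists>x. q (y - f x) = 0"
  shows "\<exists>(n::nat) x0 r. r > 0 \<and> (\<forall>x. q (f x - f x0) < r \<longrightarrow> (\<forall>e>0. \<exists>u. p u \<le> n \<and> q (f x - f u) < e))"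
proof (rule ccontr)
  assume contra: "\<not> ?thesis"
  have step: "\<exists>x' r'. q (f x' - f x) < r / 2 \<and> 0 < r' \<and> r' \<le> r / 2 \<and> (\<forall>u. p u \<le> real n \<longrightarrow> q (f x' - f u) \<ge> 2 * r')"
    if r: "r > 0" for x r and n :: nat
  proof -
    have "r / 2 > 0" using r by simp
    then obtain x' e where x': "q (f x' - f x) < r / 2" "e > 0" "\<And>u. p u \<le> real n \<Longrightarrow> \<not> q (f x' - f u) < e"
      using contra by blast
    have "2 * min (r / 2) (e / 2) \<le> q (f x' - f u)" if "p u \<le> real n" for u
      using x'(3)[OF that] by linarith
    then show ?thesis using x' r by (intro exI[of _ x'] exI[of _ "min (r / 2) (e / 2)"]) auto
  qed
  have "\<exists>t. \<forall>n. snd (t n) > 0 \<and> (q (f (fst (t (Suc n))) - f (fst (t n))) < snd (t n) / 2 \<and>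
      snd (t (Suc n)) \<le> snd (t n) / 2 \<and> (\<forall>u. p u \<le> real n \<longrightarrow> q (f (fst (t (Suc n))) - f u) \<ge> 2 * snd (t (Suc n))))"
  proof (rule dependent_nat_choice)
    show "\<exists>t :: 'a \<times> real. snd t > 0" by (intro exI[of _ "(0, 1)"]) simp
    fix t :: "'a \<times> real" and n :: nat
    assume "snd t > 0"
    from step[OF this, of "fst t" n] obtain x' r' where
      "q (f x' - f (fst t)) < snd t / 2" "0 < r'" "r' \<le> snd t / 2" "\<forall>u. p u \<le> real n \<longrightarrow> q (f x' - f u) \<ge> 2 * r'" by blast
    then show "\<exists>t'. snd t' > 0 \<and> q (f (fst t') - f (fst t)) < snd t / 2 \<and> snd t' \<le> snd t / 2 \<and>
        (\<forall>u. p u \<le> real n \<longrightarrow> q (f (fst t') - f u) \<ge> 2 * snd t')"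
      by (intro exI[of _ "(x', r')"]) simp
  qed
  then obtain t where t: "\<And>n. snd (t n) > 0" "\<And>n. q (f (fst (t (Suc n))) - f (fst (t n))) < snd (t n) / 2"
    "\<And>n. snd (t (Suc n)) \<le> snd (t n) / 2"
    "\<And>n u. p u \<le> real n \<Longrightarrow> q (f (fst (t (Suc n))) - f u) \<ge> 2 * snd (t (Suc n))" by blast
  define x where "x n = fst (t n)" for n
  define r where "r n = snd (t n)" for n
  have r: "r n > 0" "r (Suc n) \<le> r n / 2" for n using t by (simp_all add: r_def)
  have x: "q (f (x (Suc n)) - f (x n)) < r n / 2" for n using t by (simp add: x_def r_def)
  have avoid: "p u \<le> real n \<Longrightarrow> q (f (x (Suc n)) - f u) \<ge> 2 * r (Suc n)" for n u using t by (simp add: x_def r_def)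
  have r_le: "r n \<le> r 0 * (1 / 2) ^ n" for n
  proof (induction n)
    case (Suc n) then show ?case using r(2)[of n] by simp
  qed simp
  have "summable (\<lambda>n. r 0 * (1 / 2) ^ n)" by (intro summable_mult summable_geometric) simp
  then have "summable (\<lambda>n. q (f (x (Suc n)) - f (x n)))"
  proof (rule summable_comparison_test[rotated], intro exI allI impI)
    fix n show "norm (q (f (x (Suc n)) - f (x n))) \<le> r 0 * (1 / 2) ^ n"
      using x[of n] r_le[of n] r(1)[of n] seminorm_nonneg[OF q(1)] by simp
  qed
  then obtain s where s: "(\<lambda>n. q (s - (\<Sum>k<n. f (x (Suc k)) - f (x k)))) \<longlonglongrightarrow> 0"
    using q(2)[unfolded series_complete_def, rule_format, of "\<lambda>n. f (x (Suc n)) - f (x n)"] by blast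
  have tele: "s - (\<Sum>k<n. f (x (Suc k)) - f (x k)) = s + f (x 0) - f (x n)" for n
    using sum_lessThan_telescope[of "\<lambda>k. f (x k)" n] by (simp add: algebra_simps)
  have lim: "(\<lambda>n. q (s + f (x 0) - f (x n))) \<longlonglongrightarrow> 0" using s by (simp add: tele)
  have "\<exists>z. q (s + f (x 0) - f z) < e" if "e > 0" for e
    using order_tendstoD(2)[OF lim that] by (auto simp: eventually_sequentially)
  then obtain z where z: "q (s + f (x 0) - f z) = 0" using closed by blast
  have lim': "(\<lambda>n. q (f z - f (x n))) \<longlonglongrightarrow> 0"
  proof (rule tendsto_sandwich[OF _ _ tendsto_const lim])
    show "\<forall>\<^sub>F n in sequentially. 0 \<le> q (f z - f (x n))" using seminorm_nonneg[OF q(1)] by simp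
    have "q (f z - f (x n)) \<le> q (s + f (x 0) - f (x n))" for n
      using seminorm_triangle_diff[OF q(1), of "f z" "f (x n)" "s + f (x 0)"] z
        seminorm_minus[OF q(1), of "f z" "s + f (x 0)"] by simp
    then show "\<forall>\<^sub>F n in sequentially. q (f z - f (x n)) \<le> q (s + f (x 0) - f (x n))" by simp
  qed
  obtain n :: nat where n: "p z \<le> real n" using real_arch_simple by blast
  have close: "q (f (x (Suc n + m)) - f (x (Suc n))) \<le> r (Suc n) - r (Suc n + m)" for m
  proof (induction m)
    case 0 then show ?case by (simp add: seminorm_zero[OF q(1)])
  next
    case (Suc m)
    have "q (f (x (Suc n + Suc m)) - f (x (Suc n))) \<le> r (Suc n + m) / 2 + (r (Suc n) - r (Suc n + m))"
      using seminorm_triangle_diff[OF q(1), of "f (x (Suc n + Suc m))" "f (x (Suc n))" "f (x (Suc n + m))"]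
        Suc x[of "Suc n + m"] by simp
    then show ?case using r(2)[of "Suc n + m"] by simp
  qed
  from order_tendstoD(2)[OF lim' r(1)[of "Suc n"]] obtain N where N: "\<And>k. k \<ge> N \<Longrightarrow> q (f z - f (x k)) < r (Suc n)"
    by (auto simp: eventually_sequentially)
  have "q (f (x (Suc n + N)) - f z) < r (Suc n)"
    using N[of "Suc n + N"] seminorm_minus[OF q(1)] by simp
  moreover have "q (f (x (Suc n)) - f (x (Suc n + N))) \<le> r (Suc n)"
    using close[of N] r(1)[of "Suc n + N"] seminorm_minus[OF q(1), of "f (x (Suc n))"] by simp
  ultimately have "q (f (x (Suc n)) - f z) < 2 * r (Suc n)"
    using seminorm_triangle_diff[OF q(1), of "f (x (Suc n))" "f z" "f (x (Suc n + N))"] by simp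
  then show False using avoid[OF n] by simp
qed

text \<open>By the preceding lemma, translated to the origin and rescaled, every value \<open>f x\<close> is approximated up to half of
  its size by the image of a vector of controlled size. Iterating this gives a convergent series of
  corrections whose sum has image \<open>f x\<close>.\<close>

lemma open_mapping_seminorm:
  fixes f :: "'a::real_vector \<Rightarrow> 'b::real_vector"
  assumes p: "seminorm p" "series_complete p" and q: "seminorm q" "series_complete q" and f: "linear f"
    and bound: "\<And>x. q (f x) \<le> C * p x"
    and closed: "\<And>y. (\<And>e. e > 0 \<Longrightarrow> \<exists>x. q (y - f x) < e) \<Longrightarrow> \<exists>x. q (y - f x) = 0"
  shows "\<exists>K>0. \<forall>x. \<exists>u. q (f x - f u) = 0 \<and> p u \<le> K * q (f x)"
proof -
  have "\<exists>(n::nat) x0 r. r > 0 \<and> (\<forall>x. q (f x - f x0) < r \<longrightarrow> (\<forall>e>0. \<exists>u. p u \<le> n \<and> q (f x - f u) < e))"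
    by (rule range_ball_almost_covered[OF p(1) q f closed])
  then obtain n :: nat and x0 r where r: "r > 0"
    and cover': "\<forall>x. q (f x - f x0) < r \<longrightarrow> (\<forall>e>0. \<exists>u. p u \<le> n \<and> q (f x - f u) < e)"
    by blast
  have cover: "\<exists>u. p u \<le> n \<and> q (f x - f u) < e" if "q (f x - f x0) < r" "e > 0" for x e
    using cover' that by blast
  define K where "K = 4 * real n / r"
  have K: "K \<ge> 0" using r by (simp add: K_def)
  have half: "\<exists>u. p u \<le> K * q (f x) \<and> q (f x - f u) \<le> q (f x) / 2" for x
  proof (cases "q (f x) = 0")
    case True
    then show ?thesis using seminorm_zero[OF p(1)] linear_0[OF f] by (intro exI[of _ 0]) simp
  next
    case False
    then have pos: "q (f x) > 0" using seminorm_nonneg[OF q(1), of "f x"] by simp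
    \<comment> \<open>scaled so that \<open>x0 + t x\<close> stays in the ball around \<open>x0\<close> that is almost covered\<close>
    define t where "t = r / (2 * q (f x))"
    have t: "t > 0" "t * q (f x) = r / 2" using r pos by (simp_all add: t_def)
    have e: "r / 8 > 0" using r by simp
    have "q (f (x0 + t *\<^sub>R x) - f x0) < r"
      using t r by (simp add: linear_add[OF f] linear_scale[OF f] seminorm_scale[OF q(1)])
    then obtain u1 where u1: "p u1 \<le> n" "q (f (x0 + t *\<^sub>R x) - f u1) < r / 8" using cover[OF _ e] by blast
    have "q (f x0 - f x0) < r" using r by (simp add: seminorm_zero[OF q(1)])
    then obtain u2 where u2: "p u2 \<le> n" "q (f x0 - f u2) < r / 8" using cover[OF _ e] by blast
    define u where "u = (1 / t) *\<^sub>R (u1 - u2)"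
    have "f x - f u = (1 / t) *\<^sub>R ((f (x0 + t *\<^sub>R x) - f u1) - (f x0 - f u2))"
      using t(1) by (simp add: u_def linear_add[OF f] linear_scale[OF f] linear_diff[OF f] algebra_simps)
    then have "q (f x - f u) = (1 / t) * q ((f (x0 + t *\<^sub>R x) - f u1) - (f x0 - f u2))"
      using t(1) by (simp add: seminorm_scale[OF q(1)])
    also have "\<dots> \<le> (1 / t) * (r / 4)"
      using u1(2) u2(2) seminorm_diff[OF q(1), of "f (x0 + t *\<^sub>R x) - f u1" "f x0 - f u2"] t(1)
      by (intro mult_left_mono) auto
    also have "\<dots> = q (f x) / 2" using r pos by (simp add: t_def)
    finally have 1: "q (f x - f u) \<le> q (f x) / 2" .
    have "p u = (1 / t) * p (u1 - u2)" using t(1) by (simp add: u_def seminorm_scale[OF p(1)])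
    also have "\<dots> \<le> (1 / t) * (2 * n)"
      using u1(1) u2(1) seminorm_diff[OF p(1), of u1 u2] t(1) by (intro mult_left_mono) auto
    also have "\<dots> = K * q (f x)" using r pos by (simp add: t_def K_def)
    finally show ?thesis using 1 by blast
  qed
  then have "\<exists>U. \<forall>x. p (U x) \<le> K * q (f x) \<and> q (f x - f (U x)) \<le> q (f x) / 2"
    by (intro choice allI)
  then obtain U where U: "\<And>x. p (U x) \<le> K * q (f x)" "\<And>x. q (f x - f (U x)) \<le> q (f x) / 2" by blast
  have "\<exists>u. q (f x - f u) = 0 \<and> p u \<le> (2 * K + 1) * q (f x)" for x
  proof -
    define y where "y n = ((\<lambda>z. z - U z) ^^ n) x" for n
    have y0: "y 0 = x" and yS: "y (Suc n) = y n - U (y n)" for n by (simp_all add: y_def)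
    have qy: "q (f (y n)) \<le> q (f x) * (1 / 2) ^ n" for n
    proof (induction n)
      case (Suc n)
      then show ?case using U(2)[of "y n"] by (simp add: yS linear_diff[OF f])
    qed (simp add: y0)
    have pU: "p (U (y n)) \<le> K * q (f x) * (1 / 2) ^ n" for n
      using U(1)[of "y n"] mult_left_mono[OF qy[of n] K] by (simp add: mult.assoc)
    have sm: "summable (\<lambda>n. K * q (f x) * (1 / 2) ^ n)" by (intro summable_mult summable_geometric) simp
    have smU: "summable (\<lambda>n. p (U (y n)))"
      by (rule summable_comparison_test[OF _ sm]) (use pU seminorm_nonneg[OF p(1)] in auto)
    then obtain s where s: "(\<lambda>n. p (s - (\<Sum>k<n. U (y k)))) \<longlonglongrightarrow> 0"
      using p(2)[unfolded series_complete_def, rule_format, of "\<lambda>n. U (y n)"] by blast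
    have part: "f (\<Sum>k<n. U (y k)) = f x - f (y n)" for n
      by (induction n) (simp_all add: y0 yS linear_0[OF f] linear_add[OF f] linear_diff[OF f])
    have "q (f x - f s) \<le> 0"
    proof (rule tendsto_lowerbound)
      have "(\<lambda>n. q (f x) * (1 / 2) ^ n + C * p (s - (\<Sum>k<n. U (y k)))) \<longlonglongrightarrow> q (f x) * 0 + C * 0"
        by (intro tendsto_intros s LIMSEQ_realpow_zero) auto
      then show "(\<lambda>n. q (f x) * (1 / 2) ^ n + C * p (s - (\<Sum>k<n. U (y k)))) \<longlonglongrightarrow> 0" by simp
      have "q (f x - f s) \<le> q (f x) * (1 / 2) ^ n + C * p (s - (\<Sum>k<n. U (y k)))" for n
      proof -
        have eq: "f x - f s = f (y n) - f (s - (\<Sum>k<n. U (y k)))"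
          by (simp add: linear_diff[OF f] part)
        show ?thesis unfolding eq
          using seminorm_diff[OF q(1), of "f (y n)" "f (s - (\<Sum>k<n. U (y k)))"] qy[of n]
            bound[of "s - (\<Sum>k<n. U (y k))"] by linarith
      qed
      then show "\<forall>\<^sub>F n in sequentially. q (f x - f s) \<le> q (f x) * (1 / 2) ^ n + C * p (s - (\<Sum>k<n. U (y k)))" by simp
    qed simp
    then have 1: "q (f x - f s) = 0" using seminorm_nonneg[OF q(1), of "f x - f s"] by simp
    have "p s \<le> 2 * K * q (f x)"
    proof (rule tendsto_lowerbound)
      have "(\<lambda>n. p (s - (\<Sum>k<n. U (y k))) + 2 * K * q (f x)) \<longlonglongrightarrow> 0 + 2 * K * q (f x)"
        by (intro tendsto_intros s)
      then show "(\<lambda>n. p (s - (\<Sum>k<n. U (y k))) + 2 * K * q (f x)) \<longlonglongrightarrow> 2 * K * q (f x)" by simp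
      have "p s \<le> p (s - (\<Sum>k<n. U (y k))) + 2 * K * q (f x)" for n
      proof -
        have "(\<Sum>k<n. p (U (y k))) \<le> (\<Sum>k<n. K * q (f x) * (1 / 2) ^ k)" by (intro sum_mono pU)
        also have "\<dots> \<le> suminf (\<lambda>k. K * q (f x) * (1 / 2) ^ k)"
          by (intro sum_le_suminf sm) (use K seminorm_nonneg[OF q(1)] in auto)
        also have "\<dots> = 2 * K * q (f x)"
          by (subst suminf_mult) (simp_all add: suminf_geometric summable_geometric)
        finally have "p (\<Sum>k<n. U (y k)) \<le> 2 * K * q (f x)"
          using seminorm_sum[OF p(1), of "\<lambda>k. U (y k)" "{..<n}"] by simp
        then show ?thesis using seminorm_triangle[OF p(1), of "s - (\<Sum>k<n. U (y k))" "\<Sum>k<n. U (y k)"] by simp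
      qed
      then show "\<forall>\<^sub>F n in sequentially. p s \<le> p (s - (\<Sum>k<n. U (y k))) + 2 * K * q (f x)" by simp
    qed simp
    then show ?thesis using 1 seminorm_nonneg[OF q(1), of "f x"] by (intro exI[of _ s]) (simp add: algebra_simps)
  qed
  then show ?thesis using K by (intro exI[of _ "2 * K + 1"]) auto
qed

section \<open>Finite powers of a Hilbert space\<close>

text \<open>Only the underlying real Hilbert space matters, because the matrices have rational coefficients.\<close>

abbreviation rip :: "'v::complex_hilbert_space \<Rightarrow> 'v \<Rightarrow> real" where
  "rip x y \<equiv> Re (cinner x y)"

lemma rip_add_left: "rip (x + y) z = rip x z + rip y z"
  by (simp add: cinner_add_left)

lemma rip_commute: "rip x y = rip y x"
  by (subst cinner_commute) simp

lemma rip_scaleR_left: "rip (r *\<^sub>R x) y = r * rip x y"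
  by (simp add: scaleC_of_real[symmetric] cinner_scaleC_left)

lemma rip_self: "rip x x = (norm x)\<^sup>2"
  by (simp add: cinner_norm)

lemma rip_Cauchy_Schwarz: "\<bar>rip x y\<bar> \<le> norm x * norm y"
proof -
  have le: "rip x y \<le> norm x * norm y" for x y :: 'a
  proof -
    have "(norm (x + y))\<^sup>2 \<le> (norm x + norm y)\<^sup>2"
      by (intro power_mono norm_triangle_ineq) simp
    moreover have "(norm (x + y))\<^sup>2 = (norm x)\<^sup>2 + 2 * rip x y + (norm y)\<^sup>2"
    proof -
      have "(norm (x + y))\<^sup>2 = rip x (x + y) + rip y (x + y)"
        by (simp only: rip_self[symmetric] rip_add_left)
      also have "\<dots> = rip (x + y) x + rip (x + y) y"
        by (simp only: rip_commute[of x "x + y"] rip_commute[of y "x + y"])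
      also have "\<dots> = (norm x)\<^sup>2 + 2 * rip x y + (norm y)\<^sup>2"
        unfolding rip_add_left rip_self rip_commute[of y x] by simp
      finally show ?thesis .
    qed
    ultimately show ?thesis by (simp add: power2_sum)
  qed
  have "rip (- x) y = - rip x y" using rip_scaleR_left[of "-1" x y] by simp
  then show ?thesis using le[of x y] le[of "- x" y] by (simp add: abs_le_iff)
qed

definition l2norm :: "'i set \<Rightarrow> ('i \<Rightarrow> 'v::real_normed_vector) \<Rightarrow> real" where
  "l2norm J u = L2_set (\<lambda>j. norm (u j)) J"

definition l2inner :: "'i set \<Rightarrow> ('i \<Rightarrow> 'v::complex_hilbert_space) \<Rightarrow> ('i \<Rightarrow> 'v) \<Rightarrow> real" where
  "l2inner J u v = (\<Sum>j\<in>J. rip (u j) (v j))"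

lemma l2norm_seminorm: "seminorm (l2norm J)"
  unfolding seminorm_def
proof (intro conjI allI)
  fix u v :: "'a \<Rightarrow> 'b"
  have "l2norm J (u + v) \<le> L2_set (\<lambda>j. norm (u j) + norm (v j)) J"
    unfolding l2norm_def by (intro L2_set_mono) (auto simp: norm_triangle_ineq)
  also have "\<dots> \<le> l2norm J u + l2norm J v"
    unfolding l2norm_def by (rule L2_set_triangle_ineq)
  finally show "l2norm J (u + v) \<le> l2norm J u + l2norm J v" .
next
  fix r and u :: "'a \<Rightarrow> 'b"
  show "l2norm J (r *\<^sub>R u) = \<bar>r\<bar> * l2norm J u"
    by (simp only: l2norm_def scaleR_fun_apply norm_scaleR L2_set_right_distrib[OF abs_ge_zero])
qed

lemmas l2norm_nonneg = seminorm_nonneg[OF l2norm_seminorm]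
  and l2norm_triangle = seminorm_triangle[OF l2norm_seminorm]
  and l2norm_diff = seminorm_diff[OF l2norm_seminorm]

lemma norm_le_l2norm: "finite J \<Longrightarrow> j \<in> J \<Longrightarrow> norm (u j) \<le> l2norm J u"
  unfolding l2norm_def by (rule member_le_L2_set)

lemma l2norm_le_sum: "l2norm J u \<le> (\<Sum>j\<in>J. norm (u j))"
  unfolding l2norm_def by (rule L2_set_le_sum) simp

lemma l2norm_eq_0: "finite J \<Longrightarrow> l2norm J u = 0 \<longleftrightarrow> (\<forall>j\<in>J. u j = 0)"
  by (simp add: l2norm_def L2_set_eq_0_iff)

lemma l2norm_cong: "(\<And>j. j \<in> J \<Longrightarrow> u j = v j) \<Longrightarrow> l2norm J u = l2norm J v"
  by (simp add: l2norm_def cong: L2_set_cong)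

lemma l2norm_series_complete:
  assumes J: "finite J"
  shows "series_complete (l2norm J :: ('i \<Rightarrow> 'v::banach) \<Rightarrow> real)"
  unfolding series_complete_def
proof (intro allI impI)
  fix x :: "nat \<Rightarrow> 'i \<Rightarrow> 'v"
  assume sm: "summable (\<lambda>n. l2norm J (x n))"
  define s where "s j = suminf (\<lambda>n. x n j)" for j
  have sj: "(\<lambda>n. x n j) sums s j" if "j \<in> J" for j
  proof -
    have "summable (\<lambda>n. norm (x n j))"
      by (rule summable_comparison_test[OF _ sm]) (use norm_le_l2norm[OF J that] in auto)
    then show ?thesis unfolding s_def by (rule summable_sums[OF summable_norm_cancel])
  qed
  have app: "(\<Sum>k<n. x k) j = (\<Sum>k<n. x k j)" for n j by (induction n) simp_all
  have "(\<lambda>n. \<Sum>j\<in>J. norm (s j - (\<Sum>k<n. x k j))) \<longlonglongrightarrow> (\<Sum>j\<in>J. norm (s j - s j))"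
    by (intro tendsto_sum tendsto_norm tendsto_diff tendsto_const) (rule sj[unfolded sums_def])
  then have lim: "(\<lambda>n. \<Sum>j\<in>J. norm (s j - (\<Sum>k<n. x k j))) \<longlonglongrightarrow> 0" by simp
  show "\<exists>s. (\<lambda>n. l2norm J (s - (\<Sum>k<n. x k))) \<longlonglongrightarrow> 0"
  proof (rule exI[of _ s], rule tendsto_sandwich[OF _ _ tendsto_const lim])
    show "\<forall>\<^sub>F n in sequentially. 0 \<le> l2norm J (s - (\<Sum>k<n. x k))"
      by (simp add: l2norm_nonneg)
    show "\<forall>\<^sub>F n in sequentially. l2norm J (s - (\<Sum>k<n. x k)) \<le> (\<Sum>j\<in>J. norm (s j - (\<Sum>k<n. x k j)))"
    proof (rule always_eventually, rule allI)
      fix n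
      show "l2norm J (s - (\<Sum>k<n. x k)) \<le> (\<Sum>j\<in>J. norm (s j - (\<Sum>k<n. x k j)))"
        using l2norm_le_sum[of J "s - (\<Sum>k<n. x k)"] by (simp add: app)
    qed
  qed
qed

lemma l2inner_simps:
  "l2inner J (u + v) w = l2inner J u w + l2inner J v w"
  "l2inner J (r *\<^sub>R u) w = r * l2inner J u w"
  by (simp_all add: l2inner_def rip_add_left rip_scaleR_left sum.distrib sum_distrib_left)

lemma l2inner_commute: "l2inner J u v = l2inner J v u"
  unfolding l2inner_def by (intro sum.cong refl rip_commute)

lemma l2inner_self: "l2inner J u u = (l2norm J u)\<^sup>2"
  by (simp add: l2inner_def l2norm_def L2_set_def rip_self sum_nonneg)

lemma l2inner_le: "l2inner J u v \<le> l2norm J u * l2norm J v"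
proof -
  have "l2inner J u v \<le> (\<Sum>j\<in>J. \<bar>norm (u j)\<bar> * \<bar>norm (v j)\<bar>)"
    unfolding l2inner_def
  proof (rule sum_mono)
    fix j
    show "rip (u j) (v j) \<le> \<bar>norm (u j)\<bar> * \<bar>norm (v j)\<bar>"
      using rip_Cauchy_Schwarz[of "u j" "v j"] by (simp add: abs_le_iff)
  qed
  also have "\<dots> \<le> l2norm J u * l2norm J v"
    unfolding l2norm_def by (rule L2_set_mult_ineq)
  finally show ?thesis .
qed

section \<open>Evaluating group-ring matrices in a unitary representation\<close>

definition scale_rat :: "rat \<Rightarrow> 'v::real_vector \<Rightarrow> 'v" where
  "scale_rat r v = of_rat r *\<^sub>R v"

lemma rip_sum: "rip (sum f A) y = (\<Sum>a\<in>A. rip (f a) y)"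
proof (induction A rule: infinite_finite_induct)
  case (insert a A) then show ?case by (simp add: rip_add_left)
qed (use rip_scaleR_left[of 0 0 y] in simp_all)

locale unitary_representation = group G
  for G :: "('g, 'x) monoid_scheme" (structure) +
  fixes \<pi> :: "'g \<Rightarrow> 'v::complex_hilbert_space \<Rightarrow> 'v"
  assumes rep: "unitary_rep G \<pi>"
begin

lemma unitary: "g \<in> carrier G \<Longrightarrow> unitary_operator (\<pi> g)"
  using rep by (auto simp: unitary_rep_def hom_def unitary_group_def)

lemma rep_mult: "g \<in> carrier G \<Longrightarrow> h \<in> carrier G \<Longrightarrow> \<pi> (g \<otimes> h) x = \<pi> g (\<pi> h x)"
  using rep by (auto simp: unitary_rep_def hom_def unitary_group_def)

lemma rep_add: "g \<in> carrier G \<Longrightarrow> \<pi> g (x + y) = \<pi> g x + \<pi> g y"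
  using unitary by (simp add: unitary_operator_def)

lemma rep_scaleC: "g \<in> carrier G \<Longrightarrow> \<pi> g (c *\<^sub>C x) = c *\<^sub>C \<pi> g x"
  using unitary by (simp add: unitary_operator_def)

lemma rep_scaleR: "g \<in> carrier G \<Longrightarrow> \<pi> g (r *\<^sub>R x) = r *\<^sub>R \<pi> g x"
  using rep_scaleC[of g "of_real r" x] by (simp add: scaleC_of_real)

lemma rep_cinner: "g \<in> carrier G \<Longrightarrow> cinner (\<pi> g x) (\<pi> g y) = cinner x y"
  using unitary by (simp add: unitary_operator_def)

lemma rep_norm: "g \<in> carrier G \<Longrightarrow> norm (\<pi> g x) = norm x"
  using rip_self[of "\<pi> g x"] rip_self[of x] rep_cinner[of g x x] by simp

lemma rep_diff: "g \<in> carrier G \<Longrightarrow> \<pi> g (x - y) = \<pi> g x - \<pi> g y"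
  using rep_add[of g "x - y" y] by (simp add: algebra_simps)

lemma rep_one: "\<pi> \<one> x = x"
proof -
  have "\<pi> \<one> (\<pi> \<one> x) = \<pi> \<one> x" using rep_mult[of \<one> \<one> x] by simp
  then have "norm (\<pi> \<one> (\<pi> \<one> x - x)) = 0" by (simp add: rep_diff)
  then show ?thesis by (simp add: rep_norm)
qed

lemma rip_rep: "g \<in> carrier G \<Longrightarrow> rip (\<pi> g x) y = rip x (\<pi> (inv g) y)"
proof -
  assume g: "g \<in> carrier G"
  have "\<pi> (inv g) (\<pi> g x) = x"
    unfolding rep_mult[OF inv_closed[OF g] g, symmetric] l_inv[OF g] by (rule rep_one)
  then show ?thesis using rep_cinner[OF inv_closed[OF g], of "\<pi> g x" y] by simp
qed

lemma rep_bounded_linear: "g \<in> carrier G \<Longrightarrow> bounded_linear (\<pi> g)"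
  by (rule bounded_linear_intro[where K = 1]) (simp_all add: rep_add rep_scaleR rep_norm)

sublocale rational_rep G scale_rat \<pi>
proof
  fix r s :: rat and x y :: 'v
  show "scale_rat r (x + y) = scale_rat r x + scale_rat r y"
    "scale_rat (r + s) x = scale_rat r x + scale_rat s x"
    "scale_rat r (scale_rat s x) = scale_rat (r * s) x" "scale_rat 1 x = x"
    by (simp_all add: scale_rat_def scaleR_add_right of_rat_add scaleR_add_left of_rat_mult)
qed (auto simp: scale_rat_def rep_add rep_scaleR rep_mult rep_one)

abbreviation equivariant :: "('i, 'g) chain set \<Rightarrow> (('i, 'g) chain \<Rightarrow> 'v) \<Rightarrow> bool" where
  "equivariant Y z \<equiv> equivariant_on G Y scale_rat \<pi> z"

abbreviation evaluate :: "('i \<Rightarrow> 'v) \<Rightarrow> ('i, 'g) chain \<Rightarrow> 'v" where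
  "evaluate \<equiv> ext_act scale_rat \<pi>"

lemma evaluate_eq: "evaluate u x = (\<Sum>k\<in>supp x. of_rat (coef x k) *\<^sub>R \<pi> (snd k) (u (fst k)))"
  unfolding ext_act_def lin_def scale_rat_def by (intro sum.cong) (auto split: prod.split)

lemma key_carrier: "x \<in> free_chains G I \<Longrightarrow> k \<in> supp x \<Longrightarrow> fst k \<in> I \<and> snd k \<in> carrier G"
  by (auto simp: free_chains_def)

lemma evaluate_cong: "x \<in> free_chains G I \<Longrightarrow> (\<And>i. i \<in> I \<Longrightarrow> u i = v i) \<Longrightarrow> evaluate u x = evaluate v x"
  unfolding evaluate_eq by (intro sum.cong refl) (simp add: key_carrier[of x I])

lemma evaluate_add: "x \<in> free_chains G I \<Longrightarrow> evaluate (u + v) x = evaluate u x + evaluate v x"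
  unfolding evaluate_eq sum.distrib[symmetric]
  by (intro sum.cong refl) (simp add: rep_add key_carrier[of x I] scaleR_add_right)

lemma evaluate_scaleR: "x \<in> free_chains G I \<Longrightarrow> evaluate (r *\<^sub>R u) x = r *\<^sub>R evaluate u x"
  unfolding evaluate_eq scaleR_sum_right
  by (intro sum.cong refl) (simp add: rep_scaleR key_carrier[of x I])

lemma evaluate_diff: "x \<in> free_chains G I \<Longrightarrow> evaluate (u - v) x = evaluate u x - evaluate v x"
  using evaluate_add[of x I "u - v" v] by (simp add: algebra_simps)

lemma evaluate_sum: "x \<in> free_chains G I \<Longrightarrow> evaluate (\<lambda>i. \<Sum>a\<in>A. u a i) x = (\<Sum>a\<in>A. evaluate (u a) x)"
proof (induction A rule: infinite_finite_induct)
  case (insert a A)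
  have "(\<lambda>i. \<Sum>a\<in>insert a A. u a i) = u a + (\<lambda>i. \<Sum>a\<in>A. u a i)" using insert by (simp add: fun_eq_iff)
  then show ?case using insert evaluate_add[of x I "u a"] by simp
qed (use evaluate_scaleR[of x I 0 "\<lambda>_. 0"] in \<open>simp_all add: fun_eq_iff scaleR_fun_def\<close>)

lemma evaluate_zero: "x \<in> free_chains G I \<Longrightarrow> (\<And>i. i \<in> I \<Longrightarrow> u i = 0) \<Longrightarrow> evaluate u x = 0"
  using evaluate_cong[of x I u "0 *\<^sub>R u"] evaluate_scaleR[of x I 0 u] by simp

lemma evaluate_sums:
  assumes x: "x \<in> free_chains G I" and u: "\<And>i. i \<in> I \<Longrightarrow> (\<lambda>n. u n i) sums s i"
  shows "(\<lambda>n. evaluate (u n) x) sums evaluate s x"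
  unfolding evaluate_eq
proof (rule sums_sum)
  fix k assume "k \<in> supp x"
  from key_carrier[OF x this] have k: "fst k \<in> I" "snd k \<in> carrier G" by auto
  from bounded_linear.sums[OF rep_bounded_linear[OF k(2)] u[OF k(1)]]
  show "(\<lambda>n. of_rat (coef x k) *\<^sub>R \<pi> (snd k) (u n (fst k))) sums
        (of_rat (coef x k) *\<^sub>R \<pi> (snd k) (s (fst k)))"
    by (rule sums_scaleR_right)
qed

lemma evaluate_chain_add: "evaluate u (x + y) = evaluate u x + evaluate u y"
  by (simp add: ext_act_def lin_add)

lemma evaluate_chain_scale: "evaluate u (scale_chain r x) = of_rat r *\<^sub>R evaluate u x"
  by (simp add: ext_act_def lin_scale scale_rat_def[of r])

lemma evaluate_chain_diff: "evaluate u (x - y) = evaluate u x - evaluate u y"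
  using evaluate_chain_add[of u "x - y" y] by (simp add: algebra_simps)

lemma evaluate_chain_sum: "evaluate u (sum f A) = (\<Sum>a\<in>A. evaluate u (f a))"
proof (induction A rule: infinite_finite_induct)
  case (insert a A) then show ?case by (simp add: evaluate_chain_add)
qed (simp_all add: ext_act_def)

text \<open>Composition of operators is multiplication of matrices.\<close>

lemma evaluate_evaluate:
  fixes m :: "'i \<Rightarrow> ('j, 'g) chain"
  assumes x: "x \<in> free_chains G I" and m: "\<And>i. i \<in> I \<Longrightarrow> m i \<in> free_chains G J"
  shows "evaluate (\<lambda>i. evaluate u (m i)) x = evaluate u (extend G m x)"
proof (rule equivariant_eq_on_free[OF ext_act_equivariant _ _ x])
  interpret F: rational_rep G "scale_chain" "translate G :: 'g \<Rightarrow> ('j, 'g) chain \<Rightarrow> _"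
    by (rule rational_rep_translate[OF is_group])
  have "chain_hom G (free_chains G I) (free_chains G J) (extend G m)"
    unfolding chain_hom_def
    by (intro conjI ballI F.ext_act_equivariant ext_act_closed[OF is_group submod_free_chains[OF is_group] m])
  then show "equivariant (free_chains G I) (\<lambda>x. evaluate u (extend G m x))"
    by (rule equivariant_on_comp[OF _ ext_act_equivariant])
  show "evaluate (\<lambda>i. evaluate u (m i)) (gen G i) = evaluate u (extend G m (gen G i))" for i
    by simp
qed

lemma evaluate_bounded:
  assumes I: "finite I" and J: "finite J" and m: "\<And>j. j \<in> J \<Longrightarrow> m j \<in> free_chains G I"
  shows "\<exists>C\<ge>0. \<forall>u. l2norm J (\<lambda>j. evaluate u (m j)) \<le> C * l2norm I u"
proof (intro exI conjI allI)
  let ?C = "\<Sum>j\<in>J. \<Sum>k\<in>supp (m j). \<bar>of_rat (coef (m j) k) :: real\<bar>"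
  show "0 \<le> ?C" by (intro sum_nonneg) auto
  fix u
  have "norm (evaluate u (m j)) \<le> (\<Sum>k\<in>supp (m j). \<bar>of_rat (coef (m j) k) :: real\<bar>) * l2norm I u"
    if j: "j \<in> J" for j
  proof -
    have "norm (evaluate u (m j)) \<le> (\<Sum>k\<in>supp (m j). norm (of_rat (coef (m j) k) *\<^sub>R \<pi> (snd k) (u (fst k))))"
      unfolding evaluate_eq by (rule norm_sum)
    also have "\<dots> \<le> (\<Sum>k\<in>supp (m j). \<bar>of_rat (coef (m j) k) :: real\<bar> * l2norm I u)"
    proof (rule sum_mono)
      fix k assume "k \<in> supp (m j)"
      from key_carrier[OF m[OF j] this] have "fst k \<in> I" "snd k \<in> carrier G" by auto
      then show "norm (of_rat (coef (m j) k) *\<^sub>R \<pi> (snd k) (u (fst k)))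
          \<le> \<bar>of_rat (coef (m j) k) :: real\<bar> * l2norm I u"
        by (simp add: rep_norm norm_le_l2norm[OF I] mult_left_mono)
    qed
    finally show ?thesis by (simp add: sum_distrib_right)
  qed
  then have "(\<Sum>j\<in>J. norm (evaluate u (m j))) \<le> ?C * l2norm I u"
    unfolding sum_distrib_right[where A = J] by (intro sum_mono) auto
  then show "l2norm J (\<lambda>j. evaluate u (m j)) \<le> ?C * l2norm I u"
    using l2norm_le_sum[of J "\<lambda>j. evaluate u (m j)"] by linarith
qed

end

section \<open>Adjoint matrices\<close>

text \<open>The transpose, with every group element replaced by its inverse; a unitary representation turns it
  into the adjoint operator.\<close>

definition adjoint_matrix ::
    "('g, 'x) monoid_scheme \<Rightarrow> 'j set \<Rightarrow> ('j \<Rightarrow> ('i, 'g) chain) \<Rightarrow> 'i \<Rightarrow> ('j, 'g) chain" where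
  "adjoint_matrix G J m i = (\<Sum>j\<in>J. \<Sum>k\<in>supp (m j).
     if fst k = i then single (j, inv\<^bsub>G\<^esub> (snd k)) (coef (m j) k) else 0)"

context unitary_representation
begin

lemma adjoint_matrix_in_free_chains:
  assumes "\<And>j. j \<in> J \<Longrightarrow> m j \<in> free_chains G I"
  shows "adjoint_matrix G J m i \<in> free_chains G J"
proof -
  note F = submodD[OF submod_free_chains[OF is_group, of J]]
  have sum: "(\<Sum>a\<in>A. f a) \<in> free_chains G J" if "\<And>a. a \<in> A \<Longrightarrow> f a \<in> free_chains G J"
    for A :: "'c set" and f using that by (induction A rule: infinite_finite_induct) (simp_all add: F(1,2))
  have sum': "(\<Sum>a\<in>A. f a) \<in> free_chains G J" if "\<And>a. a \<in> A \<Longrightarrow> f a \<in> free_chains G J"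
    for A :: "('b \<times> 'g) set" and f using that by (induction A rule: infinite_finite_induct) (simp_all add: F(1,2))
  show ?thesis unfolding adjoint_matrix_def
  proof (intro sum sum')
    fix j k assume j: "j \<in> J" and k: "k \<in> supp (m j)"
    then have "snd k \<in> carrier G" using key_carrier[OF assms[OF j] k] by simp
    then show "(if fst k = i then single (j, inv (snd k)) (coef (m j) k) else 0) \<in> free_chains G J"
      using j F(1) by (simp add: free_chains_def)
  qed
qed

lemma adjoint_matrix:
  assumes I: "finite I" and m: "\<And>j. j \<in> J \<Longrightarrow> m j \<in> free_chains G I"
  shows "l2inner J (\<lambda>j. evaluate u (m j)) v = l2inner I u (\<lambda>i. evaluate v (adjoint_matrix G J m i))"
proof -
  define t where "t j k = of_rat (coef (m j) k) * rip (\<pi> (snd k) (u (fst k))) (v j)" for j k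
  have "l2inner J (\<lambda>j. evaluate u (m j)) v = (\<Sum>j\<in>J. \<Sum>k\<in>supp (m j). t j k)"
    unfolding l2inner_def evaluate_eq rip_sum rip_scaleR_left t_def ..
  also have "\<dots> = (\<Sum>j\<in>J. \<Sum>k\<in>supp (m j). \<Sum>i\<in>I. if fst k = i then t j k else 0)"
    using key_carrier[OF m] by (intro sum.cong refl) (simp add: I)
  also have "\<dots> = (\<Sum>j\<in>J. \<Sum>i\<in>I. \<Sum>k\<in>supp (m j). if fst k = i then t j k else 0)"
    by (intro sum.cong refl sum.swap)
  also have "\<dots> = (\<Sum>i\<in>I. \<Sum>j\<in>J. \<Sum>k\<in>supp (m j). if fst k = i then t j k else 0)"
    by (rule sum.swap)
  also have "\<dots> = (\<Sum>i\<in>I. rip (evaluate v (adjoint_matrix G J m i)) (u i))"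
  proof (rule sum.cong[OF refl])
    fix i
    have ev: "evaluate v (if fst k = i then single (j, inv (snd k)) (coef (m j) k) else 0)
      = (if fst k = i then of_rat (coef (m j) k) *\<^sub>R \<pi> (inv (snd k)) (v j) else 0)" for j k
      by (simp add: ext_act_def scale_rat_def)
    have r0: "rip (0 :: 'v) y = 0" for y using rip_scaleR_left[of 0 0 y] by simp
    have "rip (if fst k = i then of_rat (coef (m j) k) *\<^sub>R \<pi> (inv (snd k)) (v j) else 0) (u i)
        = (if fst k = i then t j k else 0)" if "j \<in> J" "k \<in> supp (m j)" for j k
    proof (cases "fst k = i")
      case True
      have "snd k \<in> carrier G" using key_carrier[OF m[OF that(1)] that(2)] by simp
      then show ?thesis
        using True rip_rep[of "snd k" "u i" "v j"] rip_commute[of "u i" "\<pi> (inv (snd k)) (v j)"]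
        by (simp add: t_def rip_scaleR_left)
    qed (simp add: r0)
    then show "(\<Sum>j\<in>J. \<Sum>k\<in>supp (m j). if fst k = i then t j k else 0)
      = rip (evaluate v (adjoint_matrix G J m i)) (u i)"
      unfolding adjoint_matrix_def evaluate_chain_sum ev rip_sum by (intro sum.cong refl) simp
  qed
  also have "\<dots> = l2inner I u (\<lambda>i. evaluate v (adjoint_matrix G J m i))"
    unfolding l2inner_def by (intro sum.cong refl rip_commute)
  finally show ?thesis .
qed

section \<open>The Laplacian\<close>

text \<open>In terms of the operators \<open>A\<close> and \<open>B\<close> with matrices \<open>a\<close> and \<open>b\<close>, the hypotheses say that \<open>ker B = im A\<close> and that
  \<open>B\<close> has closed range; the range of \<open>A\<close> is closed because it is a kernel. By the open mapping theorem
  an element \<open>y = Ax\<close> of \<open>ker B\<close> has such a preimage with \<open>\<parallel>x\<parallel> \<le> K\<parallel>y\<parallel>\<close>, so that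
  \<open>\<parallel>y\<parallel>\<^sup>2 = \<langle>x, A\<^sup>*y\<rangle> \<le> K\<parallel>y\<parallel>\<parallel>A\<^sup>*y\<parallel>\<close>. A general \<open>u\<close> is split as \<open>u' + (u - u')\<close> with \<open>Bu' = Bu\<close> and
  \<open>\<parallel>u'\<parallel> \<le> K'\<parallel>Bu\<parallel>\<close>, and the estimate is applied to \<open>u - u'\<close>. No orthogonal projection is involved.\<close>

lemma exact_closed_imp_coercive:
  fixes a :: "'i1 \<Rightarrow> ('i0, 'g) chain" and b :: "'i2 \<Rightarrow> ('i1, 'g) chain"
  assumes fin: "finite I0" "finite I1" "finite I2"
    and a: "\<And>i. i \<in> I1 \<Longrightarrow> a i \<in> free_chains G I0" and b: "\<And>k. k \<in> I2 \<Longrightarrow> b k \<in> free_chains G I1"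
    and ba: "\<And>x k. k \<in> I2 \<Longrightarrow> evaluate (\<lambda>i. evaluate x (a i)) (b k) = 0"
    and exact: "\<And>u. (\<And>k. k \<in> I2 \<Longrightarrow> evaluate u (b k) = 0) \<Longrightarrow> \<exists>x. \<forall>i\<in>I1. u i = evaluate x (a i)"
    and closed: "\<And>y. (\<And>e. e > 0 \<Longrightarrow> \<exists>u. l2norm I2 (y - (\<lambda>k. evaluate u (b k))) < e)
                  \<Longrightarrow> \<exists>u. l2norm I2 (y - (\<lambda>k. evaluate u (b k))) = 0"
  shows "\<exists>K>0. \<forall>u. l2norm I1 u \<le>
     K * (l2norm I0 (\<lambda>i. evaluate u (adjoint_matrix G I1 a i)) + l2norm I2 (\<lambda>k. evaluate u (b k)))"
proof -
  \<comment> \<open>Values outside the index sets are set to zero, to make the operators linear.\<close>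
  define A where "A x = (\<lambda>i. if i \<in> I1 then evaluate x (a i) else 0)" for x :: "'i0 \<Rightarrow> 'v"
  define B where "B u = (\<lambda>k. if k \<in> I2 then evaluate u (b k) else 0)" for u :: "'i1 \<Rightarrow> 'v"
  have linA: "linear A" unfolding A_def
    by (rule linearI) (auto simp: fun_eq_iff evaluate_add[OF a] evaluate_scaleR[OF a])
  have linB: "linear B" unfolding B_def
    by (rule linearI) (auto simp: fun_eq_iff evaluate_add[OF b] evaluate_scaleR[OF b])
  have A_norm: "l2norm I1 (y - A x) = l2norm I1 (y - (\<lambda>i. evaluate x (a i)))" "l2norm I1 (A x) = l2norm I1 (\<lambda>i. evaluate x (a i))" for x y
    by (rule l2norm_cong; simp add: A_def)+
  have B_norm: "l2norm I2 (y - B u) = l2norm I2 (y - (\<lambda>k. evaluate u (b k)))" "l2norm I2 (B u) = l2norm I2 (\<lambda>k. evaluate u (b k))" for u y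
    by (rule l2norm_cong; simp add: B_def)+
  from evaluate_bounded[OF fin(1,2) a] obtain Ca where
    "Ca \<ge> 0 \<and> (\<forall>x. l2norm I1 (\<lambda>i. evaluate x (a i)) \<le> Ca * l2norm I0 x)" ..
  then have Ca: "Ca \<ge> 0" "\<And>x. l2norm I1 (A x) \<le> Ca * l2norm I0 x" by (simp_all add: A_norm)
  from evaluate_bounded[OF fin(2,3) b] obtain Cb where
    "Cb \<ge> 0 \<and> (\<forall>u. l2norm I2 (\<lambda>k. evaluate u (b k)) \<le> Cb * l2norm I1 u)" ..
  then have Cb: "Cb \<ge> 0" "\<And>u. l2norm I2 (B u) \<le> Cb * l2norm I1 u" by (simp_all add: B_norm)
  have "\<exists>K>0. \<forall>u. \<exists>u'. l2norm I2 (B u - B u') = 0 \<and> l2norm I1 u' \<le> K * l2norm I2 (B u)"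
  proof (rule open_mapping_seminorm[where f = B and p = "l2norm I1" and q = "l2norm I2" and C = Cb])
    show "l2norm I2 (B u) \<le> Cb * l2norm I1 u" for u by (rule Cb(2))
    show "\<exists>u. l2norm I2 (y - B u) = 0" if "\<And>e. e > 0 \<Longrightarrow> \<exists>u. l2norm I2 (y - B u) < e" for y
      using closed[of y] that by (simp add: B_norm)
  qed (intro l2norm_seminorm l2norm_series_complete fin linB)+
  then obtain KB where KB: "KB > 0" "\<And>u. \<exists>u'. l2norm I2 (B u - B u') = 0 \<and> l2norm I1 u' \<le> KB * l2norm I2 (B u)"
    by blast
  have BA: "B (A x) = 0" for x
  proof
    fix k
    show "B (A x) k = 0 k"
    proof (cases "k \<in> I2")
      case True
      have "evaluate (A x) (b k) = evaluate (\<lambda>i. evaluate x (a i)) (b k)"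
        by (rule evaluate_cong[OF b[OF True]]) (simp add: A_def)
      then show ?thesis using True ba by (simp add: B_def)
    qed (simp add: B_def)
  qed
  have exactA: "\<exists>x. l2norm I1 (y - A x) = 0" if "l2norm I2 (B y) = 0" for y
  proof -
    have "\<exists>x. \<forall>i\<in>I1. y i = evaluate x (a i)"
      using that by (intro exact) (simp add: l2norm_eq_0[OF fin(3)] B_def)
    then show ?thesis by (simp add: l2norm_eq_0[OF fin(2)] A_def)
  qed
  have closedA: "\<exists>x. l2norm I1 (y - A x) = 0" if app: "\<And>e. e > 0 \<Longrightarrow> \<exists>x. l2norm I1 (y - A x) < e" for y
  proof (rule exactA)
    have "l2norm I2 (B y) \<le> 0 + e" if e: "e > 0" for e
    proof -
      have "e / (Cb + 1) > 0" using e Cb(1) by simp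
      then obtain x where x: "l2norm I1 (y - A x) < e / (Cb + 1)" using app by blast
      have "B y = B (y - A x)" by (simp add: linear_diff[OF linB] BA)
      then have "l2norm I2 (B y) \<le> Cb * l2norm I1 (y - A x)" using Cb(2)[of "y - A x"] by simp
      also have "\<dots> \<le> (Cb + 1) * (e / (Cb + 1))"
        using x Cb(1) l2norm_nonneg[of I1 "y - A x"] by (intro mult_mono) auto
      also have "\<dots> = e" using Cb(1) by simp
      finally show ?thesis by simp
    qed
    then have "l2norm I2 (B y) \<le> 0" by (rule field_le_epsilon)
    then show "l2norm I2 (B y) = 0" using l2norm_nonneg[of I2 "B y"] by simp
  qed
  have "\<exists>K>0. \<forall>x. \<exists>x'. l2norm I1 (A x - A x') = 0 \<and> l2norm I0 x' \<le> K * l2norm I1 (A x)"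
  proof (rule open_mapping_seminorm[where f = A and p = "l2norm I0" and q = "l2norm I1" and C = Ca])
    show "l2norm I1 (A x) \<le> Ca * l2norm I0 x" for x by (rule Ca(2))
    show "\<exists>x. l2norm I1 (y - A x) = 0" if "\<And>e. e > 0 \<Longrightarrow> \<exists>x. l2norm I1 (y - A x) < e" for y
      by (rule closedA[OF that])
  qed (intro l2norm_seminorm l2norm_series_complete fin linA)+
  then obtain KA where KA: "KA > 0" "\<And>x. \<exists>x'. l2norm I1 (A x - A x') = 0 \<and> l2norm I0 x' \<le> KA * l2norm I1 (A x)"
    by blast
  define As where "As u = (\<lambda>i. evaluate u (adjoint_matrix G I1 a i))" for u :: "'i1 \<Rightarrow> 'v"
  have adj: "l2inner I1 (A x) u = l2inner I0 x (As u)" for x u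
    using adjoint_matrix[where u = x and v = u, OF fin(1) a]
    by (simp add: l2inner_def A_def As_def)
  from evaluate_bounded[OF fin(2,1) adjoint_matrix_in_free_chains[of I1 a I0, OF a]] obtain Cs where
    "Cs \<ge> 0 \<and> (\<forall>u. l2norm I0 (\<lambda>i. evaluate u (adjoint_matrix G I1 a i)) \<le> Cs * l2norm I1 u)" ..
  then have Cs: "Cs \<ge> 0" "\<And>u. l2norm I0 (As u) \<le> Cs * l2norm I1 u" by (simp_all add: As_def)
  have ker: "l2norm I1 y \<le> KA * l2norm I0 (As y)" if By: "l2norm I2 (B y) = 0" for y
  proof -
    obtain x0 where x0: "l2norm I1 (y - A x0) = 0" using exactA[OF By] by blast
    obtain x where x: "l2norm I1 (A x0 - A x) = 0" "l2norm I0 x \<le> KA * l2norm I1 (A x0)" using KA(2) by blast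
    have eq: "\<And>i. i \<in> I1 \<Longrightarrow> A x i = y i" "\<And>i. i \<in> I1 \<Longrightarrow> A x0 i = y i"
      using x0 x(1) by (auto simp: l2norm_eq_0[OF fin(2)])
    have "(l2norm I1 y)\<^sup>2 = l2inner I1 (A x) y"
      unfolding l2inner_self[symmetric] by (simp add: l2inner_def eq)
    also have "\<dots> \<le> l2norm I0 x * l2norm I0 (As y)" unfolding adj by (rule l2inner_le)
    also have "\<dots> \<le> KA * l2norm I1 y * l2norm I0 (As y)"
      using x(2) l2norm_cong[of I1 "A x0" y, OF eq(2)] l2norm_nonneg
      by (intro mult_right_mono) auto
    finally have le: "l2norm I1 y * l2norm I1 y \<le> l2norm I1 y * (KA * l2norm I0 (As y))"
      by (simp add: power2_eq_square algebra_simps)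
    show ?thesis
    proof (cases "l2norm I1 y = 0")
      case True then show ?thesis using KA(1) l2norm_nonneg[of I0 "As y"] by simp
    next
      case False
      then have "l2norm I1 y > 0" using l2norm_nonneg[of I1 y] by simp
      then show ?thesis using le by (simp add: mult_le_cancel_left)
    qed
  qed
  define K where "K = KA + (1 + KA * Cs) * KB"
  have K: "K > 0" using KA(1) KB(1) Cs(1) by (simp add: K_def add_pos_nonneg)
  have "l2norm I1 u \<le> K * (l2norm I0 (As u) + l2norm I2 (B u))" for u
  proof -
    obtain u' where u': "l2norm I2 (B u - B u') = 0" "l2norm I1 u' \<le> KB * l2norm I2 (B u)" using KB(2) by blast
    have "l2norm I2 (B (u - u')) = 0" using u'(1) by (simp add: linear_diff[OF linB])
    then have "l2norm I1 (u - u') \<le> KA * l2norm I0 (As (u - u'))" by (rule ker)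
    also have "l2norm I0 (As (u - u')) \<le> l2norm I0 (As u) + Cs * l2norm I1 u'"
    proof -
      have "As (u - u') = As u - As u'"
        unfolding As_def using evaluate_diff[OF adjoint_matrix_in_free_chains[of I1 a I0, OF a]] by (simp add: fun_eq_iff)
      then show ?thesis using l2norm_diff[of I0 "As u" "As u'"] Cs(2)[of u'] by simp
    qed
    finally have 1: "l2norm I1 (u - u') \<le> KA * (l2norm I0 (As u) + Cs * l2norm I1 u')"
      using KA(1) by (simp add: mult_left_mono)
    have "l2norm I1 u \<le> l2norm I1 (u - u') + l2norm I1 u'"
      using l2norm_triangle[of I1 "u - u'" u'] by simp
    also have "\<dots> \<le> KA * l2norm I0 (As u) + (1 + KA * Cs) * l2norm I1 u'"
      using 1 by (simp add: algebra_simps)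
    also have "\<dots> \<le> KA * l2norm I0 (As u) + (1 + KA * Cs) * (KB * l2norm I2 (B u))"
      using u'(2) KA(1) Cs(1) by (intro add_left_mono mult_left_mono) auto
    also have "\<dots> \<le> K * (l2norm I0 (As u) + l2norm I2 (B u))"
      unfolding K_def using KA(1) KB(1) Cs(1) l2norm_nonneg[of I0 "As u"]
        l2norm_nonneg[of I2 "B u"] by (simp add: algebra_simps)
    finally show ?thesis .
  qed
  then show ?thesis using K unfolding As_def B_norm by blast
qed

end

lemma l2norm_add_scaleR_sq:
  "(l2norm J (u + r *\<^sub>R w))\<^sup>2 = (l2norm J u)\<^sup>2 + 2 * r * l2inner J u w + r\<^sup>2 * (l2norm J w)\<^sup>2"
proof -
  have "l2inner J (u + r *\<^sub>R w) (u + r *\<^sub>R w) = l2inner J u (u + r *\<^sub>R w) + r * l2inner J w (u + r *\<^sub>R w)"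
    by (simp only: l2inner_simps)
  also have "\<dots> = l2inner J (u + r *\<^sub>R w) u + r * l2inner J (u + r *\<^sub>R w) w"
    by (simp only: l2inner_commute[of J u "u + r *\<^sub>R w"] l2inner_commute[of J w "u + r *\<^sub>R w"])
  also have "\<dots> = l2inner J u u + 2 * r * l2inner J u w + r\<^sup>2 * l2inner J w w"
    unfolding l2inner_simps l2inner_commute[of J w u] by (simp add: power2_eq_square algebra_simps)
  finally show ?thesis by (simp only: l2inner_self)
qed

text \<open>The matrix of \<open>1 - (B\<^sup>*B + AA\<^sup>*)/N\<close>. Dividing by a natural number keeps its coefficients rational.\<close>

definition laplace_step ::
    "('g, 'x) monoid_scheme \<Rightarrow> 'i1 set \<Rightarrow> 'i2 set \<Rightarrow> ('i1 \<Rightarrow> ('i0, 'g) chain) \<Rightarrow> ('i2 \<Rightarrow> ('i1, 'g) chain)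
      \<Rightarrow> nat \<Rightarrow> 'i1 \<Rightarrow> ('i1, 'g) chain" where
  "laplace_step G I1 I2 a b N i = gen G i - scale_chain (1 / of_nat N)
     (extend G b (adjoint_matrix G I2 b i)
      + extend G (adjoint_matrix G I1 a) (a i))"

context unitary_representation
begin

lemma evaluate_laplace_step:
  assumes a: "\<And>i. i \<in> I1 \<Longrightarrow> a i \<in> free_chains G I0" and b: "\<And>k. k \<in> I2 \<Longrightarrow> b k \<in> free_chains G I1"
    and i: "i \<in> I1"
  shows "evaluate u (laplace_step G I1 I2 a b N i) = u i - (1 / real N) *\<^sub>R
    (evaluate (\<lambda>k. evaluate u (b k)) (adjoint_matrix G I2 b i)
     + evaluate (\<lambda>j. evaluate u (adjoint_matrix G I1 a j)) (a i))"
proof -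
  have 1: "evaluate (\<lambda>k. evaluate u (b k)) (adjoint_matrix G I2 b i)
      = evaluate u (extend G b (adjoint_matrix G I2 b i))"
    by (rule evaluate_evaluate[OF adjoint_matrix_in_free_chains[where m = b and I = I1, OF b] b])
  have 2: "evaluate (\<lambda>j. evaluate u (adjoint_matrix G I1 a j)) (a i)
      = evaluate u (extend G (adjoint_matrix G I1 a) (a i))"
    by (rule evaluate_evaluate[OF a[OF i] adjoint_matrix_in_free_chains[where m = a and I = I0, OF a]])
  show ?thesis
    unfolding laplace_step_def evaluate_chain_diff evaluate_chain_scale evaluate_chain_add ext_act_gen 1 2
    by (simp add: of_rat_divide)
qed

lemma laplace_step_in_free_chains:
  assumes a: "\<And>i. i \<in> I1 \<Longrightarrow> a i \<in> free_chains G I0" and b: "\<And>k. k \<in> I2 \<Longrightarrow> b k \<in> free_chains G I1"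
    and i: "i \<in> I1"
  shows "laplace_step G I1 I2 a b N i \<in> free_chains G I1"
proof -
  note F = submodD[OF submod_free_chains[OF is_group, of I1]]
  note S = submod_free_chains[OF is_group]
  show ?thesis unfolding laplace_step_def
    by (intro submod_diff[OF S] F(2) F(3) gen_in_free_chains[OF is_group] i
        ext_act_closed[OF is_group S b adjoint_matrix_in_free_chains[where m = b and I = I1, OF b]]
        ext_act_closed[OF is_group S adjoint_matrix_in_free_chains[where m = a and I = I0, OF a] a])
qed

text \<open>Let \<open>\<Delta> = B\<^sup>*B + AA\<^sup>*\<close>. Then \<open>\<langle>\<Delta>u, u\<rangle> = \<parallel>A\<^sup>*u\<parallel>\<^sup>2 + \<parallel>Bu\<parallel>\<^sup>2\<close>, called \<open>h u\<close> in the proof, and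
  \<open>\<parallel>\<Delta>u\<parallel>\<^sup>2 \<le> 2M\<^sup>2 h u\<close> if \<open>M\<close> bounds the norms of \<open>A\<close> and \<open>B\<^sup>*\<close>. So \<open>N \<ge> 2M\<^sup>2\<close> yields
  \<open>\<parallel>u - \<Delta>u/N\<parallel>\<^sup>2 = \<parallel>u\<parallel>\<^sup>2 - 2 h u / N + \<parallel>\<Delta>u\<parallel>\<^sup>2/N\<^sup>2 \<le> \<parallel>u\<parallel>\<^sup>2 - h u / N\<close>, without spectral theory.\<close>

lemma coercive_imp_contraction:
  fixes a :: "'i1 \<Rightarrow> ('i0, 'g) chain" and b :: "'i2 \<Rightarrow> ('i1, 'g) chain"
  assumes fin: "finite I0" "finite I1" "finite I2"
    and a: "\<And>i. i \<in> I1 \<Longrightarrow> a i \<in> free_chains G I0" and b: "\<And>k. k \<in> I2 \<Longrightarrow> b k \<in> free_chains G I1"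
    and coercive: "K > 0" "\<And>u. l2norm I1 u \<le>
      K * (l2norm I0 (\<lambda>i. evaluate u (adjoint_matrix G I1 a i)) + l2norm I2 (\<lambda>k. evaluate u (b k)))"
  shows "\<exists>N r. N > 0 \<and> 0 \<le> r \<and> r < 1 \<and>
     (\<forall>u. l2norm I1 (\<lambda>i. evaluate u (laplace_step G I1 I2 a b N i)) \<le> r * l2norm I1 u)"
proof -
  define As where "As u = (\<lambda>i. evaluate u (adjoint_matrix G I1 a i))" for u :: "'i1 \<Rightarrow> 'v"
  define B where "B u = (\<lambda>k. evaluate u (b k))" for u :: "'i1 \<Rightarrow> 'v"
  define L1 where "L1 u = (\<lambda>i. evaluate (B u) (adjoint_matrix G I2 b i))" for u
  define L2 where "L2 u = (\<lambda>i. evaluate (As u) (a i))" for u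
  from evaluate_bounded[OF fin(1,2) a] obtain C1 where
    "C1 \<ge> 0 \<and> (\<forall>x. l2norm I1 (\<lambda>i. evaluate x (a i)) \<le> C1 * l2norm I0 x)" ..
  then have C1: "C1 \<ge> 0" "\<And>u. l2norm I1 (L2 u) \<le> C1 * l2norm I0 (As u)" by (simp_all add: L2_def)
  from evaluate_bounded[OF fin(3,2) adjoint_matrix_in_free_chains[where m = b and I = I1, OF b]] obtain C2 where
    "C2 \<ge> 0 \<and> (\<forall>y. l2norm I1 (\<lambda>i. evaluate y (adjoint_matrix G I2 b i)) \<le> C2 * l2norm I2 y)" ..
  then have C2: "C2 \<ge> 0" "\<And>u. l2norm I1 (L1 u) \<le> C2 * l2norm I2 (B u)" by (simp_all add: L1_def)
  define M where "M = max C1 C2"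
  obtain N0 :: nat where N0: "2 * M\<^sup>2 \<le> real N0" using real_arch_simple by blast
  define N where "N = Suc N0"
  have N: "N > 0" "2 * M\<^sup>2 \<le> real N" using N0 by (simp_all add: N_def)
  define h where "h u = (l2norm I0 (As u))\<^sup>2 + (l2norm I2 (B u))\<^sup>2" for u
  have sq2: "(x + y)\<^sup>2 \<le> 2 * (x\<^sup>2 + y\<^sup>2)" for x y :: real
    using zero_le_power2[of "x - y"] by (simp add: power2_sum power2_diff)
  have inner: "l2inner I1 u (L1 u + L2 u) = h u" for u
  proof -
    have "l2inner I1 u (L1 u + L2 u) = l2inner I1 u (L1 u) + l2inner I1 u (L2 u)"
      by (simp only: l2inner_commute[of I1 u] l2inner_simps)
    also have "l2inner I1 u (L1 u) = l2inner I2 (B u) (B u)"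
      unfolding L1_def using adjoint_matrix[where u = u and v = "B u", OF fin(2) b] by (simp only: B_def)
    also have "l2inner I1 u (L2 u) = l2inner I1 (L2 u) u" by (rule l2inner_commute)
    also have "\<dots> = l2inner I0 (As u) (As u)"
      unfolding L2_def using adjoint_matrix[where u = "As u" and v = u, OF fin(1) a] by (simp only: As_def)
    finally show ?thesis by (simp add: h_def l2inner_self plus_fun_def)
  qed
  have L_bound: "(l2norm I1 (L1 u + L2 u))\<^sup>2 \<le> real N * h u" for u
  proof -
    have nn: "l2norm I0 (As u) \<ge> 0" "l2norm I2 (B u) \<ge> 0" by (rule l2norm_nonneg)+
    have "l2norm I1 (L1 u + L2 u) \<le> l2norm I1 (L1 u) + l2norm I1 (L2 u)"
      by (rule l2norm_triangle)
    also have "\<dots> \<le> M * l2norm I2 (B u) + M * l2norm I0 (As u)"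
      using C1(2)[of u] C2(2)[of u] mult_right_mono[OF max.cobounded1[of C1 C2] nn(1)]
        mult_right_mono[OF max.cobounded2[of C2 C1] nn(2)] by (simp add: M_def)
    finally have "(l2norm I1 (L1 u + L2 u))\<^sup>2 \<le> (M * (l2norm I0 (As u) + l2norm I2 (B u)))\<^sup>2"
      using l2norm_nonneg by (intro power_mono) (simp_all add: algebra_simps)
    also have "\<dots> = M\<^sup>2 * (l2norm I0 (As u) + l2norm I2 (B u))\<^sup>2" by (simp add: power_mult_distrib)
    also have "\<dots> \<le> M\<^sup>2 * (2 * h u)"
      unfolding h_def by (intro mult_left_mono sq2) simp
    also have "\<dots> = 2 * M\<^sup>2 * h u" by simp
    also have "\<dots> \<le> real N * h u" using N(2) by (intro mult_right_mono) (simp_all add: h_def)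
    finally show ?thesis .
  qed
  define c where "c = 1 / (2 * K\<^sup>2 * real N)"
  have c: "c > 0" using coercive(1) N(1) by (simp add: c_def)
  have h_bound: "c * (l2norm I1 u)\<^sup>2 \<le> h u / real N" for u
  proof -
    have "(l2norm I1 u)\<^sup>2 \<le> (K * (l2norm I0 (As u) + l2norm I2 (B u)))\<^sup>2"
      unfolding As_def B_def by (rule power_mono[OF coercive(2) l2norm_nonneg])
    also have "\<dots> \<le> K\<^sup>2 * (2 * h u)"
      unfolding power_mult_distrib h_def by (intro mult_left_mono sq2) simp
    finally show ?thesis using coercive(1) N(1) by (simp add: c_def field_simps)
  qed
  define r where "r = sqrt (max 0 (1 - c))"
  have r: "0 \<le> r" "r < 1" using c by (simp_all add: r_def)
  have "l2norm I1 (\<lambda>i. evaluate u (laplace_step G I1 I2 a b N i)) \<le> r * l2norm I1 u" for u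
  proof (rule power2_le_imp_le)
    have "l2norm I1 (\<lambda>i. evaluate u (laplace_step G I1 I2 a b N i)) = l2norm I1 (u + (- (1 / real N)) *\<^sub>R (L1 u + L2 u))"
      by (rule l2norm_cong) (simp add: evaluate_laplace_step[OF a b] L1_def L2_def As_def B_def)
    also have "\<dots>\<^sup>2 = (l2norm I1 u)\<^sup>2 + 2 * (- (1 / real N)) * h u + (- (1 / real N))\<^sup>2 * (l2norm I1 (L1 u + L2 u))\<^sup>2"
      unfolding l2norm_add_scaleR_sq inner ..
    also have "\<dots> \<le> (l2norm I1 u)\<^sup>2 + 2 * (- (1 / real N)) * h u + (- (1 / real N))\<^sup>2 * (real N * h u)"
      by (intro add_left_mono mult_left_mono L_bound) simp
    also have "\<dots> = (l2norm I1 u)\<^sup>2 - h u / real N"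
      using N(1) by (simp add: power2_eq_square field_simps)
    also have "\<dots> \<le> (1 - c) * (l2norm I1 u)\<^sup>2" using h_bound[of u] by (simp add: algebra_simps)
    also have "\<dots> \<le> max 0 (1 - c) * (l2norm I1 u)\<^sup>2" by (intro mult_right_mono) auto
    also have "\<dots> = (r * l2norm I1 u)\<^sup>2" by (simp add: r_def power_mult_distrib)
    finally show "(l2norm I1 (\<lambda>i. evaluate u (laplace_step G I1 I2 a b N i)))\<^sup>2 \<le> (r * l2norm I1 u)\<^sup>2" .
    show "0 \<le> r * l2norm I1 u" using r(1) l2norm_nonneg[of I1 u] by simp
  qed
  then show ?thesis using N(1) r by blast
qed

section \<open>Weak containment\<close>

lemma evaluate_single_bounded_linear:
  assumes x: "x \<in> free_chains G I"
  shows "bounded_linear (\<lambda>v. evaluate (\<lambda>i. if i = j then v else 0) x)"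
  unfolding evaluate_eq
proof (rule bounded_linear_sum)
  fix k assume "k \<in> supp x"
  then have k: "snd k \<in> carrier G" using key_carrier[OF x] by blast
  have "bounded_linear (\<lambda>v :: 'v. if fst k = j then v else 0)"
    by (cases "fst k = j") (simp_all add: bounded_linear_ident bounded_linear_zero)
  from bounded_linear_compose[OF rep_bounded_linear[OF k] this]
  show "bounded_linear (\<lambda>v. of_rat (coef x k) *\<^sub>R \<pi> (snd k) (if fst k = j then v else 0))"
    by (rule bounded_linear_compose[OF bounded_linear_scaleR_right])
qed

text \<open>An entry of a matrix, as a function on the group, acts as the corresponding block of the operator.\<close>

lemma l1_operator_eq_evaluate:
  assumes x: "x \<in> free_chains G I"
  shows "l1_operator G \<pi> (\<lambda>g. of_real (of_rat (coef x (j, g)))) v = evaluate (\<lambda>i. if i = j then v else 0) x"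
proof -
  define S where "S = {g. (j, g) \<in> supp x}"
  have S: "S = snd ` {k \<in> supp x. fst k = j}" unfolding S_def by force
  have finS: "finite S" unfolding S by simp
  have SG: "S \<subseteq> carrier G" using x by (auto simp: S_def free_chains_def)
  have "l1_operator G \<pi> (\<lambda>g. of_real (of_rat (coef x (j, g)))) v
      = (\<Sum>\<^sub>\<infinity>g\<in>carrier G. of_rat (coef x (j, g)) *\<^sub>R \<pi> g v)"
    by (simp add: l1_operator_def scaleC_of_real)
  also have "\<dots> = (\<Sum>\<^sub>\<infinity>g\<in>S. of_rat (coef x (j, g)) *\<^sub>R \<pi> g v)"
    using SG by (intro infsum_cong_neutral) (auto simp: S_def in_keys_iff)
  also have "\<dots> = (\<Sum>g\<in>S. of_rat (coef x (j, g)) *\<^sub>R \<pi> g v)"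
    by (rule infsum_finite[OF finS])
  also have "\<dots> = (\<Sum>k\<in>{k \<in> supp x. fst k = j}. of_rat (coef x k) *\<^sub>R \<pi> (snd k) v)"
    unfolding S by (subst sum.reindex) (auto simp: inj_on_def intro!: sum.cong)
  also have "\<dots> = (\<Sum>k\<in>supp x. of_rat (coef x k) *\<^sub>R \<pi> (snd k) (if fst k = j then v else 0))"
  proof (rule sum.mono_neutral_cong_left)
    have "\<pi> (snd k) 0 = 0" if "k \<in> supp x" for k
      using rep_add[of "snd k" 0 0] key_carrier[OF x that] by simp
    then show "\<forall>k\<in>supp x - {k \<in> supp x. fst k = j}.
        of_rat (coef x k) *\<^sub>R \<pi> (snd k) (if fst k = j then v else 0) = 0" by simp
  qed auto
  finally show ?thesis unfolding evaluate_eq .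
qed

end

lemma finitely_supported_l1:
  assumes "x \<in> free_chains G I"
  shows "(\<lambda>g. of_real (of_rat (coef x (j, g)))) \<in> l1_functions G"
proof -
  define S where "S = {g \<in> carrier G. (j, g) \<in> supp x}"
  have "S \<subseteq> snd ` supp x" unfolding S_def by force
  then have "finite S" by (rule finite_subset) simp
  then have "(\<lambda>g. norm (of_real (of_rat (coef x (j, g))) :: complex)) summable_on S" by simp
  then have "(\<lambda>g. norm (of_real (of_rat (coef x (j, g))) :: complex)) summable_on carrier G"
    by (rule summable_on_cong_neutral[THEN iffD1, rotated -1]) (auto simp: S_def in_keys_iff)
  then show ?thesis by (simp add: l1_functions_def)
qed

lemma weak_containment_entry_bound:
  assumes \<sigma>: "unitary_representation G \<sigma>" and \<pi>: "unitary_representation G \<pi>" and wc: "weakly_contains G \<pi> \<sigma>"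
    and x: "x \<in> free_chains G I" and r: "0 \<le> r"
    and bound: "\<And>v. norm (ext_act scale_rat \<pi> (\<lambda>i. if i = j then v else 0) x) \<le> r * norm v"
  shows "norm (ext_act scale_rat \<sigma> (\<lambda>i. if i = j then w else 0) x) \<le> r * norm w"
proof -
  let ?f = "\<lambda>g. of_real (of_rat (coef x (j, g))) :: complex"
  note eq\<pi> = unitary_representation.l1_operator_eq_evaluate[OF \<pi> x]
  note eq\<sigma> = unitary_representation.l1_operator_eq_evaluate[OF \<sigma> x]
  have "onorm (l1_operator G \<sigma> ?f) \<le> onorm (l1_operator G \<pi> ?f)"
    using wc finitely_supported_l1[OF x] by (simp add: weakly_contains_def)
  also have "\<dots> \<le> r" by (rule onorm_bound[OF r]) (simp add: eq\<pi> bound)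
  finally have le: "onorm (l1_operator G \<sigma> ?f) \<le> r" .
  have "bounded_linear (l1_operator G \<sigma> ?f)"
    unfolding eq\<sigma> by (rule unitary_representation.evaluate_single_bounded_linear[OF \<sigma> x])
  from onorm[OF this, of w] have "norm (l1_operator G \<sigma> ?f w) \<le> onorm (l1_operator G \<sigma> ?f) * norm w" .
  also have "\<dots> \<le> r * norm w" using le by (rule mult_right_mono) simp
  finally show ?thesis by (simp add: eq\<sigma>)
qed

primrec matrix_power :: "('g, 'x) monoid_scheme \<Rightarrow> ('i \<Rightarrow> ('i, 'g) chain) \<Rightarrow> nat \<Rightarrow> 'i \<Rightarrow> ('i, 'g) chain" where
  "matrix_power G T 0 = (\<lambda>i. gen G i)"
| "matrix_power G T (Suc n) = (\<lambda>i. extend G (matrix_power G T n) (T i))"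

lemma matrix_power_in_free_chains:
  assumes G: "group G" and T: "\<And>i. i \<in> I \<Longrightarrow> T i \<in> free_chains G I" and i: "i \<in> I"
  shows "matrix_power G T n i \<in> free_chains G I"
  using i
proof (induction n arbitrary: i)
  case 0 then show ?case by (simp add: gen_in_free_chains[OF G])
next
  case (Suc n)
  show ?case unfolding matrix_power.simps
    by (rule ext_act_closed[OF G submod_free_chains[OF G] Suc.IH T[OF Suc.prems]])
qed

lemma (in unitary_representation) evaluate_matrix_power_Suc:
  assumes T: "\<And>i. i \<in> I \<Longrightarrow> T i \<in> free_chains G I" and i: "i \<in> I"
  shows "evaluate u (matrix_power G T (Suc n) i) = evaluate (\<lambda>j. evaluate u (matrix_power G T n j)) (T i)"
  unfolding matrix_power.simps
  by (rule evaluate_evaluate[symmetric, OF T[OF i] matrix_power_in_free_chains[OF is_group T]])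

text \<open>Let \<open>T\<close> be the matrix \<open>laplace_step\<close>. Each entry of \<open>T\<^sup>n\<close> has norm at most \<open>r\<^sup>n\<close> under \<open>\<pi>\<close>, hence under \<open>\<sigma>\<close>, so
  that \<open>s = \<Sum> T\<^sup>n w\<close> converges. Every \<open>T\<^sup>n w\<close>, and so \<open>s\<close>, lies in the kernel of \<open>B\<close>, because \<open>Bw = 0\<close> and \<open>BA = 0\<close>.
  Therefore \<open>w = s - Ts = (B\<^sup>*B + AA\<^sup>*)s/N = A(A\<^sup>*s/N)\<close>.\<close>

lemma weak_containment_exactness:
  fixes a :: "'i1 \<Rightarrow> ('i0, 'g) chain" and b :: "'i2 \<Rightarrow> ('i1, 'g) chain"
    and G :: "('g, 'x) monoid_scheme"
    and \<sigma> :: "'g \<Rightarrow> 'w::complex_hilbert_space \<Rightarrow> 'w" and \<pi> :: "'g \<Rightarrow> 'v::complex_hilbert_space \<Rightarrow> 'v"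
  assumes \<sigma>: "unitary_representation G \<sigma>" and \<pi>: "unitary_representation G \<pi>" and wc: "weakly_contains G \<pi> \<sigma>"
    and fin: "finite I1"
    and a: "\<And>i. i \<in> I1 \<Longrightarrow> a i \<in> free_chains G I0" and b: "\<And>k. k \<in> I2 \<Longrightarrow> b k \<in> free_chains G I1"
    and ba: "\<And>x k. k \<in> I2 \<Longrightarrow> ext_act scale_rat \<sigma> (\<lambda>i. ext_act scale_rat \<sigma> x (a i)) (b k) = 0"
    and N: "N > 0" and r: "0 \<le> r" "r < 1"
    and contraction: "\<And>u. l2norm I1 (\<lambda>i. ext_act scale_rat \<pi> u (laplace_step G I1 I2 a b N i)) \<le> r * l2norm I1 u"
    and w: "\<And>k. k \<in> I2 \<Longrightarrow> ext_act scale_rat \<sigma> w (b k) = 0"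
  shows "\<exists>x. \<forall>i\<in>I1. w i = ext_act scale_rat \<sigma> x (a i)"
proof -
  interpret S: unitary_representation G \<sigma> by fact
  interpret P: unitary_representation G \<pi> by fact
  let ?T = "laplace_step G I1 I2 a b N"
  have T: "?T i \<in> free_chains G I1" if "i \<in> I1" for i by (rule S.laplace_step_in_free_chains[OF a b that])
  have Tn: "matrix_power G ?T n i \<in> free_chains G I1" if "i \<in> I1" for n i
    using that by (intro matrix_power_in_free_chains[OF S.is_group] T)
  have T_eval: "S.evaluate u (?T i) = u i - (1 / real N) *\<^sub>R
      (S.evaluate (\<lambda>k. S.evaluate u (b k)) (adjoint_matrix G I2 b i)
       + S.evaluate (\<lambda>j. S.evaluate u (adjoint_matrix G I1 a j)) (a i))" if "i \<in> I1" for u i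
    by (rule S.evaluate_laplace_step[OF a b that])
  have P_power: "l2norm I1 (\<lambda>i. P.evaluate u (matrix_power G ?T n i)) \<le> r ^ n * l2norm I1 u" for u n
  proof (induction n)
    case 0
    then show ?case by (simp add: P.act_one)
  next
    case (Suc n)
    have "l2norm I1 (\<lambda>i. P.evaluate u (matrix_power G ?T (Suc n) i))
        = l2norm I1 (\<lambda>i. P.evaluate (\<lambda>j. P.evaluate u (matrix_power G ?T n j)) (?T i))"
      by (rule l2norm_cong) (rule P.evaluate_matrix_power_Suc[OF T])
    also have "\<dots> \<le> r * l2norm I1 (\<lambda>j. P.evaluate u (matrix_power G ?T n j))" by (rule contraction)
    also have "\<dots> \<le> r * (r ^ n * l2norm I1 u)" by (rule mult_left_mono[OF Suc r(1)])
    finally show ?case by (simp add: mult.assoc)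
  qed
  have P_entry: "norm (P.evaluate (\<lambda>i. if i = j then v else 0) (matrix_power G ?T n i)) \<le> r ^ n * norm v"
    if i: "i \<in> I1" and j: "j \<in> I1" for i j n v
  proof -
    have "norm (P.evaluate (\<lambda>i. if i = j then v else 0) (matrix_power G ?T n i))
        \<le> l2norm I1 (\<lambda>i. P.evaluate (\<lambda>i. if i = j then v else 0) (matrix_power G ?T n i))"
      by (rule norm_le_l2norm[OF fin i])
    also have "\<dots> \<le> r ^ n * l2norm I1 (\<lambda>i. if i = j then v else 0)" by (rule P_power)
    also have "l2norm I1 (\<lambda>i. if i = j then v else 0) \<le> (\<Sum>i\<in>I1. norm (if i = j then v else 0))"
      by (rule l2norm_le_sum)
    also have "\<dots> = norm v" using fin j by (simp add: if_distrib[of norm] cong: if_cong)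
    finally show ?thesis using r(1) by (simp add: mult_left_mono)
  qed
  define C where "C = (\<Sum>j\<in>I1. norm (w j))"
  have S_bound: "norm (S.evaluate w (matrix_power G ?T n i)) \<le> C * r ^ n" if i: "i \<in> I1" for i n
  proof -
    have "S.evaluate w (matrix_power G ?T n i)
        = S.evaluate (\<lambda>i'. \<Sum>j\<in>I1. if i' = j then w j else 0) (matrix_power G ?T n i)"
      by (rule S.evaluate_cong[OF Tn[OF i]]) (use fin in simp)
    also have "\<dots> = (\<Sum>j\<in>I1. S.evaluate (\<lambda>i'. if i' = j then w j else 0) (matrix_power G ?T n i))"
      by (rule S.evaluate_sum[OF Tn[OF i]])
    also have "norm \<dots> \<le> (\<Sum>j\<in>I1. r ^ n * norm (w j))"
    proof (rule sum_norm_le)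
      fix j assume j: "j \<in> I1"
      show "norm (S.evaluate (\<lambda>i'. if i' = j then w j else 0) (matrix_power G ?T n i)) \<le> r ^ n * norm (w j)"
        by (rule weak_containment_entry_bound[OF \<sigma> \<pi> wc Tn[OF i] zero_le_power[OF r(1)] P_entry[OF i j]])
    qed
    finally show ?thesis by (simp add: C_def sum_distrib_left mult.commute)
  qed
  define v where "v n = (\<lambda>i. S.evaluate w (matrix_power G ?T n i))" for n
  define s where "s i = suminf (\<lambda>n. v n i)" for i
  have sums: "(\<lambda>n. v n i) sums s i" if i: "i \<in> I1" for i
  proof -
    have "summable (\<lambda>n. C * r ^ n)" using r by (intro summable_mult summable_geometric) simp
    then have "summable (\<lambda>n. v n i)"
      by (rule summable_comparison_test') (use S_bound[OF i] in \<open>simp add: v_def\<close>)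
    then show ?thesis unfolding s_def by (rule summable_sums)
  qed
  have v0: "v 0 = w" by (simp add: v_def)
  have vS: "v (Suc n) i = S.evaluate (v n) (?T i)" if "i \<in> I1" for n i
    unfolding v_def by (rule S.evaluate_matrix_power_Suc[OF T that])
  have vB: "S.evaluate (v n) (b k) = 0" if k: "k \<in> I2" for n k
    using k
  proof (induction n arbitrary: k)
    case 0 then show ?case by (simp only: v0 w)
  next
    case (Suc n)
    define y where "y = (\<lambda>j. S.evaluate (v n) (adjoint_matrix G I1 a j))"
    have "v (Suc n) i = (v n - (1 / real N) *\<^sub>R (\<lambda>i. S.evaluate y (a i))) i" if i: "i \<in> I1" for i
    proof -
      have "S.evaluate (\<lambda>k. S.evaluate (v n) (b k)) (adjoint_matrix G I2 b i) = 0"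
        by (rule S.evaluate_zero[OF S.adjoint_matrix_in_free_chains[where m = b and I = I1, OF b] Suc.IH])
      then show ?thesis unfolding vS[OF i] T_eval[OF i] by (simp add: y_def)
    qed
    then have "S.evaluate (v (Suc n)) (b k) = S.evaluate (v n - (1 / real N) *\<^sub>R (\<lambda>i. S.evaluate y (a i))) (b k)"
      by (rule S.evaluate_cong[OF b[OF Suc.prems]])
    also have "\<dots> = 0"
      unfolding S.evaluate_diff[OF b[OF Suc.prems]] S.evaluate_scaleR[OF b[OF Suc.prems]]
      by (simp add: Suc.IH[OF Suc.prems] ba[OF Suc.prems])
    finally show ?case .
  qed
  have sB: "S.evaluate s (b k) = 0" if k: "k \<in> I2" for k
  proof -
    have "(\<lambda>n. S.evaluate (v n) (b k)) sums S.evaluate s (b k)" by (rule S.evaluate_sums[OF b[OF k] sums])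
    then show ?thesis using vB[OF k] sums_unique2[OF _ sums_zero] by simp
  qed
  define x where "x = (1 / real N) *\<^sub>R (\<lambda>j. S.evaluate s (adjoint_matrix G I1 a j))"
  have "w i = S.evaluate x (a i)" if i: "i \<in> I1" for i
  proof -
    have "(\<lambda>n. v (Suc n) i) sums S.evaluate s (?T i)"
      unfolding vS[OF i] by (rule S.evaluate_sums[OF T[OF i] sums])
    moreover have "(\<lambda>n. v (Suc n) i) sums (s i - w i)"
      using sums[OF i] sums_Suc_iff[of "\<lambda>n. v n i" "s i - w i"] by (simp add: v0)
    ultimately have "S.evaluate s (?T i) = s i - w i" by (rule sums_unique2)
    moreover have "S.evaluate (\<lambda>k. S.evaluate s (b k)) (adjoint_matrix G I2 b i) = 0"
      by (rule S.evaluate_zero[OF S.adjoint_matrix_in_free_chains[where m = b and I = I1, OF b] sB])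
    ultimately show ?thesis
      unfolding x_def S.evaluate_scaleR[OF a[OF i]] T_eval[OF i] by simp
  qed
  then show ?thesis by blast
qed

section \<open>Cohomology of a finite resolution by matrices\<close>

lemma (in unitary_representation) evaluate_comp_hom:
  assumes f: "chain_hom G (free_chains G I) (free_chains G J) f" and x: "x \<in> free_chains G I"
  shows "evaluate (\<lambda>i. evaluate u (f (gen G i))) x = evaluate u (f x)"
  using equivariant_eq_ext_act[OF equivariant_on_comp[OF f ext_act_equivariant] x] by simp

lemma (in unitary_representation) evaluate_tendsto:
  assumes x: "x \<in> free_chains G I" and u: "\<And>i. i \<in> I \<Longrightarrow> (\<lambda>n. u n i) \<longlonglongrightarrow> s i"
  shows "(\<lambda>n. evaluate (u n) x) \<longlonglongrightarrow> evaluate s x"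
  unfolding evaluate_eq
proof (rule tendsto_sum)
  fix k assume "k \<in> supp x"
  from key_carrier[OF x this] have k: "fst k \<in> I" "snd k \<in> carrier G" by auto
  from bounded_linear.tendsto[OF rep_bounded_linear[OF k(2)] u[OF k(1)]]
  show "(\<lambda>n. of_rat (coef x k) *\<^sub>R \<pi> (snd k) (u n (fst k))) \<longlonglongrightarrow>
        of_rat (coef x k) *\<^sub>R \<pi> (snd k) (s (fst k))"
    by (rule tendsto_scaleR[OF tendsto_const])
qed

text \<open>The matrices of the complex in degree \<open>q\<close>. A family \<open>u\<close> of values on the generators of
  \<open>X (Suc q)\<close> need not come from an equivariant map on this module; it does if it is unchanged by the retraction. The \<open>Inr\<close>
  block of \<open>row_out\<close> imposes this condition, and the \<open>Inl\<close> block is the differential out of degree \<open>q\<close>. So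
  the cocycles in degree \<open>q\<close> are the kernel of \<open>row_out\<close> and the coboundaries are the range of \<open>row_in\<close>.\<close>

locale resolution_coefficients = resolution G I X E D \<epsilon> + unitary_representation G \<pi>
  for G :: "('g, 'x) monoid_scheme" (structure) and I :: "nat \<Rightarrow> 'i set"
    and X E D \<epsilon> and \<pi> :: "'g \<Rightarrow> 'v::complex_hilbert_space \<Rightarrow> 'v" +
  fixes q :: nat
begin

definition "row_in i = D q (E (Suc q) (gen G i))"

definition "row_out t = (case t of Inl k \<Rightarrow> D (Suc q) (E (Suc (Suc q)) (gen G k)) | Inr j \<Rightarrow> gen G j - E (Suc q) (gen G j))"

lemma E_free_hom: "chain_hom G (free_chains G (I n)) (free_chains G (I n)) (E n)"
  using E_hom[of n] X_free[of n] by (auto simp: chain_hom_def)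

lemma DE_hom: "chain_hom G (free_chains G (I (Suc n))) (X n) (\<lambda>x. D n (E (Suc n) x))"
  by (rule chain_hom_comp[OF E_hom D_hom])

lemma DE_free_hom: "chain_hom G (free_chains G (I (Suc n))) (free_chains G (I n)) (\<lambda>x. D n (E (Suc n) x))"
  using DE_hom[of n] X_free[of n] by (auto simp: chain_hom_def)

lemma gen_in: "i \<in> I n \<Longrightarrow> gen G i \<in> free_chains G (I n)"
  by (rule gen_in_free_chains[OF is_group])

lemma E_gen: "i \<in> I n \<Longrightarrow> E n (gen G i) \<in> X n"
  by (rule chain_homD(4)[OF E_hom gen_in])

lemma row_in_X: "i \<in> I (Suc q) \<Longrightarrow> row_in i \<in> X q"
  unfolding row_in_def by (rule chain_homD(4)[OF D_hom E_gen])

lemma row_in_free: "i \<in> I (Suc q) \<Longrightarrow> row_in i \<in> free_chains G (I q)"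
  using row_in_X X_free by blast

lemma row_out_free:
  assumes "t \<in> I (Suc (Suc q)) <+> I (Suc q)"
  shows "row_out t \<in> free_chains G (I (Suc q))"
proof (cases t)
  case (Inl k)
  then have "k \<in> I (Suc (Suc q))" using assms by auto
  then show ?thesis using Inl chain_homD(4)[OF D_hom E_gen] X_free by (auto simp: row_out_def)
next
  case (Inr j)
  then have j: "j \<in> I (Suc q)" using assms by auto
  have "E (Suc q) (gen G j) \<in> free_chains G (I (Suc q))" using E_gen[OF j] X_free by blast
  then show ?thesis using Inr submod_diff[OF submod_free_chains[OF is_group] gen_in[OF j]] by (simp add: row_out_def)
qed

lemma equivariant_eq_evaluate:
  assumes z: "equivariant (X n) z" and x: "x \<in> X n"
  shows "z x = evaluate (\<lambda>i. z (E n (gen G i))) x"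
proof -
  have "x \<in> free_chains G (I n)" using x X_free by blast
  from equivariant_eq_ext_act[OF equivariant_on_comp[OF E_hom z] this] show ?thesis by (simp add: E_id[OF x])
qed

lemma evaluate_equivariant: "equivariant (X n) (evaluate u)"
  by (rule equivariant_on_subset[OF ext_act_equivariant X_free])

lemma evaluate_row_in:
  assumes x: "x \<in> X (Suc q)"
  shows "evaluate (\<lambda>i. evaluate u (row_in i)) x = evaluate u (D q x)"
proof -
  have "x \<in> free_chains G (I (Suc q))" using x X_free by blast
  from evaluate_comp_hom[OF DE_free_hom this] show ?thesis by (simp add: row_in_def E_id[OF x])
qed

lemma evaluate_row_out_Inl:
  assumes x: "x \<in> X (Suc (Suc q))"
  shows "evaluate (\<lambda>k. evaluate u (row_out (Inl k))) x = evaluate u (D (Suc q) x)"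
proof -
  have "x \<in> free_chains G (I (Suc (Suc q)))" using x X_free by blast
  from evaluate_comp_hom[OF DE_free_hom this] show ?thesis by (simp add: row_out_def E_id[OF x])
qed

lemma evaluate_row_out_Inr:
  assumes x: "x \<in> X (Suc q)"
  shows "evaluate (\<lambda>j. evaluate u (row_out (Inr j))) x = 0"
proof -
  have xf: "x \<in> free_chains G (I (Suc q))" using x X_free by blast
  have "evaluate (\<lambda>j. evaluate u (row_out (Inr j))) x
      = evaluate (u - (\<lambda>j. evaluate u (E (Suc q) (gen G j)))) x"
    by (rule evaluate_cong[OF xf]) (simp add: row_out_def evaluate_chain_diff)
  also have "\<dots> = 0"
    unfolding evaluate_diff[OF xf] evaluate_comp_hom[OF E_free_hom xf] by (simp add: E_id[OF x])
  finally show ?thesis .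
qed

lemma row_out_row_in:
  assumes t: "t \<in> I (Suc (Suc q)) <+> I (Suc q)"
  shows "evaluate (\<lambda>i. evaluate u (row_in i)) (row_out t) = 0"
proof -
  have Y: "evaluate (\<lambda>i. evaluate u (row_in i)) y = evaluate u (D q (E (Suc q) y))" if "y \<in> free_chains G (I (Suc q))" for y
    unfolding row_in_def by (rule evaluate_comp_hom[OF DE_free_hom that])
  have "D q (E (Suc q) (row_out t)) = 0"
  proof (cases t)
    case (Inl k)
    then have k: "k \<in> I (Suc (Suc q))" using t by auto
    have "D (Suc q) (E (Suc (Suc q)) (gen G k)) \<in> X (Suc q)" by (rule chain_homD(4)[OF D_hom E_gen[OF k]])
    then show ?thesis using Inl D_D[OF E_gen[OF k]] by (simp add: row_out_def E_id)
  next
    case (Inr j)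
    then have j: "j \<in> I (Suc q)" using t by auto
    have Ej: "E (Suc q) (gen G j) \<in> free_chains G (I (Suc q))" using E_gen[OF j] X_free by blast
    have "E (Suc q) (gen G j - E (Suc q) (gen G j)) = E (Suc q) (gen G j) - E (Suc q) (E (Suc q) (gen G j))"
      by (rule chain_hom_diff[OF E_hom submod_free_chains[OF is_group] gen_in[OF j] Ej])
    also have "\<dots> = 0" by (simp add: E_id[OF E_gen[OF j]])
    finally show ?thesis using Inr chain_hom_zero[OF D_hom] by (simp add: row_out_def)
  qed
  then show ?thesis using Y[OF row_out_free[OF t]] by (simp add: ext_act_def)
qed

lemma exact_rows:
  assumes ex: "exact_at G scale_rat \<pi> X D q"
    and u: "\<And>t. t \<in> I (Suc (Suc q)) <+> I (Suc q) \<Longrightarrow> evaluate u (row_out t) = 0"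
  shows "\<exists>x. \<forall>i\<in>I (Suc q). u i = evaluate x (row_in i)"
proof -
  have "evaluate u (D (Suc q) x) = 0" if x: "x \<in> X (Suc (Suc q))" for x
  proof -
    have xf: "x \<in> free_chains G (I (Suc (Suc q)))" using x X_free by blast
    show ?thesis
      unfolding evaluate_row_out_Inl[OF x, symmetric] by (rule evaluate_zero[OF xf]) (use u in auto)
  qed
  then obtain \<beta> where \<beta>: "equivariant (X q) \<beta>" "\<And>x. x \<in> X (Suc q) \<Longrightarrow> evaluate u x = \<beta> (D q x)"
    using ex evaluate_equivariant unfolding exact_at_def by blast
  have "u i = evaluate (\<lambda>i. \<beta> (E q (gen G i))) (row_in i)" if i: "i \<in> I (Suc q)" for i
  proof -
    have "evaluate u (row_out (Inr i)) = 0" using u i by auto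
    then have "u i = evaluate u (E (Suc q) (gen G i))" by (simp add: row_out_def evaluate_chain_diff)
    also have "\<dots> = \<beta> (row_in i)" unfolding row_in_def by (rule \<beta>(2)[OF E_gen[OF i]])
    also have "\<dots> = evaluate (\<lambda>i. \<beta> (E q (gen G i))) (row_in i)" by (rule equivariant_eq_evaluate[OF \<beta>(1) row_in_X[OF i]])
    finally show ?thesis .
  qed
  then show ?thesis by blast
qed

lemma rows_exact:
  assumes ex: "\<And>w. (\<And>t. t \<in> I (Suc (Suc q)) <+> I (Suc q) \<Longrightarrow> evaluate w (row_out t) = 0)
      \<Longrightarrow> \<exists>x. \<forall>i\<in>I (Suc q). w i = evaluate x (row_in i)"
  shows "exact_at G scale_rat \<pi> X D q"
  unfolding exact_at_def
proof (intro allI impI)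
  fix z assume z: "equivariant (X (Suc q)) z" and zD: "\<forall>x\<in>X (Suc (Suc q)). z (D (Suc q) x) = 0"
  define w where "w i = z (E (Suc q) (gen G i))" for i
  have zw: "z x = evaluate w x" if "x \<in> X (Suc q)" for x
    unfolding w_def by (rule equivariant_eq_evaluate[OF z that])
  have "evaluate w (row_out t) = 0" if t: "t \<in> I (Suc (Suc q)) <+> I (Suc q)" for t
  proof (cases t)
    case (Inl k)
    then have k: "k \<in> I (Suc (Suc q))" using t by auto
    show ?thesis using Inl zw[OF chain_homD(4)[OF D_hom E_gen[OF k]]] zD E_gen[OF k] by (simp add: row_out_def)
  next
    case (Inr j)
    then have j: "j \<in> I (Suc q)" using t by auto
    show ?thesis using Inr zw[OF E_gen[OF j]] by (simp add: row_out_def evaluate_chain_diff w_def)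
  qed
  from ex[OF this] obtain x where x: "\<forall>i\<in>I (Suc q). w i = evaluate x (row_in i)" by blast
  have "z y = evaluate x (D q y)" if y: "y \<in> X (Suc q)" for y
  proof -
    have yf: "y \<in> free_chains G (I (Suc q))" using y X_free by blast
    have "z y = evaluate (\<lambda>i. evaluate x (row_in i)) y"
      unfolding zw[OF y] by (rule evaluate_cong[OF yf]) (use x in blast)
    then show ?thesis by (simp only: evaluate_row_in[OF y])
  qed
  then show "\<exists>b. equivariant (X q) b \<and> (\<forall>x\<in>X (Suc q). z x = b (D q x))"
    using evaluate_equivariant[of q x] by blast
qed

text \<open>Let \<open>yl\<close> and \<open>yr\<close> be the two blocks of a limit \<open>y\<close> of values of \<open>row_out\<close>. As an equivariant map, \<open>yl\<close>
  is a pointwise limit of coboundaries in degree \<open>q + 1\<close>, hence a coboundary \<open>cD\<close>, whereas \<open>yr\<close>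
  vanishes on \<open>X (Suc q)\<close>, like the \<open>Inr\<close> block of every value. The sum of \<open>yr\<close> and the values of \<open>c\<close>
  on the generators is a preimage of \<open>y\<close>.\<close>

lemma closed_rows:
  assumes fin: "finite (I (Suc (Suc q)))" "finite (I (Suc q))"
    and cl: "closed_at G scale_rat \<pi> X D (Suc q)"
    and app: "\<And>e. e > 0 \<Longrightarrow> \<exists>u. l2norm (I (Suc (Suc q)) <+> I (Suc q)) (y - (\<lambda>t. evaluate u (row_out t))) < e"
  shows "\<exists>u. l2norm (I (Suc (Suc q)) <+> I (Suc q)) (y - (\<lambda>t. evaluate u (row_out t))) = 0"
proof -
  let ?J = "I (Suc (Suc q)) <+> I (Suc q)"
  have finJ: "finite ?J" using fin by (rule finite_Plus)
  have "\<forall>n. \<exists>u. l2norm ?J (y - (\<lambda>t. evaluate u (row_out t))) < 1 / real (Suc n)" using app by simp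
  then have "\<exists>u. \<forall>n. l2norm ?J (y - (\<lambda>t. evaluate (u n) (row_out t))) < 1 / real (Suc n)" by (rule choice)
  then obtain u where u: "\<And>n. l2norm ?J (y - (\<lambda>t. evaluate (u n) (row_out t))) < 1 / real (Suc n)" by blast
  have lim: "(\<lambda>n. evaluate (u n) (row_out t)) \<longlonglongrightarrow> y t" if t: "t \<in> ?J" for t
  proof -
    have le: "norm (evaluate (u n) (row_out t) - y t) \<le> 1 / real (Suc n)" for n
      using norm_le_l2norm[OF finJ t, of "y - (\<lambda>t. evaluate (u n) (row_out t))"] u[of n]
      by (simp add: norm_minus_commute)
    have "(\<lambda>n. 1 / real (Suc n)) \<longlonglongrightarrow> 0" by (rule LIMSEQ_Suc[OF lim_1_over_n])
    then have "(\<lambda>n. evaluate (u n) (row_out t) - y t) \<longlonglongrightarrow> 0"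
      by (rule Lim_null_comparison[rotated]) (use le in simp)
    then show ?thesis by (simp add: LIM_zero_iff)
  qed
  define yl where "yl k = y (Inl k)" for k
  define yr where "yr j = y (Inr j)" for j
  have lim_l: "(\<lambda>n. evaluate (u n) (D (Suc q) x)) \<longlonglongrightarrow> evaluate yl x" if x: "x \<in> X (Suc (Suc q))" for x
  proof -
    have xf: "x \<in> free_chains G (I (Suc (Suc q)))" using x X_free by blast
    have "(\<lambda>n. evaluate (\<lambda>k. evaluate (u n) (row_out (Inl k))) x) \<longlonglongrightarrow> evaluate yl x"
      by (rule evaluate_tendsto[OF xf]) (use lim in \<open>simp add: yl_def InlI\<close>)
    then show ?thesis by (simp only: evaluate_row_out_Inl[OF x])
  qed
  have lim_r: "evaluate yr x = 0" if x: "x \<in> X (Suc q)" for x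
  proof -
    have xf: "x \<in> free_chains G (I (Suc q))" using x X_free by blast
    have "(\<lambda>n. evaluate (\<lambda>k. evaluate (u n) (row_out (Inr k))) x) \<longlonglongrightarrow> evaluate yr x"
      by (rule evaluate_tendsto[OF xf]) (use lim in \<open>simp add: yr_def InrI\<close>)
    then show ?thesis by (simp add: evaluate_row_out_Inr[OF x] LIMSEQ_const_iff)
  qed
  have approx: "\<exists>b. equivariant (X (Suc q)) b \<and> (\<forall>x\<in>T. norm (evaluate yl x - b (D (Suc q) x)) < e)"
    if T: "finite T" "T \<subseteq> X (Suc (Suc q))" "e > 0" for T e
  proof -
    have "\<forall>\<^sub>F n in sequentially. \<forall>x\<in>T. norm (evaluate yl x - evaluate (u n) (D (Suc q) x)) < e"
    proof (rule eventually_ball_finite[OF T(1)], rule ballI)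
      fix x assume "x \<in> T"
      then have "(\<lambda>n. evaluate (u n) (D (Suc q) x)) \<longlonglongrightarrow> evaluate yl x" using lim_l T(2) by blast
      from tendstoD[OF this T(3)] show "\<forall>\<^sub>F n in sequentially. norm (evaluate yl x - evaluate (u n) (D (Suc q) x)) < e"
        by (simp add: dist_norm norm_minus_commute)
    qed
    then obtain n where "\<forall>x\<in>T. norm (evaluate yl x - evaluate (u n) (D (Suc q) x)) < e"
      by (auto simp: eventually_sequentially)
    then show ?thesis using evaluate_equivariant by blast
  qed
  have "\<exists>c. equivariant (X (Suc q)) c \<and> (\<forall>x\<in>X (Suc (Suc q)). evaluate yl x = c (D (Suc q) x))"
    using cl evaluate_equivariant approx unfolding closed_at_def by simp
  then obtain c where c: "equivariant (X (Suc q)) c"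
    "\<And>x. x \<in> X (Suc (Suc q)) \<Longrightarrow> evaluate yl x = c (D (Suc q) x)" by blast
  define v where "v = (\<lambda>j. c (E (Suc q) (gen G j))) + yr"
  have "evaluate v (row_out t) = y t" if t: "t \<in> ?J" for t
  proof (cases t)
    case (Inl k)
    then have k: "k \<in> I (Suc (Suc q))" using t by auto
    let ?x = "E (Suc (Suc q)) (gen G k)"
    have Dx: "D (Suc q) ?x \<in> X (Suc q)" by (rule chain_homD(4)[OF D_hom E_gen[OF k]])
    have Dxf: "D (Suc q) ?x \<in> free_chains G (I (Suc q))" using Dx X_free by blast
    have "evaluate v (row_out t) = evaluate (\<lambda>j. c (E (Suc q) (gen G j))) (D (Suc q) ?x) + evaluate yr (D (Suc q) ?x)"
      unfolding v_def Inl row_out_def sum.case by (rule evaluate_add[OF Dxf])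
    also have "\<dots> = c (D (Suc q) ?x)" using equivariant_eq_evaluate[OF c(1) Dx] lim_r[OF Dx] by simp
    also have "\<dots> = evaluate yl ?x" using c(2)[OF E_gen[OF k]] by simp
    also have "\<dots> = y t"
    proof (rule LIMSEQ_unique[OF lim_l[OF E_gen[OF k]]])
      show "(\<lambda>n. evaluate (u n) (D (Suc q) ?x)) \<longlonglongrightarrow> y t" using lim[OF t] by (simp add: Inl row_out_def)
    qed
    finally show ?thesis .
  next
    case (Inr j)
    then have j: "j \<in> I (Suc q)" using t by auto
    have Ef: "E (Suc q) (gen G j) \<in> free_chains G (I (Suc q))" using E_gen[OF j] X_free by blast
    have "evaluate v (E (Suc q) (gen G j)) = evaluate (\<lambda>j. c (E (Suc q) (gen G j))) (E (Suc q) (gen G j)) + evaluate yr (E (Suc q) (gen G j))"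
      unfolding v_def by (rule evaluate_add[OF Ef])
    also have "\<dots> = c (E (Suc q) (gen G j))"
      using equivariant_eq_evaluate[OF c(1) E_gen[OF j]] lim_r[OF E_gen[OF j]] by simp
    finally show ?thesis by (simp add: Inr row_out_def evaluate_chain_diff v_def yr_def)
  qed
  then show ?thesis by (intro exI[of _ v]) (simp add: l2norm_eq_0[OF finJ])
qed

end

lemma finite_resolution_weak_containment:
  assumes res: "resolution G I X E D \<epsilon>" and fin: "\<And>n. finite (I n)"
    and \<sigma>: "unitary_representation G \<sigma>" and \<pi>: "unitary_representation G \<pi>" and wc: "weakly_contains G \<pi> \<sigma>"
    and ex: "exact_at G scale_rat \<pi> X D q" and cl: "closed_at G scale_rat \<pi> X D (Suc q)"
  shows "exact_at G scale_rat \<sigma> X D q"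
proof -
  interpret P: resolution_coefficients G I X E D \<epsilon> \<pi> q
    using res \<pi> by (simp add: resolution_coefficients_def)
  interpret S: resolution_coefficients G I X E D \<epsilon> \<sigma> q
    using res \<sigma> by (simp add: resolution_coefficients_def)
  let ?J = "I (Suc (Suc q)) <+> I (Suc q)"
  have finJ: "finite ?J" using fin by (simp add: finite_Plus)
  have "\<exists>K>0. \<forall>u. l2norm (I (Suc q)) u \<le>
     K * (l2norm (I q) (\<lambda>i. P.evaluate u (adjoint_matrix G (I (Suc q)) P.row_in i)) + l2norm ?J (\<lambda>k. P.evaluate u (P.row_out k)))"
    by (rule P.exact_closed_imp_coercive[OF fin fin finJ P.row_in_free P.row_out_free P.row_out_row_in
          P.exact_rows[OF ex] P.closed_rows[OF fin fin cl]])
  then obtain K where K: "K > 0" "\<And>u. l2norm (I (Suc q)) u \<le>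
     K * (l2norm (I q) (\<lambda>i. P.evaluate u (adjoint_matrix G (I (Suc q)) P.row_in i)) + l2norm ?J (\<lambda>k. P.evaluate u (P.row_out k)))"
    by blast
  have "\<exists>N r. N > 0 \<and> 0 \<le> r \<and> r < 1 \<and>
     (\<forall>u. l2norm (I (Suc q)) (\<lambda>i. P.evaluate u (laplace_step G (I (Suc q)) ?J P.row_in P.row_out N i)) \<le> r * l2norm (I (Suc q)) u)"
    by (rule P.coercive_imp_contraction[OF fin fin finJ P.row_in_free P.row_out_free K])
  then obtain N r where Nr: "N > 0 \<and> 0 \<le> r \<and> r < 1 \<and>
     (\<forall>u. l2norm (I (Suc q)) (\<lambda>i. P.evaluate u (laplace_step G (I (Suc q)) ?J P.row_in P.row_out N i)) \<le> r * l2norm (I (Suc q)) u)"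
    by (elim exE)
  then have N: "N > 0" "0 \<le> r" "r < 1" by simp_all
  have c: "l2norm (I (Suc q)) (\<lambda>i. P.evaluate u (laplace_step G (I (Suc q)) ?J P.row_in P.row_out N i))
      \<le> r * l2norm (I (Suc q)) u" for u
    using Nr by simp
  show ?thesis
  proof (rule S.rows_exact)
    fix w assume w: "\<And>t. t \<in> ?J \<Longrightarrow> S.evaluate w (S.row_out t) = 0"
    show "\<exists>x. \<forall>i\<in>I (Suc q). w i = S.evaluate x (S.row_in i)"
      by (rule weak_containment_exactness[OF \<sigma> \<pi> wc fin P.row_in_free P.row_out_free
            S.row_out_row_in N c w])
  qed
qed

section \<open>Inhomogeneous cochains\<close>

context unitary_representation
begin

lemma coboundary_eq_evaluate:
  assumes "gs \<in> group_power G (Suc n)"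
  shows "coboundary G \<pi> n c gs = evaluate c (bar_boundary G (Suc n) (gen G gs))"
proof -
  interpret F: rational_rep G "scale_chain" "translate G :: 'g \<Rightarrow> ('g list, 'g) chain \<Rightarrow> _"
    by (rule rational_rep_translate[OF is_group])
  have "evaluate c (single (tl gs, hd gs) 1) = \<pi> (hd gs) (c (tl gs))"
    by (simp add: ext_act_def)
  moreover have "evaluate c (scale_chain r (gen G hs)) = of_rat r *\<^sub>R c hs" for r hs
    unfolding evaluate_chain_scale ext_act_gen ..
  ultimately show ?thesis
    using assms unfolding bar_boundary.simps F.ext_act_gen bar_face_sum_def
    by (simp add: coboundary_def evaluate_chain_add evaluate_chain_diff evaluate_chain_sum of_rat_power of_rat_minus
        del: scale_chain_single)
qed

abbreviation bar_chains :: "nat \<Rightarrow> ('g list, 'g) chain set" where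
  "bar_chains n \<equiv> free_chains G (group_power G n)"

lemma bar_ext:
  assumes z: "equivariant (bar_chains n) z"
    and x: "x \<in> bar_chains n"
  shows "z x = evaluate (\<lambda>gs\<in>group_power G n. z (gen G gs)) x"
proof -
  have "z x = evaluate (\<lambda>gs. z (gen G gs)) x" by (rule equivariant_eq_ext_act[OF z x])
  also have "\<dots> = evaluate (\<lambda>gs\<in>group_power G n. z (gen G gs)) x" by (rule evaluate_cong[OF x]) simp
  finally show ?thesis .
qed

lemma evaluate_coboundary:
  assumes x: "x \<in> bar_chains (Suc n)"
  shows "evaluate (coboundary G \<pi> n c) x = evaluate c (bar_boundary G (Suc n) x)"
proof -
  have "evaluate (coboundary G \<pi> n c) x = evaluate (\<lambda>gs. evaluate c (bar_boundary G (Suc n) (gen G gs))) x"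
    by (rule evaluate_cong[OF x coboundary_eq_evaluate])
  also have "\<dots> = evaluate c (bar_boundary G (Suc n) x)"
    using bar_boundary_hom[OF is_group, of "Suc n"] x
    by (intro evaluate_comp_hom[of "group_power G (Suc n)" "group_power G n"]) simp_all
  finally show ?thesis .
qed

lemma gen_group_power: "gs \<in> group_power G n \<Longrightarrow> gen G gs \<in> bar_chains n"
  by (rule gen_in_free_chains[OF is_group])

lemma cocycles_iff:
  "c \<in> cocycles G \<pi> q \<longleftrightarrow> c \<in> extensional (group_power G q) \<and>
     (\<forall>x\<in>bar_chains (Suc q). evaluate c (bar_boundary G (Suc q) x) = 0)"
proof -
  have "coboundary G \<pi> q c = (\<lambda>gs\<in>group_power G (Suc q). 0) \<longleftrightarrow>
     (\<forall>x\<in>bar_chains (Suc q). evaluate c (bar_boundary G (Suc q) x) = 0)"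
  proof
    assume eq: "coboundary G \<pi> q c = (\<lambda>gs\<in>group_power G (Suc q). 0)"
    show "\<forall>x\<in>bar_chains (Suc q). evaluate c (bar_boundary G (Suc q) x) = 0"
    proof
      fix x assume x: "x \<in> bar_chains (Suc q)"
      show "evaluate c (bar_boundary G (Suc q) x) = 0"
        unfolding evaluate_coboundary[OF x, symmetric] by (rule evaluate_zero[OF x]) (simp add: eq)
    qed
  next
    assume z: "\<forall>x\<in>bar_chains (Suc q). evaluate c (bar_boundary G (Suc q) x) = 0"
    show "coboundary G \<pi> q c = (\<lambda>gs\<in>group_power G (Suc q). 0)"
    proof
      fix gs show "coboundary G \<pi> q c gs = (\<lambda>gs\<in>group_power G (Suc q). 0) gs"
      proof (cases "gs \<in> group_power G (Suc q)")
        case True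
        then show ?thesis using z gen_group_power[OF True] by (simp only: coboundary_eq_evaluate restrict_apply' )
      next
        case False then show ?thesis by (simp add: coboundary_def)
      qed
    qed
  qed
  then show ?thesis by (simp add: cocycles_def cochain_group_def PiE_UNIV_domain PiE_def)
qed

lemma evaluate_zero_cochain: "x \<in> bar_chains q \<Longrightarrow> evaluate (\<lambda>gs\<in>group_power G q. 0) x = 0"
  by (erule evaluate_zero) simp

lemma equivariant_on_zero: "equivariant Y (\<lambda>_. 0)"
proof -
  have "\<pi> g 0 = 0" if "g \<in> carrier G" for g using rep_add[OF that, of 0 0] by simp
  then show ?thesis by (simp add: equivariant_on_def scale_rat_def)
qed

text \<open>With the shift of degrees this covers degree zero, where \<open>bar_module G 0\<close> vanishes and the condition
  forces \<open>c = 0\<close>.\<close>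

lemma coboundaries_iff:
  "c \<in> coboundaries G \<pi> q \<longleftrightarrow> c \<in> extensional (group_power G q) \<and>
     (\<exists>b. equivariant (bar_module G q) b \<and>
        (\<forall>x\<in>bar_chains q. evaluate c x = b (bar_boundary G q x)))"
  (is "_ \<longleftrightarrow> ?ext \<and> (\<exists>b. ?bounds b)")
proof (cases q)
  case 0
  show ?thesis
  proof
    assume "c \<in> coboundaries G \<pi> q"
    then have c: "c = (\<lambda>gs\<in>group_power G q. 0)" using 0 by (simp add: cochain_group_def)
    then show "?ext \<and> (\<exists>b. ?bounds b)"
      using equivariant_on_zero evaluate_zero_cochain by (intro conjI exI[of _ "\<lambda>_. 0"]) auto
  next
    assume R: "?ext \<and> (\<exists>b. ?bounds b)"
    then obtain b where b: "?bounds b" by blast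
    have "b 0 = 0" by (rule equivariant_zero[OF conjunct1[OF b]]) (simp add: free_chains_def)
    then have "c gs = 0" if "gs \<in> group_power G q" for gs
      using b gen_group_power[OF that] 0 ext_act_gen[of c gs] by fastforce
    then have "c = (\<lambda>gs\<in>group_power G q. 0)" using R by (auto simp: extensional_def fun_eq_iff)
    then show "c \<in> coboundaries G \<pi> q" using 0 by (simp add: cochain_group_def)
  qed
next
  case (Suc p)
  show ?thesis
  proof
    assume "c \<in> coboundaries G \<pi> q"
    then obtain d where d: "c = coboundary G \<pi> p d" using Suc by auto
    have "?bounds (evaluate d)"
      unfolding d Suc using ext_act_equivariant evaluate_coboundary by blast
    moreover have ?ext using d Suc by (simp add: coboundary_def)
    ultimately show "?ext \<and> (\<exists>b. ?bounds b)" by blast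
  next
    assume R: "?ext \<and> (\<exists>b. ?bounds b)"
    then obtain b where b: "equivariant (bar_chains p) b"
      "\<forall>x\<in>bar_chains q. evaluate c x = b (bar_boundary G q x)" using Suc by auto
    define d where "d = (\<lambda>gs\<in>group_power G p. b (gen G gs))"
    have "c gs = coboundary G \<pi> p d gs" for gs
    proof (cases "gs \<in> group_power G q")
      case True
      have "bar_boundary G q (gen G gs) \<in> bar_chains p"
        using chain_homD(4)[OF bar_boundary_hom[OF is_group, of q], of "gen G gs"] gen_group_power[OF True] Suc by simp
      then have "c gs = evaluate d (bar_boundary G q (gen G gs))"
        using b(2)[rule_format, OF gen_group_power[OF True]] bar_ext[OF b(1)] by (simp add: d_def)
      then show ?thesis using coboundary_eq_evaluate[of gs p d] True Suc by simp
    next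
      case False
      then show ?thesis using R Suc by (simp add: extensional_def coboundary_def)
    qed
    then have "c = coboundary G \<pi> p d" by (rule ext)
    moreover have "d \<in> carrier (cochain_group G p)" by (simp add: d_def cochain_group_def)
    ultimately show "c \<in> coboundaries G \<pi> q" using Suc by simp
  qed
qed

lemma coboundaries_subset_cocycles: "c \<in> coboundaries G \<pi> q \<Longrightarrow> c \<in> cocycles G \<pi> q"
proof -
  assume c: "c \<in> coboundaries G \<pi> q"
  then obtain b where b: "equivariant (bar_module G q) b"
    "\<forall>x\<in>bar_chains q. evaluate c x = b (bar_boundary G q x)"
    unfolding coboundaries_iff by blast
  have "evaluate c (bar_boundary G (Suc q) x) = 0" if x: "x \<in> bar_chains (Suc q)" for x
  proof -
    have "bar_boundary G (Suc q) x \<in> bar_chains q"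
      using chain_homD(4)[OF bar_boundary_hom[OF is_group, of "Suc q"], of x] x by simp
    then have "evaluate c (bar_boundary G (Suc q) x) = b (bar_boundary G q (bar_boundary G (Suc q) x))" using b(2) by blast
    also have "bar_boundary G q (bar_boundary G (Suc q) x) = 0"
      using bar_boundary_boundary[OF is_group, of x q] x by simp
    also have "b 0 = 0" by (rule equivariant_zero[OF b(1)]) (simp add: free_chains_def)
    finally show ?thesis .
  qed
  then show ?thesis using c unfolding cocycles_iff coboundaries_iff by blast
qed

lemma coboundaries_combine:
  assumes c: "c \<in> coboundaries G \<pi> q" and d: "d \<in> coboundaries G \<pi> q"
  shows "(\<lambda>gs\<in>group_power G q. c gs + d gs) \<in> coboundaries G \<pi> q"
    and "(\<lambda>gs\<in>group_power G q. c gs - d gs) \<in> coboundaries G \<pi> q"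
proof -
  obtain b where b: "equivariant (bar_module G q) b"
    "\<forall>x\<in>bar_chains q. evaluate c x = b (bar_boundary G q x)"
    using c unfolding coboundaries_iff by blast
  obtain b' where b': "equivariant (bar_module G q) b'"
    "\<forall>x\<in>bar_chains q. evaluate d x = b' (bar_boundary G q x)"
    using d unfolding coboundaries_iff by blast
  have diff: "(\<lambda>gs\<in>group_power G q. c gs - d gs) \<in> coboundaries G \<pi> q"
    if b: "equivariant (bar_module G q) b"
    "\<forall>x\<in>bar_chains q. evaluate c x = b (bar_boundary G q x)"
    and b': "equivariant (bar_module G q) b'"
    "\<forall>x\<in>bar_chains q. evaluate d x = b' (bar_boundary G q x)" for c d b b'
    unfolding coboundaries_iff
  proof (intro conjI exI ballI)
    show "equivariant (bar_module G q) (\<lambda>x. b x - b' x)"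
      by (rule equivariant_on_diff[OF b(1) b'(1)])
    fix x assume x: "x \<in> bar_chains q"
    have "evaluate (\<lambda>gs\<in>group_power G q. c gs - d gs) x = evaluate (c - d) x"
      by (rule evaluate_cong[OF x]) simp
    then show "evaluate (\<lambda>gs\<in>group_power G q. c gs - d gs) x = b (bar_boundary G q x) - b' (bar_boundary G q x)"
      using x b(2) b'(2) by (simp add: evaluate_diff[OF x])
  qed simp
  show "(\<lambda>gs\<in>group_power G q. c gs - d gs) \<in> coboundaries G \<pi> q"
    by (rule diff[OF b b'])
  have "(\<lambda>gs\<in>group_power G q. (0 - d) gs) \<in> coboundaries G \<pi> q"
    using diff[OF equivariant_on_zero _ b', of 0] evaluate_zero[of _ _ 0] by auto
  then obtain b'' where b'': "equivariant (bar_module G q) b''"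
    "\<forall>x\<in>bar_chains q. evaluate (\<lambda>gs\<in>group_power G q. (0 - d) gs) x = b'' (bar_boundary G q x)"
    unfolding coboundaries_iff by blast
  from diff[OF b b''] show "(\<lambda>gs\<in>group_power G q. c gs + d gs) \<in> coboundaries G \<pi> q"
    by (simp add: restrict_def cong: if_cong)
qed

lemma zero_coboundary: "(\<lambda>gs\<in>group_power G q. 0) \<in> coboundaries G \<pi> q"
  unfolding coboundaries_iff
  using equivariant_on_zero evaluate_zero_cochain by (intro conjI exI[of _ "\<lambda>_. 0"]) auto

abbreviation "cls q c \<equiv> coboundaries G \<pi> q #>\<^bsub>cocycle_group G \<pi> q\<^esub> c"

lemma cls_eq: "cls q c = (\<lambda>b. \<lambda>gs\<in>group_power G q. b gs + c gs) ` coboundaries G \<pi> q"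
  by (auto simp: r_coset_def cocycle_group_def cochain_group_def)

lemma cls_self: "c \<in> cocycles G \<pi> q \<Longrightarrow> c \<in> cls q c"
proof -
  assume "c \<in> cocycles G \<pi> q"
  then have "c \<in> extensional (group_power G q)" by (simp add: cocycles_iff)
  then have "c = (\<lambda>gs\<in>group_power G q. (\<lambda>gs\<in>group_power G q. 0) gs + c gs)"
    by (auto simp: extensional_def fun_eq_iff)
  then show ?thesis unfolding cls_eq using zero_coboundary by blast
qed

lemma cls_coboundary:
  assumes c: "c \<in> coboundaries G \<pi> q" shows "cls q c = coboundaries G \<pi> q"
proof
  show "cls q c \<subseteq> coboundaries G \<pi> q" unfolding cls_eq using coboundaries_combine(1)[OF _ c] by blast
  show "coboundaries G \<pi> q \<subseteq> cls q c"
  proof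
    fix b assume b: "b \<in> coboundaries G \<pi> q"
    then have "b \<in> extensional (group_power G q)" by (simp add: coboundaries_iff)
    then have "b = (\<lambda>gs\<in>group_power G q. (\<lambda>gs\<in>group_power G q. b gs - c gs) gs + c gs)"
      by (auto simp: extensional_def fun_eq_iff)
    then show "b \<in> cls q c" unfolding cls_eq using coboundaries_combine(2)[OF b c] by blast
  qed
qed

lemma cls_eq_zero_iff: "c \<in> cocycles G \<pi> q \<Longrightarrow> cls q c = coboundaries G \<pi> q \<longleftrightarrow> c \<in> coboundaries G \<pi> q"
  using cls_self cls_coboundary by blast

lemma carrier_cohomology: "carrier (cohomology G \<pi> q) = cls q ` cocycles G \<pi> q"
  by (auto simp: cohomology_def FactGroup_def RCOSETS_def cocycle_group_def)

lemma one_cohomology: "\<one>\<^bsub>cohomology G \<pi> q\<^esub> = coboundaries G \<pi> q"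
  by (simp add: cohomology_def FactGroup_def)

lemma zero_in_carrier_cohomology: "coboundaries G \<pi> q \<in> carrier (cohomology G \<pi> q)"
  unfolding carrier_cohomology
  using cls_coboundary[OF zero_coboundary] coboundaries_subset_cocycles[OF zero_coboundary] by (metis imageI)

lemma cohomology_nonzero_iff: "cohomology_nonzero G \<pi> q \<longleftrightarrow> \<not> cocycles G \<pi> q \<subseteq> coboundaries G \<pi> q"
proof -
  have "carrier (cohomology G \<pi> q) = {coboundaries G \<pi> q} \<longleftrightarrow> (\<forall>c\<in>cocycles G \<pi> q. cls q c = coboundaries G \<pi> q)"
    using zero_in_carrier_cohomology[of q] unfolding carrier_cohomology by blast
  then show ?thesis by (auto simp: cohomology_nonzero_def one_cohomology cls_eq_zero_iff)
qed

lemma cohomology_zero_iff_exact: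
  "\<not> cohomology_nonzero G \<pi> q \<longleftrightarrow>
    exact_at G scale_rat \<pi> (bar_module G) (bar_boundary G) q"
proof
  assume "\<not> cohomology_nonzero G \<pi> q"
  then have sub: "cocycles G \<pi> q \<subseteq> coboundaries G \<pi> q" by (simp add: cohomology_nonzero_iff)
  show "exact_at G scale_rat \<pi> (bar_module G) (bar_boundary G) q"
    unfolding exact_at_def
  proof (intro allI impI)
    fix z assume "equivariant (bar_module G (Suc q)) z"
      and zD: "\<forall>x\<in>bar_module G (Suc (Suc q)). z (bar_boundary G (Suc q) x) = 0"
    then have z: "equivariant (bar_chains q) z" by simp
    define c where "c = (\<lambda>gs\<in>group_power G q. z (gen G gs))"
    have zc: "z x = evaluate c x" if "x \<in> bar_chains q" for x
      unfolding c_def by (rule bar_ext[OF z that])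
    have "evaluate c (bar_boundary G (Suc q) x) = 0" if x: "x \<in> bar_chains (Suc q)" for x
    proof -
      have "bar_boundary G (Suc q) x \<in> bar_chains q"
        using chain_homD(4)[OF bar_boundary_hom[OF is_group, of "Suc q"], of x] x by simp
      from zc[OF this, symmetric] show ?thesis
        using zD x by (simp del: bar_boundary.simps)
    qed
    then have "c \<in> cocycles G \<pi> q" by (simp add: cocycles_iff c_def del: bar_boundary.simps)
    then have "c \<in> coboundaries G \<pi> q" using sub by blast
    then show "\<exists>b. equivariant (bar_module G q) b \<and>
        (\<forall>x\<in>bar_module G (Suc q). z x = b (bar_boundary G q x))"
      using zc unfolding coboundaries_iff by auto
  qed
next
  assume ex: "exact_at G scale_rat \<pi> (bar_module G) (bar_boundary G) q"
  have "c \<in> coboundaries G \<pi> q" if c: "c \<in> cocycles G \<pi> q" for c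
  proof -
    have "equivariant (bar_module G (Suc q)) (evaluate c)"
      by (rule ext_act_equivariant)
    moreover have "\<forall>x\<in>bar_module G (Suc (Suc q)). evaluate c (bar_boundary G (Suc q) x) = 0"
      using c by (simp add: cocycles_iff del: bar_boundary.simps)
    ultimately have "\<exists>b. equivariant (bar_module G q) b \<and>
        (\<forall>x\<in>bar_module G (Suc q). evaluate c x = b (bar_boundary G q x))"
      using ex unfolding exact_at_def by blast
    then show ?thesis using c by (simp add: coboundaries_iff cocycles_iff)
  qed
  then show "\<not> cohomology_nonzero G \<pi> q" by (auto simp: cohomology_nonzero_iff)
qed

section \<open>The topology of cohomology\<close>

lemma topspace_cocycles: "topspace (subtopology (cochain_topology G q) (cocycles G \<pi> q)) = cocycles G \<pi> q"
  by (auto simp: cochain_topology_def cocycles_def cochain_group_def)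

lemma topspace_cohomology: "topspace (cohomology_topology G \<pi> q) = carrier (cohomology G \<pi> q)"
proof -
  have "cls q ` topspace (subtopology (cochain_topology G q) (cocycles G \<pi> q)) = topspace (cohomology_topology G \<pi> q)"
    unfolding cohomology_topology_def by (rule quotient_imp_surjective_map[OF quotient_map_quotient_topology])
  then show ?thesis unfolding topspace_cocycles carrier_cohomology ..
qed

lemma torsion_subset: "torsion_cohomology G \<pi> q \<subseteq> carrier (cohomology G \<pi> q)"
  unfolding torsion_cohomology_def topspace_cohomology[symmetric] by (rule closure_of_subset_topspace)

lemma zero_in_torsion: "coboundaries G \<pi> q \<in> torsion_cohomology G \<pi> q"
  unfolding torsion_cohomology_def one_cohomology
  using closure_of_subset[of "{coboundaries G \<pi> q}" "cohomology_topology G \<pi> q"] zero_in_carrier_cohomology[of q]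
  by (simp add: topspace_cohomology)

lemma torsion_nonzero_imp_nonzero: "torsion_cohomology_nonzero G \<pi> q \<Longrightarrow> cohomology_nonzero G \<pi> q"
  unfolding torsion_cohomology_nonzero_def cohomology_nonzero_def one_cohomology
  using torsion_subset[of q] zero_in_torsion[of q] by auto

text \<open>If the closure of zero is just \<open>{0}\<close>, the Hausdorff quotient consists of singletons, and so it is
  trivial only if every class is zero.\<close>

lemma hausdorff_and_torsion_zero:
  assumes h: "\<not> hausdorff_cohomology_nonzero G \<pi> q" and t: "\<not> torsion_cohomology_nonzero G \<pi> q"
  shows "\<not> cohomology_nonzero G \<pi> q"
proof -
  let ?B = "coboundaries G \<pi> q"
  have T: "torsion_cohomology G \<pi> q = {?B}" using t by (simp add: torsion_cohomology_nonzero_def one_cohomology)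
  have "carrier (hausdorff_cohomology G \<pi> q) = {{?B}}"
    using h by (simp add: hausdorff_cohomology_nonzero_def hausdorff_cohomology_def FactGroup_def T)
  then have cosets: "rcosets\<^bsub>cohomology G \<pi> q\<^esub> {?B} = {{?B}}"
    by (simp add: hausdorff_cohomology_def FactGroup_def T)
  have "c \<in> ?B" if c: "c \<in> cocycles G \<pi> q" for c
  proof -
    have "cls q c \<in> carrier (cohomology G \<pi> q)" using c by (simp add: carrier_cohomology)
    then have "{?B} #>\<^bsub>cohomology G \<pi> q\<^esub> cls q c \<in> rcosets\<^bsub>cohomology G \<pi> q\<^esub> {?B}"
      unfolding RCOSETS_def by blast
    then have "{?B} #>\<^bsub>cohomology G \<pi> q\<^esub> cls q c = {?B}" using cosets by blast
    then have "?B <#>\<^bsub>cocycle_group G \<pi> q\<^esub> cls q c = ?B"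
      by (simp add: r_coset_def cohomology_def FactGroup_def)
    moreover have "(\<lambda>gs\<in>group_power G q. 0) \<otimes>\<^bsub>cocycle_group G \<pi> q\<^esub> c \<in> ?B <#>\<^bsub>cocycle_group G \<pi> q\<^esub> cls q c"
      using zero_coboundary cls_self[OF c] unfolding set_mult_def by blast
    moreover have "(\<lambda>gs\<in>group_power G q. 0) \<otimes>\<^bsub>cocycle_group G \<pi> q\<^esub> c = c"
      using c by (auto simp: cocycle_group_def cochain_group_def cocycles_iff extensional_def fun_eq_iff)
    ultimately show ?thesis by simp
  qed
  then show ?thesis by (auto simp: cohomology_nonzero_iff)
qed

text \<open>A neighbourhood of \<open>c\<close> in the product topology restricts only finitely many values, so it contains a
  coboundary; thus every neighbourhood of the class of \<open>c\<close> contains zero.\<close>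

lemma approximable_in_torsion:
  assumes c: "c \<in> cocycles G \<pi> q"
    and app: "\<And>T e. finite T \<Longrightarrow> T \<subseteq> group_power G q \<Longrightarrow> e > 0 \<Longrightarrow>
        \<exists>d\<in>coboundaries G \<pi> q. \<forall>gs\<in>T. norm (c gs - d gs) < (e :: real)"
  shows "cls q c \<in> torsion_cohomology G \<pi> q"
  unfolding torsion_cohomology_def in_closure_of topspace_cohomology one_cohomology
proof (intro conjI allI impI)
  show "cls q c \<in> carrier (cohomology G \<pi> q)" using c by (simp add: carrier_cohomology)
  fix U assume U: "cls q c \<in> U \<and> openin (cohomology_topology G \<pi> q) U"
  then have "openin (subtopology (cochain_topology G q) (cocycles G \<pi> q)) {x \<in> cocycles G \<pi> q. cls q x \<in> U}"
    unfolding cohomology_topology_def openin_quotient_topology topspace_cocycles by blast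
  then obtain W where W: "openin (cochain_topology G q) W" "{x \<in> cocycles G \<pi> q. cls q x \<in> U} = W \<inter> cocycles G \<pi> q"
    unfolding openin_subtopology by blast
  have "c \<in> W" using W(2) c U by blast
  with W(1) obtain N where N: "finite {gs \<in> group_power G q. N gs \<noteq> (UNIV :: 'v set)}" "\<And>gs. gs \<in> group_power G q \<Longrightarrow> open (N gs)"
    "c \<in> Pi\<^sub>E (group_power G q) N" "Pi\<^sub>E (group_power G q) N \<subseteq> W"
    unfolding cochain_topology_def openin_product_topology_alt by auto
  define T where "T = {gs \<in> group_power G q. N gs \<noteq> (UNIV :: 'v set)}"
  have "\<exists>e>0. \<forall>gs\<in>T'. \<forall>v. norm (c gs - v) < e \<longrightarrow> v \<in> N gs" if "finite T'" "T' \<subseteq> T" for T'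
    using that
  proof (induction T' rule: finite_induct)
    case empty then show ?case by (intro exI[of _ 1]) simp
  next
    case (insert gs T')
    then obtain e where e: "e > 0" "\<forall>gs\<in>T'. \<forall>v. norm (c gs - v) < e \<longrightarrow> v \<in> N gs" by blast
    have gs: "gs \<in> group_power G q" using insert by (auto simp: T_def)
    then have "open (N gs)" "c gs \<in> N gs" using N(2,3) by auto
    then obtain e' where e': "e' > 0" "\<forall>v. dist v (c gs) < e' \<longrightarrow> v \<in> N gs" unfolding open_dist by blast
    show ?case
      using e e' by (intro exI[of _ "min e e'"]) (auto simp: dist_norm norm_minus_commute)
  qed
  from this[OF N(1)[folded T_def] subset_refl] obtain e where
    "e > 0 \<and> (\<forall>gs\<in>T. \<forall>v. norm (c gs - v) < e \<longrightarrow> v \<in> N gs)" ..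
  then have e: "e > 0" "\<And>gs v. gs \<in> T \<Longrightarrow> norm (c gs - v) < e \<Longrightarrow> v \<in> N gs" by simp_all
  obtain d where d: "d \<in> coboundaries G \<pi> q" "\<forall>gs\<in>T. norm (c gs - d gs) < e"
    using app[OF N(1)[folded T_def] _ e(1)] by (auto simp: T_def)
  have "d \<in> Pi\<^sub>E (group_power G q) N"
  proof (rule PiE_I)
    fix gs assume "gs \<in> group_power G q"
    then show "d gs \<in> N gs" using e(2) d(2) by (cases "gs \<in> T") (auto simp: T_def)
  next
    fix gs assume "gs \<notin> group_power G q"
    then show "d gs = undefined" using d(1) by (simp add: coboundaries_iff extensional_def)
  qed
  then have "d \<in> W \<inter> cocycles G \<pi> q" using N(4) coboundaries_subset_cocycles[OF d(1)] by blast
  then have "cls q d \<in> U" using W(2) by blast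
  then show "\<exists>y. y \<in> {coboundaries G \<pi> q} \<and> y \<in> U" using cls_coboundary[OF d(1)] by simp
qed

text \<open>An approximable equivariant map on the bar resolution restricts to a cocycle whose class is torsion.\<close>

lemma torsion_zero_imp_closed:
  assumes t: "\<not> torsion_cohomology_nonzero G \<pi> (Suc q)"
  shows "closed_at G scale_rat \<pi> (bar_module G) (bar_boundary G) (Suc q)"
  unfolding closed_at_def
proof (intro allI impI)
  interpret B: resolution G "bar_index G" "\<lambda>n. bar_module G n" "\<lambda>n x. x" "bar_boundary G" augmentation
    by (rule resolution_bar[OF is_group])
  let ?p = "Suc q"
  fix z assume "equivariant (bar_module G (Suc ?p)) z"
    and app: "\<forall>T e. finite T \<longrightarrow> T \<subseteq> bar_module G (Suc ?p) \<longrightarrow> e > 0 \<longrightarrow>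
       (\<exists>b. equivariant (bar_module G ?p) b \<and>
         (\<forall>x\<in>T. norm (z x - b (bar_boundary G ?p x)) < (e::real)))"
  then have z: "equivariant (bar_chains ?p) z" by simp
  define c where "c = (\<lambda>gs\<in>group_power G ?p. z (gen G gs))"
  have zc: "z x = evaluate c x" if "x \<in> bar_chains ?p" for x
    unfolding c_def by (rule bar_ext[OF z that])
  have "evaluate c (bar_boundary G (Suc ?p) x) = 0" if x: "x \<in> bar_chains (Suc ?p)" for x
  proof -
    have "bar_boundary G (Suc ?p) x \<in> bar_chains ?p"
      using chain_homD(4)[OF bar_boundary_hom[OF is_group, of "Suc ?p"], of x] x by simp
    moreover have "z (bar_boundary G (Suc ?p) x) = 0"
      by (rule B.approximable_imp_cocycle[OF rational_rep_axioms]) (use app x in \<open>simp_all del: bar_boundary.simps\<close>)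
    ultimately show ?thesis using zc by metis
  qed
  then have c: "c \<in> cocycles G \<pi> ?p" by (simp add: cocycles_iff c_def del: bar_boundary.simps)
  have "cls ?p c \<in> torsion_cohomology G \<pi> ?p"
  proof (rule approximable_in_torsion[OF c])
    fix T and e :: real assume T: "finite T" "T \<subseteq> group_power G ?p" "e > 0"
    let ?T = "(\<lambda>gs. gen G gs) ` T"
    have "?T \<subseteq> bar_module G (Suc ?p)" using T(2) gen_group_power by auto
    then obtain b where b: "equivariant (bar_module G ?p) b"
      "\<forall>x\<in>?T. norm (z x - b (bar_boundary G ?p x)) < e"
      using app T(1,3) by (meson finite_imageI)
    define d where "d = (\<lambda>gs\<in>group_power G ?p. b (bar_boundary G ?p (gen G gs)))"
    have "equivariant (bar_chains ?p) (\<lambda>x. b (bar_boundary G ?p x))"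
      using equivariant_on_comp[OF bar_boundary_hom[OF is_group, of ?p] b(1)] by simp
    from bar_ext[OF this] have "d \<in> coboundaries G \<pi> ?p"
      unfolding coboundaries_iff d_def using b(1) by auto
    moreover have "norm (c gs - d gs) < e" if "gs \<in> T" for gs
      using b(2) that T(2) by (auto simp: c_def d_def simp del: bar_boundary.simps)
    ultimately show "\<exists>d\<in>coboundaries G \<pi> ?p. \<forall>gs\<in>T. norm (c gs - d gs) < e" by blast
  qed
  then have "cls ?p c = coboundaries G \<pi> ?p"
    using t by (simp add: torsion_cohomology_nonzero_def one_cohomology)
  then have "c \<in> coboundaries G \<pi> ?p" using cls_eq_zero_iff[OF c] by blast
  then show "\<exists>b. equivariant (bar_module G ?p) b \<and>
        (\<forall>x\<in>bar_module G (Suc ?p). z x = b (bar_boundary G ?p x))"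
    using zc unfolding coboundaries_iff by auto
qed

end

theorem theorem17:
  fixes G :: "('g, 'x) monoid_scheme"
    and \<sigma> :: "'g \<Rightarrow> 'w::separable_complex_hilbert_space \<Rightarrow> 'w"
    and \<pi> :: "'g \<Rightarrow> 'v::separable_complex_hilbert_space \<Rightarrow> 'v"
    and q :: nat
  assumes "group G" and "countable (carrier G)"
    and "type_FP_infinity_rat TYPE('m) G"
    and "unitary_rep G \<sigma>"
    and "cohomology_nonzero G \<sigma> q"
    and "unitary_rep G \<pi>"
    and "weakly_contains G \<pi> \<sigma>"
  shows "(hausdorff_cohomology_nonzero G \<pi> q
           \<or> torsion_cohomology_nonzero G \<pi> q
           \<or> torsion_cohomology_nonzero G \<pi> (q + 1))
         \<and> (cohomology_nonzero G \<pi> q \<or> cohomology_nonzero G \<pi> (q + 1))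
         \<and> (\<not> cohomology_nonzero G \<pi> q \<longrightarrow> torsion_cohomology_nonzero G \<pi> (q + 1))"
proof -
  interpret group G by fact
  have \<sigma>: "unitary_representation G \<sigma>" and \<pi>: "unitary_representation G \<pi>"
    using assms(4,6) by unfold_locales
  interpret S: unitary_representation G \<sigma> by fact
  interpret P: unitary_representation G \<pi> by fact
  note bar = resolution_bar[OF assms(1)]
  obtain I :: "nat \<Rightarrow> 'm set" and X E D \<epsilon> where res: "resolution G I X E D \<epsilon>" and fin: "\<And>n. finite (I n)"
    using finite_resolution_exists[OF assms(1,3)] by metis
  have torsion: "torsion_cohomology_nonzero G \<pi> (q + 1)" if zero: "\<not> cohomology_nonzero G \<pi> q"
  proof (rule ccontr)
    assume "\<not> torsion_cohomology_nonzero G \<pi> (q + 1)"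
    then have "closed_at G scale_rat \<pi> (bar_module G) (bar_boundary G) (Suc q)"
      by (intro P.torsion_zero_imp_closed) simp
    then have cl: "closed_at G scale_rat \<pi> X D (Suc q)"
      by (rule closed_at_transfer[OF P.rational_rep_axioms bar res])
    have ex: "exact_at G scale_rat \<pi> X D q"
      using zero unfolding P.cohomology_zero_iff_exact by (rule P.exact_at_transfer[OF bar res])
    have "exact_at G scale_rat \<sigma> X D q"
      by (rule finite_resolution_weak_containment[OF res fin \<sigma> \<pi> assms(7) ex cl])
    then have "exact_at G scale_rat \<sigma> (bar_module G) (bar_boundary G) q"
      by (rule S.exact_at_transfer[OF res bar])
    then show False using assms(5) S.cohomology_zero_iff_exact by blast
  qed
  then show ?thesis
    using P.hausdorff_and_torsion_zero[of q] P.torsion_nonzero_imp_nonzero[of "q + 1"] by blast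
qed

end
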